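(* Let $a>0$ and $w>0$, and let $Q^{[0,a],L}_{\log,w,n}[f]$ be the new Levin approximation of $\int_0^a f(x)\log(x)e^{iwx}\,dx$ based on the $n$ Chebyshev–Gauss–Lobatto points mapped to $[0,a]$ (as defined in the context), with absolute error $$E_n(f):=\left|\int_0^a f(x)\log(x)e^{iwx}\,dx-Q^{[0,a],L}_{\log,w,n}[f]\right|.$$ (i) Suppose that $f,f',\dots,f^{(k-1)}$ are absolutely continuous on $[0,a]$ and $\int_0^a\frac{|f^{(k)}(t)|}{\sqrt{at-t^2}}\,dt=V_k<\infty$ for some $k\ge1$. Then, for $n\ge k+2$ and $k>4$, $$E_n(f)\le C\,(1+|\ln(w)|)\,w^{-2}\,\frac{n(n-1)}{(n-3)(n-4)\cdots(n-k)},$$ where $C$ is a constant independent of $n$ and $w$. (ii) If the function $z\mapsto f((z+1)a/2)$ is analytic with $|f((z+1)a/2)|\le M$ in the region bounded by the ellipse with foci $\pm1$ and major and minor semiaxis lengths summing to $\rho>1$, then for each $n\ge2$, $$E_n(f)\le C\,(1+|\ln(w)|)\,w^{-2}\,n^4\rho^{-(n-1)},$$ where $C$ is a constant independent of $n$, $\rho$ and $w$.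
   Context: Nodes: $\hat x_j:=\frac a2\left(1-\cos\frac{j\pi}{n-1}\right)$, $j=0,1,\dots,n-1$. New Levin method (linear oscillator $g(x)=x$) based on the points $\hat x_0,\dots,\hat x_{n-1}$, all linear systems being solved exactly: (1) $\hat q_1$ is the polynomial of degree at most $n-1$ with $\hat q_1'(\hat x_j)+iw\,\hat q_1(\hat x_j)=f(\hat x_j)$ for $j=0,\dots,n-1$. (2) $\hat q_2(x):=\frac{\hat q_1(x)-\hat q_1(0)}{x}$ for $x\ne0$ and $\hat q_2(0):=\hat q_1'(0)$; this is a polynomial. (3) $\hat h_1$ is the polynomial of degree at most $n-1$ with $\hat h_1'(\hat x_j)+iw\,\hat h_1(\hat x_j)=-\hat q_2(\hat x_j)$ for $j=0,\dots,n-1$. (4) $\hat h_2(x):=\hat q_1(0)e^{-iwx}\left(\gamma+\Gamma(0,-iwx)+\operatorname{Log}(-iwx)\right)$ for $x\neq0$ and $\hat h_2(0):=0$, where $\gamma$ is Euler's constant, $\operatorname{Log}(z)=\log|z|+i\arg(z)$ is the principal logarithm, and $\Gamma(0,z)=\int_z^\infty e^{-t}t^{-1}\,dt$ is the complementary incomplete Gamma function (principal branch), with $\Gamma(0,z)=-\gamma-\operatorname{Log}(z)-\sum_{j\ge1}\frac{(-z)^j}{j\,(j!)}$. (5) $$Q^{[0,a],L}_{\log,w,n}[f]:=e^{iwa}\big(\hat q_1(a)\log a+\hat h_1(a)+\hat h_2(a)\big)-\big(\hat q_1(0)\log a+\hat h_1(0)\big).$$ *)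

theory Defs
  imports "HOL-Analysis.Analysis" "HOL-Complex_Analysis.Complex_Analysis"
    "HOL-Computational_Algebra.Polynomial"
begin

definition cgl_node :: "real \<Rightarrow> nat \<Rightarrow> nat \<Rightarrow> real" where
  "cgl_node a n j = a / 2 * (1 - cos (real j * pi / (real n - 1)))"

text \<open>For \<open>w \<noteq> 0\<close> and distinct nodes there is exactly one such polynomial: if \<open>deg p \<le> n - 1\<close>,
  then \<open>p' + i w p\<close> also has degree at most \<open>n - 1\<close>, and it vanishes only for \<open>p = 0\<close>.\<close>

definition levin_poly :: "real \<Rightarrow> real \<Rightarrow> nat \<Rightarrow> (real \<Rightarrow> complex) \<Rightarrow> complex poly" where
  "levin_poly a w n r =
     (THE p. degree p \<le> n - 1 \<and>
        (\<forall>j<n. poly (pderiv p) (of_real (cgl_node a n j))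
               + \<i> * of_real w * poly p (of_real (cgl_node a n j)) = r (cgl_node a n j)))"

definition levin_q1 :: "real \<Rightarrow> real \<Rightarrow> nat \<Rightarrow> (real \<Rightarrow> complex) \<Rightarrow> complex poly" where
  "levin_q1 a w n f = levin_poly a w n f"

definition levin_q2 :: "real \<Rightarrow> real \<Rightarrow> nat \<Rightarrow> (real \<Rightarrow> complex) \<Rightarrow> real \<Rightarrow> complex" where
  "levin_q2 a w n f x =
     (if x = 0 then poly (pderiv (levin_q1 a w n f)) 0
      else (poly (levin_q1 a w n f) (of_real x) - poly (levin_q1 a w n f) 0) / of_real x)"

definition levin_h1 :: "real \<Rightarrow> real \<Rightarrow> nat \<Rightarrow> (real \<Rightarrow> complex) \<Rightarrow> complex poly" where
  "levin_h1 a w n f = levin_poly a w n (\<lambda>x. - levin_q2 a w n f x)"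

text \<open>The incomplete Gamma function \<open>\<Gamma>(0,z)\<close>, with the path of integration from \<open>z\<close> to
  infinity chosen as the horizontal ray \<open>z + s\<close>, \<open>s \<ge> 0\<close>.  For \<open>z\<close> off the nonpositive real axis
  this ray avoids the branch cut, so it yields the principal branch.\<close>

definition inc_Gamma0 :: "complex \<Rightarrow> complex" where
  "inc_Gamma0 z = integral {0..} (\<lambda>s::real. exp (- (z + of_real s)) / (z + of_real s))"

definition levin_h2 :: "real \<Rightarrow> real \<Rightarrow> nat \<Rightarrow> (real \<Rightarrow> complex) \<Rightarrow> real \<Rightarrow> complex" where
  "levin_h2 a w n f x =
     (if x = 0 then 0
      else poly (levin_q1 a w n f) 0 * exp (- \<i> * of_real w * of_real x) *
           (euler_mascheroni + inc_Gamma0 (- \<i> * of_real w * of_real x)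
            + Ln (- \<i> * of_real w * of_real x)))"

definition levin_Q :: "real \<Rightarrow> real \<Rightarrow> nat \<Rightarrow> (real \<Rightarrow> complex) \<Rightarrow> complex" where
  "levin_Q a w n f =
     exp (\<i> * of_real w * of_real a) *
       (poly (levin_q1 a w n f) (of_real a) * of_real (ln a)
        + poly (levin_h1 a w n f) (of_real a) + levin_h2 a w n f a)
     - (poly (levin_q1 a w n f) 0 * of_real (ln a) + poly (levin_h1 a w n f) 0)"

definition levin_error :: "real \<Rightarrow> real \<Rightarrow> nat \<Rightarrow> (real \<Rightarrow> complex) \<Rightarrow> real" where
  "levin_error a w n f =
     norm (integral {0..a} (\<lambda>x. f x * of_real (ln x) * exp (\<i> * of_real w * of_real x))
           - levin_Q a w n f)"

text \<open>The usual epsilon-delta definition: a division of \<open>T\<close> is a finite family of non-overlapping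
  compact intervals, and \<open>Inf K\<close>, \<open>Sup K\<close> are the endpoints of \<open>K\<close>.\<close>

definition absolutely_continuous_fun_on ::
    "real set \<Rightarrow> (real \<Rightarrow> 'a::real_normed_vector) \<Rightarrow> bool" where
  "absolutely_continuous_fun_on S f \<longleftrightarrow>
     (\<forall>\<epsilon>>0. \<exists>\<delta>>0. \<forall>D T. D division_of T \<and> T \<subseteq> S \<and> (\<Sum>K\<in>D. Sup K - Inf K) < \<delta> \<longrightarrow>
        (\<Sum>K\<in>D. norm (f (Sup K) - f (Inf K))) < \<epsilon>)"

text \<open>\<open>F j\<close> is the derivative \<open>f\<^sup>(\<^sup>j\<^sup>)\<close> on \<open>[0,a]\<close> (one-sided at the endpoints).  The derivatives
  of order less than \<open>k\<close> exist everywhere and are absolutely continuous; \<open>F k\<close> is the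
  almost-everywhere derivative of the absolutely continuous \<open>F (k - 1)\<close>.\<close>

definition ac_derivatives ::
    "real \<Rightarrow> nat \<Rightarrow> (real \<Rightarrow> complex) \<Rightarrow> (nat \<Rightarrow> real \<Rightarrow> complex) \<Rightarrow> bool" where
  "ac_derivatives a k f F \<longleftrightarrow>
     (\<forall>t\<in>{0..a}. F 0 t = f t) \<and>
     (\<forall>j<k. absolutely_continuous_fun_on {0..a} (F j)) \<and>
     (\<forall>j. Suc j < k \<longrightarrow>
        (\<forall>t\<in>{0..a}. (F j has_vector_derivative F (Suc j) t) (at t within {0..a}))) \<and>
     negligible {t\<in>{0..a}. \<not> (F (k - 1) has_vector_derivative F k t) (at t within {0..a})}"

text \<open>The open region bounded by the ellipse with foci \<open>\<plusminus>1\<close> whose semiaxes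
  \<open>(\<rho> + 1/\<rho>)/2\<close> and \<open>(\<rho> - 1/\<rho>)/2\<close> sum to \<open>\<rho>\<close>.\<close>

definition bernstein_ellipse :: "real \<Rightarrow> complex set" where
  "bernstein_ellipse \<rho> =
     {z. (Re z / ((\<rho> + 1 / \<rho>) / 2))\<^sup>2 + (Im z / ((\<rho> - 1 / \<rho>) / 2))\<^sup>2 < 1}"

end

theory Submission
  imports Defs "HOL-Real_Asymp.Real_Asymp"
begin

text \<open>Both Levin systems are solved exactly by polynomials, so the quadrature value is
  \<open>\<integral>\<^sub>0\<^sup>a p(x) ln x e\<^sup>i\<^sup>w\<^sup>x dx\<close>, where \<open>p\<close> interpolates \<open>f\<close> at the nodes, and the error is the same integral of
  \<open>r = f - p\<close>. Two integrations by parts, with second antiderivative of \<open>ln x e\<^sup>i\<^sup>w\<^sup>x\<close> of size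
  \<open>(1 + \<bar>ln w\<bar>) / w\<^sup>2\<close>, bound it by \<open>sup \<bar>r'\<bar> + \<integral> \<bar>r''\<bar>\<close>, since \<open>r\<close> vanishes at both ends of \<open>[0,a]\<close>.
  On a Chebyshev expansion \<open>f = \<Sum> b\<^sub>m T\<^sub>m\<close> the interpolation error of \<open>T\<^sub>m\<close> is \<open>T\<^sub>m - T\<^sub>l\<close> for an alias \<open>l < n\<close>
  (and zero for \<open>m < n\<close>), and this bound for it is of order \<open>m\<^sup>5\<^sup>/\<^sup>2\<close>; so the error is at most a constant times
  \<open>(1 + \<bar>ln w\<bar>) / w\<^sup>2 \<Sum>\<^bsub>m \<ge> n\<^esub> m\<^sup>5\<^sup>/\<^sup>2 \<bar>b\<^sub>m\<bar>\<close>. For (i), Bessel's inequality for the \<open>(k-1)\<close>-st derivative of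
  \<open>f (a/2 (1 - cos t))\<close> controls \<open>\<Sum> (m\<^sup>k\<^sup>-\<^sup>1 \<bar>b\<^sub>m\<bar>)\<^sup>2\<close>. For (ii), shifting the contour to the circle of radius
  \<open>\<rho>\<close> gives \<open>\<bar>b\<^sub>m\<bar> \<le> 2 M \<rho>\<^sup>-\<^sup>m\<close>; as \<open>C\<close> may depend on \<open>f\<close>, radii below one fixed admissible \<open>\<rho>\<^sub>1\<close> are
  served by the estimate for \<open>\<rho>\<^sub>1\<close>.\<close>

section \<open>The exponential integral on the imaginary axis\<close>

text \<open>The factor in (i) has order n^(4-k): two powers of n over k-2. By Cauchy-Schwarz, square
  summability of m^(k-1) |b_m| gives the tail of m^e |b_m| the rate n^(e+3/2-k), so e = 5/2 is the
  largest admissible growth. The bound |T_m''| <= m^4 on its own is too weak for that; it has to be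
  mixed with (1-y^2) |T_m''| <= 2 m^2. Exponent \<theta> on the second gives growth m^(4-2\<theta>)
  and the singularity (1-y^2)^(-\<theta>), integrable for \<theta> < 1; the choice \<theta> = 3/4
  meets both demands and explains the exponent -3/4 throughout. The explicit antiderivatives contain
  \<Gamma>(0,-iwx) and ln x, both singular at 0, so integrations by parts run over
  [\<epsilon>, a-\<epsilon>] and pass to the limit. The constant \<gamma> has to be pinned down
  exactly, since the quadrature adds \<gamma> + \<Gamma>(0,z) + Log z.\<close>

lemma integral_atLeast_dominated:
  fixes f :: "real \<Rightarrow> 'a::euclidean_space"
  assumes int: "\<And>n. (f has_integral I n) {0..real n}"
    and h: "h integrable_on {0..}" "\<And>s. s \<ge> 0 \<Longrightarrow> norm (f s) \<le> h s"
  shows "f integrable_on {0..}" "I \<longlonglongrightarrow> integral {0..} f"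
proof -
  define g where "g = (\<lambda>(k::nat) s. if s \<in> {0..real k} then f s else 0)"
  have g: "(g k has_integral I k) {0..}" for k
    unfolding g_def by (subst has_integral_restrict) (use int in auto)
  have gi: "g k integrable_on {0..}" for k
    using g by blast
  have conv: "(\<lambda>k. g k s) \<longlonglongrightarrow> f s" if "s \<in> {0..}" for s
  proof (rule tendsto_eventually)
    have "eventually (\<lambda>k. s \<le> real k) sequentially"
      by real_asymp
    then show "\<forall>\<^sub>F k in sequentially. g k s = f s"
      by eventually_elim (use that in \<open>auto simp: g_def\<close>)
  qed
  have le: "norm (g k s) \<le> h s" if "s \<in> {0..}" for k s
  proof -
    have "norm (f s) \<le> h s" using h(2) that by simp
    moreover from this have "0 \<le> h s" using norm_ge_zero order_trans by blast
    ultimately show ?thesis by (simp add: g_def)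
  qed
  have "f integrable_on {0..}" "(\<lambda>k. integral {0..} (g k)) \<longlonglongrightarrow> integral {0..} f"
    using dominated_convergence[of g "{0..}" h f] gi h(1) le conv by auto
  moreover have "(\<lambda>k. integral {0..} (g k)) = I"
    using g by (auto simp: integral_unique)
  ultimately show "f integrable_on {0..}" "I \<longlonglongrightarrow> integral {0..} f"
    by simp_all
qed

lemma exp_minus_integrable_atLeast: "(\<lambda>s::real. exp (- s)) integrable_on {0..}"
  using integrable_on_exp_minus_to_infinity[of 1 0] by simp

lemma one_minus_exp_le: "1 - exp (-t) \<le> (t::real)"
  using exp_ge_add_one_self[of "-t"] by simp

text \<open>The number -\<gamma> is the derivative of Gamma at 1, and the difference quotient
  (Gamma(1+s) - 1)/s = Gamma(s) - 1/s is the integral of (exp(-t) - [t <= 1]) t^(s-1). Letting s =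
  1/(k+2) tend to 0 under the integral gives the claim.\<close>

lemma has_integral_euler_mascheroni:
  "((\<lambda>t::real. (exp (-t) - (if t \<le> 1 then 1 else 0)) / t) has_integral (- euler_mascheroni)) {0..}"
proof -
  define s where "s = (\<lambda>k::nat. 1 / (real k + 2))"
  have s: "s k > 0" "s k < 1" for k by (auto simp: s_def field_simps)
  have s0: "s \<longlonglongrightarrow> 0" unfolding s_def by real_asymp
  define c where "c = (\<lambda>t::real. if t \<le> 1 then 1 else (0::real))"
  define g where "g = (\<lambda>k t. (exp (-t) - c t) * t powr (s k - 1))"
  have int: "(g k has_integral (Gamma (1 + s k) - Gamma 1) / s k) {0..}" for k
  proof -
    have 1: "((\<lambda>t. t powr (s k - 1) / exp t) has_integral Gamma (s k)) {0..}"
      by (rule Gamma_integral_real[OF s(1)])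
    have "((\<lambda>t. t powr (s k - 1)) has_integral (1 powr (s k - 1 + 1) / (s k - 1 + 1))) {0..1}"
      by (rule has_integral_powr_from_0) (use s[of k] in auto)
    then have "((\<lambda>t. if t \<in> {0..1} then t powr (s k - 1) else 0) has_integral 1 / s k) {0..}"
      by (subst has_integral_restrict) auto
    from has_integral_diff[OF 1 this]
    have "((\<lambda>t. t powr (s k - 1) / exp t - (if t \<in> {0..1} then t powr (s k - 1) else 0))
           has_integral (Gamma (s k) - 1 / s k)) {0..}" .
    moreover have "Gamma (s k) - 1 / s k = (Gamma (1 + s k) - Gamma 1) / s k"
    proof -
      have "s k \<notin> \<int>\<^sub>\<le>\<^sub>0" using s[of k] nonpos_Ints_nonpos[of "s k"] by force
      from Gamma_plus1[OF this] show ?thesis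
        using s[of k] by (simp add: field_simps)
    qed
    ultimately show ?thesis
      by (auto simp: g_def c_def exp_minus algebra_simps divide_inverse elim!: has_integral_eq[rotated])
  qed
  \<comment> \<open>On [0,1] the factor 1 - exp(-t) <= t absorbs the singularity and leaves at most
    1 <= 3 exp(-1); beyond 1 the power of t is at most 1.\<close>
  have le: "norm (g k t) \<le> 3 * exp (-t)" if t: "t \<in> {0..}" for k t
  proof (cases "t \<le> 1")
    case True
    show ?thesis
    proof (cases "t = 0")
      case False
      then have t0: "t > 0" using t by auto
      have "norm (g k t) = (1 - exp (-t)) * t powr (s k - 1)"
        using True t by (auto simp: g_def c_def abs_mult)
      also have "\<dots> \<le> t * t powr (s k - 1)"
        by (intro mult_right_mono one_minus_exp_le) auto
      also have "\<dots> = t powr s k"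
        using t0 by (simp add: powr_mult_base)
      also have "\<dots> \<le> 1 powr s k"
        using t0 True s[of k] by (intro powr_mono2) auto
      also have "\<dots> \<le> 3 * exp (-1)"
        using exp_le by (simp add: exp_minus field_simps)
      also have "\<dots> \<le> 3 * exp (-t)" using True by simp
      finally show ?thesis .
    qed (auto simp: g_def)
  next
    case False
    have "t powr (s k - 1) \<le> t powr 0"
      using False s[of k] by (intro powr_mono) auto
    also have "\<dots> = 1" using False by simp
    finally have "exp (-t) * t powr (s k - 1) \<le> exp (-t) * 3" by (intro mult_left_mono) auto
    then show ?thesis using False by (simp add: g_def c_def abs_mult)
  qed
  have conv: "(\<lambda>k. g k t) \<longlonglongrightarrow> (exp (-t) - c t) / t" if "t \<in> {0..}" for t
  proof (cases "t = 0")
    case False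
    then have t: "t > 0" using that by auto
    have "(\<lambda>k. g k t) \<longlonglongrightarrow> (exp (-t) - c t) * t powr (0 - 1)"
      unfolding g_def by (intro tendsto_intros s0) (use t in auto)
    then show ?thesis using t by (simp add: powr_minus divide_inverse)
  qed (auto simp: g_def)
  have D: "(\<lambda>t. (exp (-t) - c t) / t) integrable_on {0..}"
    "(\<lambda>k. integral {0..} (g k)) \<longlonglongrightarrow> integral {0..} (\<lambda>t. (exp (-t) - c t) / t)"
    using dominated_convergence[of g "{0..}" "\<lambda>t. 3 * exp (-t)"] int le conv
      integrable_on_cmult_left[OF exp_minus_integrable_atLeast, of 3]
    by (auto simp: has_integral_iff)
  have "(Gamma has_field_derivative Gamma 1 * Digamma 1) (at (1::real))"
    by (rule has_field_derivative_Gamma) (auto dest: nonpos_Ints_nonpos)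
  then have "((\<lambda>h. (Gamma (1 + h) - Gamma 1) / h) \<longlongrightarrow> - euler_mascheroni) (at (0::real))"
    by (simp add: DERIV_def)
  moreover have "filterlim s (at 0) sequentially"
    using s0 s(1) by (auto simp: filterlim_at intro!: always_eventually less_imp_neq[symmetric])
  ultimately have "(\<lambda>k. (Gamma (1 + s k) - Gamma 1) / s k) \<longlonglongrightarrow> - euler_mascheroni"
    by (rule filterlim_compose)
  moreover have "(\<lambda>k. integral {0..} (g k)) = (\<lambda>k. (Gamma (1 + s k) - Gamma 1) / s k)"
    using int by (auto simp: integral_unique)
  ultimately have "integral {0..} (\<lambda>t. (exp (-t) - c t) / t) = - euler_mascheroni"
    using D(2) LIMSEQ_unique by metis
  with D(1) show ?thesis
    by (auto simp: c_def has_integral_iff)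
qed

section \<open>The entire exponential integral and the incomplete Gamma function\<close>

text \<open>The singularity of (1 - exp(-z))/z at 0 is removable with value 1, and an entire
  function has a primitive; subtracting its value at 0 normalises it.\<close>

lemma Ein_exists:
  "\<exists>E :: complex \<Rightarrow> complex. E 0 = 0 \<and>
     (\<forall>z. (E has_field_derivative (if z = 0 then 1 else (1 - exp (-z)) / z)) (at z))"
proof -
  let ?e = "\<lambda>z. if z = 0 then 1 else (1 - exp (-z)) / z :: complex"
  have d: "deriv (\<lambda>z. - exp (-z)) 0 = (1::complex)"
    by (rule DERIV_imp_deriv) (auto intro!: derivative_eq_intros)
  have "(\<lambda>z. if z = 0 then deriv (\<lambda>z. - exp (-z)) 0 else (- exp (-z) - - exp (-0)) / (z - 0))
    holomorphic_on (UNIV :: complex set)"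
    by (rule pole_lemma) (auto intro!: holomorphic_intros)
  moreover have "(\<lambda>z. if z = 0 then deriv (\<lambda>z. - exp (-z)) 0 else (- exp (-z) - - exp (-0)) / (z - 0)) = ?e"
    by (rule ext) (simp add: d)
  ultimately have "?e holomorphic_on UNIV" by simp
  then obtain g where g: "(g has_field_derivative ?e z) (at z)" for z
    using holomorphic_convex_primitive'[OF convex_UNIV open_UNIV, of ?e] by (metis UNIV_I)
  have "((\<lambda>z. g z - g 0) has_field_derivative ?e z) (at z)" for z
    using DERIV_diff[OF g[of z] DERIV_const[of "g 0"]] by (simp only: diff_zero)
  then show ?thesis
    by (intro exI[of _ "\<lambda>z. g z - g 0"] conjI allI) simp_all
qed

text \<open>This is the entire part of \<Gamma>(0,z), that is, minus the sum of (-z)^j / (j j!) over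
  j >= 1.\<close>

definition Ein :: "complex \<Rightarrow> complex" where
  "Ein = (SOME E. E 0 = 0 \<and>
     (\<forall>z. (E has_field_derivative (if z = 0 then 1 else (1 - exp (-z)) / z)) (at z)))"

lemma Ein_0: "Ein 0 = 0"
  using someI_ex[OF Ein_exists] unfolding Ein_def by (rule conjunct1)

lemma Ein_deriv: "(Ein has_field_derivative (if z = 0 then 1 else (1 - exp (-z)) / z)) (at z)"
  using someI_ex[OF Ein_exists] unfolding Ein_def by (elim conjE allE)

lemma Ln_minus_Ein_deriv:
  assumes "z \<notin> \<real>\<^sub>\<le>\<^sub>0"
  shows "((\<lambda>z. Ln z - Ein z) has_field_derivative exp (-z) / z) (at z)"
proof -
  have "z \<noteq> 0" using assms by auto
  have "((\<lambda>z. Ln z - Ein z) has_field_derivative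
      inverse z - (if z = 0 then 1 else (1 - exp (-z)) / z)) (at z)"
    by (intro DERIV_diff has_field_derivative_Ln Ein_deriv assms)
  moreover have "inverse z - (if z = 0 then 1 else (1 - exp (-z)) / z) = exp (-z) / z"
    using \<open>z \<noteq> 0\<close> by (simp add: diff_divide_distrib inverse_eq_divide)
  ultimately show ?thesis by simp
qed

text \<open>This limit fixes the constant of integration in \<Gamma>(0,z). The integral for
  -\<gamma> is cut at 1: the part on [0,1] is -Ein(1), the part on [1,n] is Ln n - Ein(n) +
  Ein(1).\<close>

lemma Ln_minus_Ein_lim:
  "(\<lambda>n. Ln (of_nat n) - Ein (of_nat n)) \<longlonglongrightarrow> - euler_mascheroni"
proof -
  define f where "f = (\<lambda>t::real. (exp (-t) - (if t \<le> 1 then 1 else 0)) / t)"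
  define F where "F = (\<lambda>t. complex_of_real (f t))"
  have "(F has_integral complex_of_real (- euler_mascheroni)) {0..}"
    using has_integral_linear[OF has_integral_euler_mascheroni bounded_linear_of_real]
    unfolding F_def f_def o_def .
  then have F: "(F has_integral (- euler_mascheroni)) {0..}" by simp
  have e: "exp (- complex_of_real t) = of_real (exp (-t))" for t
    by (metis exp_of_real of_real_minus)
  have 1: "(F has_integral (- Ein 1)) {0..1}"
  proof -
    have "((\<lambda>t. - Ein (of_real t)) has_vector_derivative
        - (if t = 0 then 1 else (1 - exp (- of_real t)) / complex_of_real t)) (at t within {0..1})" for t
      using has_vector_derivative_minus[OF has_vector_derivative_real_field[OF Ein_deriv[of "of_real t"]]]
      by simp
    from fundamental_theorem_of_calculus[OF _ this]
    have "((\<lambda>t::real. - (if t = 0 then 1 else (1 - exp (- of_real t)) / complex_of_real t)) has_integral (- Ein 1)) {0..1}"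
      by (simp add: Ein_0)
    then show ?thesis
    proof (rule has_integral_spike_finite[of "{0}", rotated 2])
      fix t :: real assume "t \<in> {0..1} - {0}"
      then show "F t = - (if t = 0 then 1 else (1 - exp (- of_real t)) / complex_of_real t)"
        by (simp add: F_def f_def e diff_divide_distrib)
    qed simp
  qed
  have 2: "(F has_integral (Ln (of_nat n) - Ein (of_nat n) + Ein 1)) {1..real n}" if "n \<ge> 1" for n
  proof -
    have "((\<lambda>t. Ln (of_real t) - Ein (of_real t)) has_vector_derivative (exp (- of_real t) / of_real t))
      (at t within {1..real n})" if "t \<in> {1..real n}" for t
      using that by (intro has_vector_derivative_real_field Ln_minus_Ein_deriv)
        (simp add: complex_nonpos_Reals_iff)
    from fundamental_theorem_of_calculus[OF _ this]
    have "((\<lambda>t. exp (- of_real t) / complex_of_real t) has_integral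
        (Ln (of_nat n) - Ein (of_nat n) + Ein 1)) {1..real n}"
      using that by simp
    then show ?thesis
    \<comment> \<open>At t = 1 the cut-off still equals 1, so that one point is discarded.\<close>
    proof (rule has_integral_spike_finite[of "{1}", rotated 2])
      fix t :: real assume "t \<in> {1..real n} - {1}"
      then show "F t = exp (- of_real t) / complex_of_real t"
        by (simp add: F_def f_def e)
    qed simp
  qed
  have 3: "integral {0..real n} F = Ln (of_nat n) - Ein (of_nat n)" if "n \<ge> 1" for n
    using has_integral_combine[OF _ _ 1 2[OF that]] that by (auto simp: integral_unique)
  have 4: "(F has_integral integral {0..real n} F) {0..real n}" for n
  proof (cases "n = 0")
    case False
    then have "n \<ge> 1" by simp
    from has_integral_combine[OF _ _ 1 2[OF this]] this show ?thesis
      by (auto simp: has_integral_iff)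
  qed auto
  have le: "norm (F t) \<le> 3 * exp (-t)" if "t \<ge> 0" for t
  proof (cases "t \<le> 1")
    case True
    have "\<bar>exp (-t) - 1\<bar> \<le> t" using one_minus_exp_le[of t] that by auto
    then have "\<bar>exp (-t) - 1\<bar> / t \<le> 1" 
      using that by (auto simp: divide_le_eq)
    also have "1 \<le> 3 * exp (-1::real)"
      using exp_le by (simp add: exp_minus field_simps)
    also have "3 * exp (-1) \<le> 3 * exp (-t)" using True by simp
    finally show ?thesis using True that by (simp add: F_def f_def del: of_real_diff of_real_divide)
  next
    case False
    then have "exp (-t) / t \<le> exp (-t)" by (simp add: divide_le_eq)
    also have "\<dots> \<le> 3 * exp (-t)" by simp
    finally show ?thesis using False by (simp add: F_def f_def del: of_real_diff of_real_divide)
  qed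
  have "(\<lambda>n. integral {0..real n} F) \<longlonglongrightarrow> integral {0..} F"
    by (rule integral_atLeast_dominated(2)[OF 4 integrable_on_cmult_left[OF exp_minus_integrable_atLeast, of 3]])
       (use le in simp)
  then have "(\<lambda>n. integral {0..real n} F) \<longlonglongrightarrow> - euler_mascheroni"
    using F by (simp add: integral_unique)
  moreover have "eventually (\<lambda>n. integral {0..real n} F = Ln (of_nat n) - Ein (of_nat n)) sequentially"
    using eventually_ge_at_top[of 1] by eventually_elim (rule 3)
  ultimately show ?thesis
    by (rule Lim_transform_eventually)
qed

text \<open>Along the ray z + s the integrand has the antiderivative Ln - Ein, so only its limit at
  infinity is missing, and that is known on the real axis. The bound 1/u holds because every point
  of the ray has modulus at least u while |exp(-(z+s))| = exp(-s).\<close>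

lemma inc_Gamma0_imaginary:
  assumes "u > 0"
  defines "z \<equiv> - \<i> * complex_of_real u"
  shows inc_Gamma0_eq: "inc_Gamma0 z = - euler_mascheroni - Ln z + Ein z"
    and norm_inc_Gamma0_le: "norm (inc_Gamma0 z) \<le> 1 / u"
proof -
  define \<Phi> where "\<Phi> = (\<lambda>z. Ln z - Ein z)"
  let ?f = "\<lambda>s::real. exp (- (z + of_real s)) / (z + of_real s)"
  have Im: "Im (z + of_real s) \<noteq> 0" for s using assms by simp
  have int: "(?f has_integral (\<Phi> (z + of_nat n) - \<Phi> z)) {0..real n}" for n :: nat
  proof -
    have d: "((\<lambda>s. z + of_real s) has_vector_derivative 1) (at s within {0..real n})" for s
      by (auto intro!: derivative_eq_intros)
    have "((\<lambda>s. \<Phi> (z + of_real s)) has_vector_derivative ?f s) (at s within {0..real n})" for s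
    proof -
      have "((\<lambda>w. \<Phi> w) has_field_derivative exp (- (z + of_real s)) / (z + of_real s)) 
          (at (z + of_real s) within (\<lambda>s. z + of_real s) ` {0..real n})"
        unfolding \<Phi>_def using Im[of s]
        by (intro has_field_derivative_at_within[OF Ln_minus_Ein_deriv]) (simp add: complex_nonpos_Reals_iff)
      from field_vector_diff_chain_within[OF d this] show ?thesis by (simp add: o_def)
    qed
    from fundamental_theorem_of_calculus[OF _ this] show ?thesis by simp
  qed
  have lez: "norm (z + of_real s) \<ge> u" for s
    using abs_Im_le_cmod[of "z + of_real s"] assms by simp
  have le: "norm (?f s) \<le> 1 / u * exp (-s)" for s
  proof -
    have "norm (exp (- (z + of_real s))) = exp (-s)" by (simp add: assms(2))
    then show ?thesis using lez[of s] assms(1) by (simp add: norm_divide frac_le)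
  qed
  have h: "(\<lambda>s::real. 1 / u * exp (-s)) integrable_on {0..}"
    using integrable_on_cmult_left[OF exp_minus_integrable_atLeast, of "1 / u"] by simp
  \<comment> \<open>The limit is carried from the real axis to the ray across a vertical segment of
    length u at real part n, where the derivative exp(-x)/x is at most exp(-n) in modulus.\<close>
  have "(\<lambda>n. \<Phi> (z + of_nat n) - \<Phi> (of_nat n)) \<longlonglongrightarrow> 0"
  proof (rule Lim_null_comparison)
    show "\<forall>\<^sub>F n in sequentially. norm (\<Phi> (z + of_nat n) - \<Phi> (of_nat n)) \<le> exp (- real n) * u"
      using eventually_ge_at_top[of 1]
    proof eventually_elim
      case (elim n)
      have Re: "Re x = real n" if "x \<in> closed_segment (of_nat n) (z + of_nat n)" for x
      proof -
        from that obtain t where x: "x = (1 - t) *\<^sub>R of_nat n + t *\<^sub>R (z + of_nat n)"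
          by (auto simp: closed_segment_def)
        show ?thesis unfolding x by (simp add: assms(2)) (simp add: algebra_simps)
      qed
      have "norm (\<Phi> (z + of_nat n) - \<Phi> (of_nat n)) \<le> exp (- real n) * norm (z + of_nat n - of_nat n)"
      proof (rule field_differentiable_bound)
        fix x assume x: "x \<in> closed_segment (of_nat n) (z + of_nat n)"
        show "(\<Phi> has_field_derivative exp (-x) / x) (at x within closed_segment (of_nat n) (z + of_nat n))"
          unfolding \<Phi>_def using Re[OF x] elim
          by (intro has_field_derivative_at_within[OF Ln_minus_Ein_deriv]) (auto simp: complex_nonpos_Reals_iff)
        have "norm x \<ge> 1" using Re[OF x] elim abs_Re_le_cmod[of x] by simp
        then show "norm (exp (-x) / x) \<le> exp (- real n)"
          using Re[OF x] by (auto simp: norm_divide divide_le_eq)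
      qed auto
      then show ?case using assms by (simp add: norm_mult)
    qed
    show "(\<lambda>n. exp (- real n) * u) \<longlonglongrightarrow> 0" by real_asymp
  qed
  from tendsto_add[OF this Ln_minus_Ein_lim]
  have "(\<lambda>n. \<Phi> (z + of_nat n) - \<Phi> z) \<longlonglongrightarrow> - euler_mascheroni - \<Phi> z"
    by (intro tendsto_diff tendsto_const) (simp add: \<Phi>_def)
  then have "integral {0..} ?f = - euler_mascheroni - \<Phi> z"
    using integral_atLeast_dominated(2)[OF int h le] LIMSEQ_unique by metis
  with integral_atLeast_dominated(1)[OF int h le]
  have I: "(?f has_integral (- euler_mascheroni - \<Phi> z)) {0..}"
    by (simp add: has_integral_iff)
  show "inc_Gamma0 z = - euler_mascheroni - Ln z + Ein z"
    using I by (simp add: inc_Gamma0_def integral_unique \<Phi>_def)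
  have "norm (integral {0..} ?f) \<le> integral {0..} (\<lambda>s. 1 / u * exp (-s))"
    using I h le by (intro integral_norm_bound_integral) auto
  also have "\<dots> = 1 / u"
    using has_integral_exp_minus_to_infinity[of 1 0] by (simp add: integral_unique)
  finally show "norm (inc_Gamma0 z) \<le> 1 / u" by (simp add: inc_Gamma0_def)
qed

text \<open>A chord of the unit circle is no longer than its arc.\<close>

lemma norm_exp_ii_minus_one_le: "norm (exp (\<i> * complex_of_real t) - 1) \<le> \<bar>t\<bar>"
proof -
  have "norm (exp (\<i> * complex_of_real t) - 1) = 2 * \<bar>sin (t / 2)\<bar>"
    using dist_exp_i_1[of t] by (simp add: exp_eq_polar norm_mult)
  also have "\<dots> \<le> 2 * \<bar>t / 2\<bar>"
    using abs_sin_x_le_abs_x[of "t / 2"] by (intro mult_left_mono) auto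
  finally show ?thesis by simp
qed

lemma norm_Ein_imaginary_le:
  assumes "u > 0"
  shows "norm (Ein (- \<i> * complex_of_real u)) \<le> u"
proof -
  let ?S = "closed_segment 0 (- \<i> * complex_of_real u)"
  have "norm (Ein (- \<i> * complex_of_real u) - Ein 0) \<le> 1 * norm (- \<i> * complex_of_real u - 0)"
  proof (rule field_differentiable_bound[of ?S])
    fix z assume "z \<in> ?S"
    then obtain s where "z = (1 - s) *\<^sub>R 0 + s *\<^sub>R (- \<i> * complex_of_real u)"
      by (auto simp: closed_segment_def)
    then have s: "z = - \<i> * complex_of_real (s * u)"
      by (simp add: scaleR_conv_of_real)
    show "(Ein has_field_derivative (if z = 0 then 1 else (1 - exp (-z)) / z)) (at z within ?S)"
      by (rule has_field_derivative_at_within[OF Ein_deriv])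
    have "norm (1 - exp (-z)) \<le> norm z"
      using norm_exp_ii_minus_one_le[of "s * u"] by (simp add: s norm_mult abs_mult norm_minus_commute)
    then show "norm (if z = 0 then 1 else (1 - exp (-z)) / z) \<le> 1"
      by (auto simp: norm_divide divide_le_eq)
  qed auto
  then show ?thesis using assms by (simp add: Ein_0 norm_mult)
qed

text \<open>The two logarithmic singularities cancel: \<Gamma>(0,-iu) contains -ln u, which leaves
  (exp(iu) - 1) ln u, bounded by u |ln u| <= 1. The remaining terms contribute \<gamma>, \<pi>/2 and
  |Ein| <= 1.\<close>

lemma norm_exp_ln_plus_inc_Gamma0_le:
  assumes "0 < u" "u \<le> 1"
  shows "norm (exp (\<i> * of_real u) * of_real (ln u) + inc_Gamma0 (- \<i> * of_real u)) \<le> 2 + euler_mascheroni + pi / 2"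
proof -
  have "- ln u = ln (1 / u)" using assms by (simp add: ln_div)
  also have "\<dots> \<le> 1 / u - 1" using assms by (intro ln_le_minus_one) auto
  finally have "u * \<bar>ln u\<bar> \<le> u * (1 / u)"
    using assms by (intro mult_left_mono) auto
  then have uln: "u * \<bar>ln u\<bar> \<le> 1" using assms by simp
  have Ln: "Ln (- \<i> * of_real u) = of_real (ln u) - \<i> * (pi / 2)"
    using assms Ln_times_of_real[of u "- \<i>"] Ln_of_real[of u] by (simp add: mult.commute)
  have eq: "exp (\<i> * of_real u) * of_real (ln u) + inc_Gamma0 (- \<i> * of_real u)
      = (exp (\<i> * of_real u) - 1) * of_real (ln u) + (- euler_mascheroni) + \<i> * (pi / 2)
        + Ein (- \<i> * of_real u)"
    unfolding inc_Gamma0_eq[OF assms(1)] Ln by (simp add: algebra_simps)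
  have 1: "norm ((exp (\<i> * of_real u) - 1) * of_real (ln u)) \<le> 1"
  proof -
    have "norm ((exp (\<i> * of_real u) - 1) * of_real (ln u)) \<le> u * \<bar>ln u\<bar>"
      using mult_right_mono[OF norm_exp_ii_minus_one_le[of u], of "\<bar>ln u\<bar>"] assms by (simp add: norm_mult)
    with uln show ?thesis by simp
  qed
  have 2: "norm (- euler_mascheroni :: complex) \<le> euler_mascheroni"
    using euler_mascheroni_pos norm_of_real[of euler_mascheroni, where ?'a = complex] by simp
  have 3: "norm (\<i> * complex_of_real (pi / 2)) \<le> pi / 2"
    by (simp add: norm_mult)
  have 4: "norm (Ein (- \<i> * of_real u)) \<le> 1"
    using norm_Ein_imaginary_le[OF assms(1)] assms(2) by linarith
  show ?thesis unfolding eq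
    by (rule order_trans[OF norm_triangle_mono[OF norm_triangle_mono[OF norm_triangle_mono[OF 1 2] 3] 4]]) simp
qed

lemma inc_Gamma0_ray_deriv:
  assumes "w > 0" "x > 0"
  shows "((\<lambda>x. inc_Gamma0 (- \<i> * of_real (w * x))) has_vector_derivative
     - (exp (\<i> * of_real w * of_real x) / of_real x)) (at x)"
proof -
  define c where "c = - \<i> * complex_of_real w"
  have "Im (c * of_real x) \<noteq> 0" using assms by (simp add: c_def)
  then have cx: "c * of_real x \<notin> \<real>\<^sub>\<le>\<^sub>0" by (auto simp: complex_nonpos_Reals_iff)
  have "((\<lambda>z. - euler_mascheroni - (Ln (c * z) - Ein (c * z))) has_field_derivative
     0 - exp (- (c * of_real x)) / (c * of_real x) * (c * 1)) (at (of_real x))"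
    by (intro DERIV_diff[OF DERIV_const] DERIV_chain2[where f = "\<lambda>z. Ln z - Ein z" and g = "\<lambda>z. c * z", OF Ln_minus_Ein_deriv[OF cx]] DERIV_cmult DERIV_ident)
  then have "((\<lambda>z. - euler_mascheroni - (Ln (c * z) - Ein (c * z))) has_field_derivative
     - (exp (\<i> * of_real w * of_real x) / of_real x)) (at (of_real x))"
    using assms by (simp add: c_def)
  from has_vector_derivative_real_field[OF this]
  have "((\<lambda>x. - euler_mascheroni - (Ln (c * of_real x) - Ein (c * of_real x))) has_vector_derivative
     - (exp (\<i> * of_real w * of_real x) / of_real x)) (at x)" .
  then show ?thesis
  proof (rule has_vector_derivative_transform_within_open[of _ _ _ "{0<..}"])
    fix y :: real assume "y \<in> {0<..}"
    then show "- euler_mascheroni - (Ln (c * of_real y) - Ein (c * of_real y)) = inc_Gamma0 (- \<i> * of_real (w * y))"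
      using inc_Gamma0_eq[of "w * y"] assms by (simp add: c_def algebra_simps)
  qed (use assms in auto)
qed

text \<open>Writing \<open>E(x) = \<Gamma>(0, - i w x)\<close>, so that \<open>E' = - e\<^sup>i\<^sup>w\<^sup>x / x\<close>, both iterated antiderivatives
  of \<open>e\<^sup>i\<^sup>w\<^sup>x ln x\<close> are elementary in \<open>E\<close>, and \<open>\<bar>E(x)\<bar> \<le> 1 / (w x)\<close> makes the second one
  of size \<open>(1 + \<bar>ln w\<bar>) / w\<^sup>2\<close>.\<close>

lemma iterated_antiderivative_ln_exp:
  assumes a: "a > (0::real)"
  shows "\<exists>A. A > 0 \<and> (\<forall>w>0. \<exists>G1 G2 B. \<forall>x\<in>{0<..a}.
      (G2 has_vector_derivative G1 x) (at x) \<and>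
      (G1 has_vector_derivative of_real (ln x) * exp (\<i> * of_real w * of_real x)) (at x) \<and>
      norm (G1 x) \<le> B \<and> norm (G2 x :: complex) \<le> A * (1 + \<bar>ln w\<bar>) / w\<^sup>2)"
proof -
  \<comment> \<open>Sum of the constants of two regimes: 2 + \<gamma> + \<pi>/2 for w x <= 1 and 1 +
    |ln a| for w x > 1.\<close>
  define C where "C = 3 + euler_mascheroni + pi / 2 + \<bar>ln a\<bar>"
  have C: "C \<ge> 1" using euler_mascheroni_pos pi_gt_zero by (simp add: C_def)
  have "\<exists>G1 G2 B. \<forall>x\<in>{0<..a}.
      (G2 has_vector_derivative G1 x) (at x) \<and>
      (G1 has_vector_derivative of_real (ln x) * exp (\<i> * of_real w * of_real x)) (at x) \<and>
      norm (G1 x) \<le> B \<and> norm (G2 x :: complex) \<le> (C + 2) * (1 + \<bar>ln w\<bar>) / w\<^sup>2"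
    if w: "w > 0" for w
  proof -
    define E where "E = (\<lambda>x. inc_Gamma0 (- \<i> * of_real (w * x)))"
    define e where "e = (\<lambda>x. exp (\<i> * of_real w * complex_of_real x))"
    \<comment> \<open>Since E' = -e/x, integration by parts turns e ln x into (e ln x + E)/(iw), and
      turns E into x E + e/(iw). The second formula gives \<open>G2\<close>.\<close>
    define G1 where "G1 = (\<lambda>x. (e x * of_real (ln x) + E x) / (\<i> * of_real w))"
    define G2 where "G2 = (\<lambda>x. (G1 x + of_real x * E x + e x / (\<i> * of_real w)) / (\<i> * of_real w))"
    have E: "(E has_vector_derivative - (e x / of_real x)) (at x)" if "x > 0" for x
      unfolding E_def e_def using inc_Gamma0_ray_deriv[OF w that] .
    have e: "(e has_vector_derivative \<i> * of_real w * e x) (at x)" for x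
      unfolding e_def
      by (rule has_vector_derivative_real_field) (auto intro!: derivative_eq_intros)
    have ln: "((\<lambda>x. complex_of_real (ln x)) has_vector_derivative of_real (inverse x)) (at x)" if "x > 0" for x
      using that by (intro has_vector_derivative_of_real DERIV_ln)
    have id: "((\<lambda>x. complex_of_real x) has_vector_derivative 1) (at x)" for x
      using has_vector_derivative_of_real[OF DERIV_ident] by simp
    have G1: "(G1 has_vector_derivative of_real (ln x) * e x) (at x)" if "x > 0" for x
    proof -
      have "((\<lambda>x. e x * of_real (ln x) + E x) has_vector_derivative
         (e x * of_real (inverse x) + \<i> * of_real w * e x * of_real (ln x)) + - (e x / of_real x)) (at x)"
        by (intro has_vector_derivative_add has_vector_derivative_mult e E ln that)
      from has_vector_derivative_divide[OF this, of "\<i> * of_real w"]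
      show ?thesis using w that unfolding G1_def by (simp add: field_simps)
    qed
    have G2: "(G2 has_vector_derivative G1 x) (at x)" if "x > 0" for x
    proof -
      have "((\<lambda>x. G1 x + of_real x * E x + e x / (\<i> * of_real w)) has_vector_derivative
         (of_real (ln x) * e x + (of_real x * (- (e x / of_real x)) + 1 * E x)
          + \<i> * of_real w * e x / (\<i> * of_real w))) (at x)"
        by (intro has_vector_derivative_add has_vector_derivative_mult has_vector_derivative_divide e E id G1 that)
      from has_vector_derivative_divide[OF this, of "\<i> * of_real w"]
      show ?thesis using w that unfolding G2_def by (simp add: G1_def mult.commute)
    qed
    have nE: "norm (E x) \<le> 1 / (w * x)" if "x > 0" for x
      using norm_inc_Gamma0_le[of "w * x"] w that by (simp add: E_def)
    have ne: "norm (e x) = 1" for x by (simp add: e_def)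
    \<comment> \<open>For w x <= 1 the logarithms cancel once ln x is written as ln(wx) - ln w. For
      w x > 1 the point lies between 1/w and a, so |ln x| is controlled by |ln a| + |ln w|, and |E|
      <= 1.\<close>
    have k: "norm (e x * of_real (ln x) + E x) \<le> C + \<bar>ln w\<bar>" if x: "0 < x" "x \<le> a" for x
    proof (cases "w * x \<le> 1")
      case True
      have "e x * of_real (ln x) + E x =
        (exp (\<i> * of_real (w * x)) * of_real (ln (w * x)) + inc_Gamma0 (- \<i> * of_real (w * x))) - e x * of_real (ln w)"
        using w x by (simp add: e_def E_def ln_mult algebra_simps)
      also have "norm \<dots> \<le> (2 + euler_mascheroni + pi / 2) + \<bar>ln w\<bar>"
        using norm_exp_ln_plus_inc_Gamma0_le[of "w * x"] True w x ne[of x]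
        by (intro norm_triangle_le_diff add_mono) (auto simp: norm_mult)
      also have "\<dots> \<le> C + \<bar>ln w\<bar>" by (simp add: C_def)
      finally show ?thesis .
    next
      case False
      then have wx: "1 \<le> w * x" by simp
      then have "0 \<le> ln (w * x)" by simp
      then have "- ln w \<le> ln x" using w x by (simp add: ln_mult)
      moreover have "ln x \<le> ln a" using x by simp
      ultimately have "\<bar>ln x\<bar> \<le> \<bar>ln a\<bar> + \<bar>ln w\<bar>" by linarith
      moreover have "norm (E x) \<le> 1"
        using order_trans[OF nE[OF x(1)]] wx by (simp add: divide_le_eq)
      ultimately have "norm (e x * of_real (ln x) + E x) \<le> (\<bar>ln a\<bar> + \<bar>ln w\<bar>) + 1"
        using ne[of x] by (intro norm_triangle_le add_mono) (auto simp: norm_mult)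
      also have "\<dots> \<le> C + \<bar>ln w\<bar>" using euler_mascheroni_pos pi_gt_zero by (simp add: C_def)
      finally show ?thesis .
    qed
    have nG1: "norm (G1 x) \<le> (C + \<bar>ln w\<bar>) / w" if "0 < x" "x \<le> a" for x
      using k[OF that] w by (simp add: G1_def norm_divide norm_mult divide_right_mono)
    have nG2: "norm (G2 x) \<le> (C + 2) * (1 + \<bar>ln w\<bar>) / w\<^sup>2" if x: "0 < x" "x \<le> a" for x
    proof -
      have "norm (of_real x * E x) \<le> x * (1 / (w * x))"
        using nE[OF x(1)] x by (simp only: norm_mult norm_of_real abs_of_pos) (intro mult_left_mono, auto)
      then have "norm (of_real x * E x) \<le> 1 / w" using x by simp
      moreover have "norm (e x / (\<i> * of_real w)) \<le> 1 / w"
        using w ne[of x] by (simp add: norm_divide norm_mult)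
      ultimately have "norm (G1 x + of_real x * E x + e x / (\<i> * of_real w)) \<le> (C + \<bar>ln w\<bar>) / w + 1 / w + 1 / w"
        using nG1[OF x] by (intro norm_triangle_le add_mono)
      also have "\<dots> = (C + 2 + \<bar>ln w\<bar>) / w" by (simp add: add_divide_distrib)
      finally have "norm (G1 x + of_real x * E x + e x / (\<i> * of_real w)) / w \<le> (C + 2 + \<bar>ln w\<bar>) / w / w"
        using w by (intro divide_right_mono) auto
      then have "norm (G2 x) \<le> (C + 2 + \<bar>ln w\<bar>) / w / w"
        using w unfolding G2_def norm_divide norm_mult by simp
      also have "\<dots> = (C + 2 + \<bar>ln w\<bar>) / w\<^sup>2" by (simp add: power2_eq_square)
      also have "\<dots> \<le> (C + 2) * (1 + \<bar>ln w\<bar>) / w\<^sup>2"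
      proof (rule divide_right_mono)
        have "1 * \<bar>ln w\<bar> \<le> (C + 2) * \<bar>ln w\<bar>" using C by (intro mult_right_mono) auto
        then show "C + 2 + \<bar>ln w\<bar> \<le> (C + 2) * (1 + \<bar>ln w\<bar>)" by (simp add: algebra_simps)
      qed simp
      finally show ?thesis .
    qed
    show ?thesis
      using G1 G2 nG1 nG2 by (intro exI[of _ G1] exI[of _ G2] exI[of _ "(C + \<bar>ln w\<bar>) / w"]) (auto simp: e_def)
  qed
  then show ?thesis using C by (intro exI[of _ "C + 2"]) auto
qed

section \<open>Integration by parts against the logarithmic oscillator\<close>

text \<open>An integrable majorant of the logarithm: on (0,1] apply ln y <= y to y = x^(-1/2),
  beyond 1 use ln x <= x <= a.\<close>

lemma abs_ln_le_powr:
  assumes "0 \<le> x" "x \<le> a"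
  shows "\<bar>ln x\<bar> \<le> 2 * x powr (- 1/2) + (a::real)"
proof (cases "x = 0")
  case False
  then have x: "x > 0" using assms by simp
  show ?thesis
  proof (cases "x \<le> 1")
    case True
    have "ln (x powr (- 1/2)) \<le> x powr (- 1/2)" using x ln_bound[of "x powr (- 1/2)"] by simp
    then have "- ln x \<le> 2 * x powr (- 1/2)" using x by (simp add: ln_powr)
    moreover have "ln x \<le> 0" using True x by simp
    ultimately show ?thesis using assms by simp
  next
    case False
    then have "\<bar>ln x\<bar> \<le> x" using ln_bound[of x] by simp
    also have "\<dots> \<le> 2 * x powr (- 1/2) + a" using assms by (simp add: add_increasing)
    finally show ?thesis .
  qed
qed (use assms in auto)

lemma ln_absolutely_integrable: "(\<lambda>x. ln x) absolutely_integrable_on {0..a::real}"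
proof (rule measurable_bounded_by_integrable_imp_absolutely_integrable)
  have "(\<lambda>x. x powr (- 1/2)) integrable_on {0..a}"
    by (cases "a \<ge> 0") (use integrable_on_powr_from_0[of "- 1/2" a] in auto)
  then show "(\<lambda>x. 2 * x powr (- 1/2) + a) integrable_on {0..a}"
    by (intro integrable_add integrable_on_mult_right) auto
  have "(\<lambda>x::real. ln x) \<in> borel_measurable borel" by simp
  then have "(\<lambda>x::real. ln x) \<in> borel_measurable lebesgue"
    by (intro measurable_completion) simp
  then show "(\<lambda>x. ln x) \<in> borel_measurable (lebesgue_on {0..a})"
    by (rule measurable_restrict_space1)
qed (use abs_ln_le_powr in auto)

definition ln_osc_integral :: "real \<Rightarrow> real \<Rightarrow> (real \<Rightarrow> complex) \<Rightarrow> complex" where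
  "ln_osc_integral a w r =
     integral {0..a} (\<lambda>x. r x * of_real (ln x) * exp (\<i> * of_real w * of_real x))"

lemma ln_osc_absolutely_integrable:
  fixes r :: "real \<Rightarrow> complex"
  assumes "continuous_on {0..a} r"
  shows "(\<lambda>x. r x * of_real (ln x) * exp (\<i> * of_real w * of_real x)) absolutely_integrable_on {0..a}"
proof -
  have c: "continuous_on {0..a} (\<lambda>x. r x * exp (\<i> * of_real w * of_real x))"
    by (intro continuous_intros assms)
  have "(\<lambda>x. ln x *\<^sub>R (r x * exp (\<i> * of_real w * of_real x))) absolutely_integrable_on {0..a}"
  proof (rule absolutely_integrable_bounded_measurable_product
      [where h = "\<lambda>c t. t *\<^sub>R c" and f = "\<lambda>x. r x * exp (\<i> * of_real w * of_real x)" and g = ln])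
    show "bilinear (\<lambda>(c::complex) t. t *\<^sub>R c)"
      by (auto simp: bilinear_def linear_iff algebra_simps)
    show "(\<lambda>x. r x * exp (\<i> * of_real w * of_real x)) \<in> borel_measurable (lebesgue_on {0..a})"
      by (rule continuous_imp_measurable_on_sets_lebesgue[OF c]) auto
    show "bounded ((\<lambda>x. r x * exp (\<i> * of_real w * of_real x)) ` {0..a})"
      by (intro compact_imp_bounded compact_continuous_image c compact_Icc)
  qed (use ln_absolutely_integrable in auto)
  then show ?thesis by (simp add: scaleR_conv_of_real mult_ac)
qed

lemma ln_osc_integrable:
  fixes r :: "real \<Rightarrow> complex"
  assumes "continuous_on {0..a} r"
  shows "(\<lambda>x. r x * of_real (ln x) * exp (\<i> * of_real w * of_real x)) integrable_on {0..a}"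
  using ln_osc_absolutely_integrable[OF assms] by (rule set_lebesgue_integral_eq_integral(1))

lemma ln_osc_integral_diff:
  assumes "continuous_on {0..a} r" "continuous_on {0..a} s"
  shows "ln_osc_integral a w (\<lambda>x. r x - s x) = ln_osc_integral a w r - ln_osc_integral a w s"
  unfolding ln_osc_integral_def left_diff_distrib
  by (intro integral_diff ln_osc_integrable assms)

lemma ln_osc_integral_sum:
  assumes "finite I" "\<And>i. i \<in> I \<Longrightarrow> continuous_on {0..a} (r i)"
  shows "ln_osc_integral a w (\<lambda>x. \<Sum>i\<in>I. c i * r i x) = (\<Sum>i\<in>I. c i * ln_osc_integral a w (r i))"
proof -
  have "ln_osc_integral a w (\<lambda>x. \<Sum>i\<in>I. c i * r i x)
      = integral {0..a} (\<lambda>x. \<Sum>i\<in>I. c i * r i x * of_real (ln x) * exp (\<i> * of_real w * of_real x))"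
    by (simp add: ln_osc_integral_def sum_distrib_right)
  also have "\<dots> = (\<Sum>i\<in>I. integral {0..a} (\<lambda>x. c i * r i x * of_real (ln x) * exp (\<i> * of_real w * of_real x)))"
    by (intro integral_sum assms ln_osc_integrable continuous_intros)
  also have "\<dots> = (\<Sum>i\<in>I. c i * ln_osc_integral a w (r i))"
    by (simp add: ln_osc_integral_def mult.assoc)
  finally show ?thesis .
qed

text \<open>There is no decay in w here; the bound serves for remainders that tend to 0 uniformly
  with w held fixed.\<close>

lemma norm_ln_osc_integral_le:
  assumes "continuous_on {0..a} r" "\<And>x. x \<in> {0..a} \<Longrightarrow> norm (r x) \<le> B"
  shows "norm (ln_osc_integral a w r) \<le> B * integral {0..a} (\<lambda>x. \<bar>ln x\<bar>)"
proof -
  have "(\<lambda>x. \<bar>ln x\<bar>) integrable_on {0..a}"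
    using ln_absolutely_integrable[of a] by (simp add: absolutely_integrable_on_def)
  then have "norm (ln_osc_integral a w r) \<le> integral {0..a} (\<lambda>x. B * \<bar>ln x\<bar>)"
    unfolding ln_osc_integral_def
    by (intro integral_norm_bound_integral ln_osc_integrable assms integrable_on_mult_right)
       (auto simp: norm_mult intro!: mult_right_mono assms(2))
  then show ?thesis by simp
qed

text \<open>The antiderivatives in use are available on (0,a] only, and the second-derivative bounds
  on the open interval only, hence the truncation at both ends. The 3 makes a/(n+3) at most a -
  a/(n+3) already for n = 0.\<close>

lemma integral_truncated_lim:
  fixes g :: "real \<Rightarrow> 'a::banach"
  assumes "a > 0" "g integrable_on {0..a}"
  shows "(\<lambda>n. integral {a / (real n + 3)..a - a / (real n + 3)} g) \<longlonglongrightarrow> integral {0..a} g"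
proof -
  define \<epsilon> where "\<epsilon> = (\<lambda>n::nat. a / (real n + 3))"
  have e: "0 < \<epsilon> n" "\<epsilon> n \<le> a - \<epsilon> n" for n
    using assms(1) by (auto simp: \<epsilon>_def field_simps)
  have ea: "\<epsilon> n \<in> {0..a}" "a - \<epsilon> n \<in> {0..a}" for n using e[of n] by auto
  have e0: "\<epsilon> \<longlonglongrightarrow> 0" unfolding \<epsilon>_def by real_asymp
  have c: "continuous_on {0..a} (\<lambda>x. integral {0..x} g)"
    by (rule indefinite_integral_continuous_1[OF assms(2)])
  have "(\<lambda>n. integral {0..a - \<epsilon> n} g) \<longlonglongrightarrow> integral {0..a} g"
    by (rule continuous_on_tendsto_compose[OF c]) (use e0 ea assms in \<open>auto intro!: tendsto_eq_intros\<close>)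
  moreover have "(\<lambda>n. integral {0..\<epsilon> n} g) \<longlonglongrightarrow> integral {0..0} g"
    by (rule continuous_on_tendsto_compose[OF c]) (use e0 ea assms in auto)
  ultimately have "(\<lambda>n. integral {0..a - \<epsilon> n} g - integral {0..\<epsilon> n} g) \<longlonglongrightarrow> integral {0..a} g - integral {0..0} g"
    by (rule tendsto_diff)
  moreover have "integral {0..a - \<epsilon> n} g - integral {0..\<epsilon> n} g = integral {\<epsilon> n..a - \<epsilon> n} g" for n
  proof -
    have "g integrable_on {0..a - \<epsilon> n}"
      by (rule integrable_on_subinterval[OF assms(2)]) (use ea in auto)
    from Henstock_Kurzweil_Integration.integral_combine[OF _ e(2)[of n] this] e(1)[of n]
    show ?thesis by (simp add: algebra_simps)
  qed
  ultimately show ?thesis by (simp add: \<epsilon>_def)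
qed

lemma endpoint_weight_integral:
  fixes a :: real
  assumes "a > 0"
  shows "((\<lambda>x. x powr (-3/4) + (a - x) powr (-3/4)) has_integral 8 * a powr (1/4)) {0..a}"
proof -
  have 1: "((\<lambda>x. x powr (-3/4)) has_integral 4 * a powr (1/4)) {0..a}"
    using has_integral_powr_from_0[of "-3/4" a] assms by (simp add: mult.commute)
  then have "((\<lambda>x. x powr (-3/4)) has_integral 4 * a powr (1/4)) (cbox 0 a)" by simp
  from has_integral_affinity[OF this, of "-1" a]
  have "((\<lambda>x. (a - x) powr (-3/4)) has_integral 4 * a powr (1/4)) ((\<lambda>x. a - x) ` {0..a})"
    using assms by (simp add: algebra_simps)
  moreover have "(\<lambda>x. a - x) ` {0..a} = {0..a}"
    by (auto simp: image_iff intro!: bexI[of _ "a - x" for x])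
  ultimately have 2: "((\<lambda>x. (a - x) powr (-3/4)) has_integral 4 * a powr (1/4)) {0..a}" by simp
  show ?thesis using has_integral_add[OF 1 2] by simp
qed

lemma poly_of_real_has_vector_derivative:
  "((\<lambda>x. poly p (complex_of_real x)) has_vector_derivative poly (pderiv p) (of_real x)) (at x within S)"
  by (rule has_vector_derivative_real_field[OF poly_DERIV])

text \<open>Two integrations by parts. The first antiderivative is bounded only by some
  \<open>B\<close> of no known size, but it multiplies values of \<open>s\<close> that tend to 0 at
  both ends. The boundary terms with s' contribute 2 and the integral of s'' contributes \<Omega> to
  the factor 2 + \<Omega>.\<close>

lemma ln_osc_integral_poly_bound:
  assumes a: "a > 0"
  obtains A where "A > 0" and "\<And>w s K. w > 0 \<Longrightarrow> poly s 0 = 0 \<Longrightarrow> poly s (of_real a) = 0 \<Longrightarrow>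
      (\<And>x. x \<in> {0..a} \<Longrightarrow> norm (poly (pderiv s) (of_real x)) \<le> K) \<Longrightarrow>
      (\<And>x. x \<in> {0<..<a} \<Longrightarrow> norm (poly (pderiv (pderiv s)) (of_real x)) \<le> K * (x powr (-3/4) + (a - x) powr (-3/4)))
      \<Longrightarrow> norm (ln_osc_integral a w (\<lambda>x. poly s (of_real x))) \<le> A * (1 + \<bar>ln w\<bar>) / w\<^sup>2 * K"
proof -
  obtain A where A: "A > 0" and G: "\<And>w. w > 0 \<Longrightarrow> \<exists>G1 G2 B. \<forall>x\<in>{0<..a}.
      (G2 has_vector_derivative G1 x) (at x) \<and>
      (G1 has_vector_derivative of_real (ln x) * exp (\<i> * of_real w * of_real x)) (at x) \<and>
      norm (G1 x) \<le> B \<and> norm (G2 x :: complex) \<le> A * (1 + \<bar>ln w\<bar>) / w\<^sup>2"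
    using iterated_antiderivative_ln_exp[OF a] by blast
  define \<omega> where "\<omega> = (\<lambda>x. x powr (-3/4) + (a - x) powr (-3/4))"
  define \<Omega> where "\<Omega> = 8 * a powr (1/4)"
  have \<omega>: "(\<omega> has_integral \<Omega>) {0..a}"
    unfolding \<omega>_def \<Omega>_def by (rule endpoint_weight_integral[OF a])
  have \<Omega>: "\<Omega> > 0" using a by (simp add: \<Omega>_def)
  have "norm (ln_osc_integral a w (\<lambda>x. poly s (of_real x))) \<le> A * (2 + \<Omega>) * (1 + \<bar>ln w\<bar>) / w\<^sup>2 * K"
    if w: "w > 0" and s: "poly s 0 = 0" "poly s (of_real a) = 0"
      and s1: "\<And>x. x \<in> {0..a} \<Longrightarrow> norm (poly (pderiv s) (of_real x)) \<le> K"
      and s2: "\<And>x. x \<in> {0<..<a} \<Longrightarrow> norm (poly (pderiv (pderiv s)) (of_real x)) \<le> K * \<omega> x"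
    for w s K
  proof -
    obtain G1 G2 B where
      G2: "\<And>x. x \<in> {0<..a} \<Longrightarrow> (G2 has_vector_derivative G1 x) (at x)" and
      G1: "\<And>x. x \<in> {0<..a} \<Longrightarrow> (G1 has_vector_derivative of_real (ln x) * exp (\<i> * of_real w * of_real x)) (at x)" and
      nG1: "\<And>x. x \<in> {0<..a} \<Longrightarrow> norm (G1 x) \<le> B" and
      nG2: "\<And>x. x \<in> {0<..a} \<Longrightarrow> norm (G2 x :: complex) \<le> A * (1 + \<bar>ln w\<bar>) / w\<^sup>2"
      using G[OF w] by blast
    define B2 where "B2 = A * (1 + \<bar>ln w\<bar>) / w\<^sup>2"
    have B2: "B2 \<ge> 0" using A by (simp add: B2_def)
    have K: "K \<ge> 0" using order_trans[OF norm_ge_zero s1[of 0]] a by simp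
    define f where "f = (\<lambda>x. poly s (complex_of_real x))"
    define f1 where "f1 = (\<lambda>x. poly (pderiv s) (complex_of_real x))"
    define f2 where "f2 = (\<lambda>x. poly (pderiv (pderiv s)) (complex_of_real x))"
    define g where "g = (\<lambda>x. f x * of_real (ln x) * exp (\<i> * of_real w * of_real x))"
    \<comment> \<open>Both integrations by parts at once: the derivative of \<Psi> is g - f''
      G2.\<close>
    define \<Psi> where "\<Psi> = (\<lambda>x. f x * G1 x - f1 x * G2 x)"
    define \<epsilon> where "\<epsilon> = (\<lambda>n::nat. a / (real n + 3))"
    have e: "0 < \<epsilon> n" "\<epsilon> n \<le> a - \<epsilon> n" for n
      using a by (auto simp: \<epsilon>_def field_simps)
    have e0: "\<epsilon> \<longlonglongrightarrow> 0" unfolding \<epsilon>_def by real_asymp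
    have cf: "continuous_on S f" for S unfolding f_def by (intro continuous_intros)
    have cf2: "continuous_on S f2" for S unfolding f2_def by (intro continuous_intros)
    have fd: "(f has_vector_derivative f1 x) (at x)" "(f1 has_vector_derivative f2 x) (at x)" for x
      unfolding f_def f1_def f2_def by (rule poly_of_real_has_vector_derivative)+
    have gint: "g integrable_on {0..a}"
      unfolding g_def by (rule ln_osc_integrable[OF cf])
    have \<Psi>: "(\<Psi> has_vector_derivative g x - f2 x * G2 x) (at x)" if "x \<in> {0<..a}" for x
    proof -
      have "(\<Psi> has_vector_derivative (f x * (of_real (ln x) * exp (\<i> * of_real w * of_real x)) + f1 x * G1 x)
         - (f1 x * G1 x + f2 x * G2 x)) (at x)"
        unfolding \<Psi>_def by (intro has_vector_derivative_diff has_vector_derivative_mult fd G1 G2 that)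
      then show ?thesis by (simp add: g_def mult.assoc)
    qed
    have n\<Psi>: "norm (\<Psi> x) \<le> norm (f x) * B + K * B2" if "x \<in> {0<..a}" for x
    proof -
      have "norm (f x * G1 x) \<le> norm (f x) * B"
        using nG1[OF that] by (simp add: norm_mult mult_left_mono)
      moreover have "norm (f1 x * G2 x) \<le> K * B2"
        using nG2[OF that] s1[of x] that K unfolding norm_mult f1_def B2_def
        by (intro mult_mono) auto
      ultimately show ?thesis
        unfolding \<Psi>_def by (intro norm_triangle_le_diff add_mono)
    qed
    have bound: "norm (integral {\<epsilon> n..a - \<epsilon> n} g)
       \<le> (norm (f (a - \<epsilon> n)) * B + K * B2) + (norm (f (\<epsilon> n)) * B + K * B2) + K * B2 * \<Omega>" for n
    proof -
      let ?I = "{\<epsilon> n..a - \<epsilon> n}"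
      have sub: "?I \<subseteq> {0<..a}" "?I \<subseteq> {0..a}" "?I \<subseteq> {0<..<a}" using e[of n] by auto
      have ends: "\<epsilon> n \<in> {0<..a}" "a - \<epsilon> n \<in> {0<..a}" using e[of n] by auto
      have "((\<lambda>x. g x - f2 x * G2 x) has_integral \<Psi> (a - \<epsilon> n) - \<Psi> (\<epsilon> n)) ?I"
        by (rule fundamental_theorem_of_calculus[OF e(2)])
           (use \<Psi> sub(1) has_vector_derivative_at_within in blast)
      then have 1: "integral ?I (\<lambda>x. g x - f2 x * G2 x) = \<Psi> (a - \<epsilon> n) - \<Psi> (\<epsilon> n)"
        by (rule integral_unique)
      have "continuous_on ?I G2"
        using G2 sub(1) by (intro continuous_at_imp_continuous_on ballI)
          (blast intro: has_vector_derivative_continuous)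
      then have i2: "(\<lambda>x. f2 x * G2 x) integrable_on ?I"
        by (intro integrable_continuous_interval continuous_intros cf2)
      have i1: "g integrable_on ?I"
        by (rule integrable_on_subinterval[OF gint sub(2)])
      have 2: "integral ?I g = \<Psi> (a - \<epsilon> n) - \<Psi> (\<epsilon> n) + integral ?I (\<lambda>x. f2 x * G2 x)"
        using trans[OF integral_diff[OF i1 i2, symmetric] 1] by (simp only: diff_eq_eq)
      have i3: "(\<lambda>x. K * B2 * \<omega> x) integrable_on {0..a}"
        using has_integral_mult_right[OF \<omega>, of "K * B2"] by blast
      have "norm (integral ?I (\<lambda>x. f2 x * G2 x)) \<le> integral ?I (\<lambda>x. K * B2 * \<omega> x)"
      proof (rule integral_norm_bound_integral[OF i2])
        show "(\<lambda>x. K * B2 * \<omega> x) integrable_on ?I"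
          by (rule integrable_on_subinterval[OF i3 sub(2)])
        fix x assume x: "x \<in> ?I"
        have "norm (f2 x * G2 x) \<le> (K * \<omega> x) * B2"
          unfolding norm_mult f2_def B2_def
        proof (rule mult_mono)
          show "norm (poly (pderiv (pderiv s)) (of_real x)) \<le> K * \<omega> x" using s2 x sub by blast
          show "norm (G2 x) \<le> A * (1 + \<bar>ln w\<bar>) / w\<^sup>2" using nG2 x sub by blast
          show "0 \<le> K * \<omega> x" using K by (simp add: \<omega>_def)
        qed simp
        then show "norm (f2 x * G2 x) \<le> K * B2 * \<omega> x" by (simp add: mult_ac)
      qed
      also have "\<dots> \<le> integral {0..a} (\<lambda>x. K * B2 * \<omega> x)"
        by (rule integral_subset_le[OF sub(2) _ i3])
           (use integrable_on_subinterval[OF i3 sub(2)] K B2 in \<open>auto simp: \<omega>_def\<close>)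
      also have "\<dots> = K * B2 * \<Omega>" using \<omega> by (simp add: integral_unique)
      finally have 3: "norm (integral ?I (\<lambda>x. f2 x * G2 x)) \<le> K * B2 * \<Omega>" .
      show ?thesis unfolding 2
        by (intro norm_triangle_mono norm_triangle_le_diff add_mono n\<Psi> ends 3)
    qed
    have l1: "(\<lambda>n. f (\<epsilon> n)) \<longlonglongrightarrow> 0"
      using continuous_on_tendsto_compose[OF cf[of UNIV] e0] s by (simp add: f_def)
    have "(\<lambda>n. a - \<epsilon> n) \<longlonglongrightarrow> a - 0" by (intro tendsto_intros e0)
    then have l2: "(\<lambda>n. f (a - \<epsilon> n)) \<longlonglongrightarrow> 0"
      using continuous_on_tendsto_compose[OF cf[of UNIV], of "\<lambda>n. a - \<epsilon> n" a] s by (simp add: f_def)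
    have "(\<lambda>n. (norm (f (a - \<epsilon> n)) * B + K * B2) + (norm (f (\<epsilon> n)) * B + K * B2) + K * B2 * \<Omega>)
        \<longlonglongrightarrow> (norm (0::complex) * B + K * B2) + (norm (0::complex) * B + K * B2) + K * B2 * \<Omega>"
      by (intro tendsto_intros l1 l2)
    moreover have "(\<lambda>n. norm (integral {\<epsilon> n..a - \<epsilon> n} g)) \<longlonglongrightarrow> norm (integral {0..a} g)"
      unfolding \<epsilon>_def by (intro tendsto_norm integral_truncated_lim a gint)
    ultimately have "norm (integral {0..a} g) \<le>
        (norm (0::complex) * B + K * B2) + (norm (0::complex) * B + K * B2) + K * B2 * \<Omega>"
      using bound by (intro LIMSEQ_le) auto
    also have "\<dots> = A * (2 + \<Omega>) * (1 + \<bar>ln w\<bar>) / w\<^sup>2 * K"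
      using w by (simp add: B2_def field_simps)
    finally show ?thesis by (simp add: ln_osc_integral_def g_def f_def)
  qed
  moreover have "A * (2 + \<Omega>) > 0" using A \<Omega> by simp
  ultimately show ?thesis
    unfolding \<omega>_def by (rule that[rotated])
qed

section \<open>Exactness of the Levin method\<close>

text \<open>If q' + c q = p, then r = q' solves the same equation with right-hand side p', of
  smaller degree. Conversely q = (p - r)/c recovers q, which is the induction step.\<close>

lemma poly_ode_exists:
  fixes p :: "complex poly"
  assumes "c \<noteq> 0"
  shows "\<exists>q. degree q \<le> degree p \<and> pderiv q + smult c q = p"
proof (induction "degree p" arbitrary: p rule: less_induct)
  case less
  show ?case
  proof (cases "degree p = 0")
    case True
    then have "pderiv p = 0" by (simp add: pderiv_eq_0_iff)
    then show ?thesis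
      using assms by (intro exI[of _ "smult (1 / c) p"]) (simp add: pderiv_smult)
  next
    case False
    then have d: "degree (pderiv p) < degree p" by (simp add: degree_pderiv)
    with less obtain r where r: "degree r \<le> degree (pderiv p)" "pderiv r + smult c r = pderiv p"
      by blast
    have "pderiv (smult (1 / c) (p - r)) + smult c (smult (1 / c) (p - r)) = smult (1 / c) (pderiv p - pderiv r) + (p - r)"
      using assms by (simp add: pderiv_smult pderiv_diff)
    also have "pderiv p - pderiv r = smult c r" using r(2) by (simp add: algebra_simps)
    also have "smult (1 / c) (smult c r) + (p - r) = p" using assms by simp
    finally have eq: "pderiv (smult (1 / c) (p - r)) + smult c (smult (1 / c) (p - r)) = p" .
    have "degree (smult (1 / c) (p - r)) \<le> degree p"
      using r(1) d by (intro order_trans[OF degree_smult_le] degree_diff_le) auto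
    with eq show ?thesis by blast
  qed
qed

lemma poly_ode_unique:
  fixes p :: "complex poly"
  assumes "c \<noteq> 0" "pderiv p + smult c p = 0"
  shows "p = 0"
proof (rule ccontr)
  assume "p \<noteq> 0"
  have "pderiv p = smult (- c) p" using assms(2) by (simp add: eq_neg_iff_add_eq_0)
  then have "degree (pderiv p) = degree p" using assms(1) by simp
  then have "degree p = 0" by (simp add: degree_pderiv)
  then have "pderiv p = 0" by (simp add: pderiv_eq_0_iff)
  with \<open>pderiv p = smult (- c) p\<close> assms(1) \<open>p \<noteq> 0\<close> show False by simp
qed

section \<open>Interpolation at the Chebyshev-Gauss-Lobatto nodes\<close>

lemma poly_eq_on_nodes:
  fixes p q :: "complex poly"
  assumes "inj_on x {..<n}" "degree p < n" "degree q < n" "\<And>j. j < n \<Longrightarrow> poly p (x j) = poly q (x j)"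
  shows "p = q"
proof (rule ccontr)
  assume "p \<noteq> q"
  then have nz: "p - q \<noteq> 0" by simp
  have "n = card (x ` {..<n})" using assms(1) by (simp add: card_image)
  also have "\<dots> \<le> card {z. poly (p - q) z = 0}"
    using assms(4) poly_roots_finite[OF nz] by (intro card_mono) auto
  also have "\<dots> \<le> degree (p - q)" by (rule card_poly_roots_bound[OF nz])
  also have "\<dots> < n" using assms(2,3) by (rule degree_diff_less)
  finally show False by simp
qed

text \<open>Newton's construction: a multiple of the nodal polynomial of the earlier points corrects
  the value at the new one.\<close>

lemma poly_interpolation_exists:
  fixes x :: "nat \<Rightarrow> complex"
  assumes "inj_on x {..<n}" "n \<ge> 1"
  shows "\<exists>p. degree p \<le> n - 1 \<and> (\<forall>j<n. poly p (x j) = y j)"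
  using assms
proof (induction n)
  case (Suc n)
  show ?case
  proof (cases "n = 0")
    case True
    then show ?thesis by (intro exI[of _ "[:y 0:]"]) auto
  next
    case False
    from Suc.prems(1) have inj: "inj_on x {..<n}" by (rule inj_on_subset) auto
    with Suc.IH False obtain p where p: "degree p \<le> n - 1" "\<And>j. j < n \<Longrightarrow> poly p (x j) = y j" by auto
    define r where "r = (\<Prod>j<n. [:- x j, 1:])"
    have r: "poly r (x j) = 0" if "j < n" for j
      using that by (auto simp: r_def poly_prod)
    have "x n \<noteq> x j" if "j < n" for j
      using inj_on_eq_iff[OF Suc.prems(1), of n j] that by simp
    then have "poly r (x n) \<noteq> 0"
      by (simp add: r_def poly_prod)
    define c where "c = (y n - poly p (x n)) / poly r (x n)"
    have "degree r \<le> n"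
      unfolding r_def by (rule order_trans[OF degree_prod_sum_le]) auto
    then have "degree (p + smult c r) \<le> n"
      using p(1) by (intro degree_add_le order_trans[OF degree_smult_le]) auto
    moreover have "poly (p + smult c r) (x j) = y j" if "j < Suc n" for j
      using that p(2) r \<open>poly r (x n) \<noteq> 0\<close> by (cases "j = n") (auto simp: c_def)
    ultimately show ?thesis by auto
  qed
qed auto

lemma cgl_node_inj:
  assumes "a > 0" "n \<ge> 2"
  shows "inj_on (\<lambda>j. complex_of_real (cgl_node a n j)) {..<n}"
proof (rule inj_onI)
  define t where "t = (\<lambda>j::nat. real j * pi / (real n - 1))"
  have n: "real n - 1 > 0" using assms(2) by simp
  have t: "0 \<le> t k" "t k \<le> pi" if "k < n" for k
  proof -
    have "real k * pi \<le> (real n - 1) * pi" using that by (intro mult_right_mono) auto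
    then show "t k \<le> pi" using n by (simp add: t_def pos_divide_le_eq mult.commute)
    show "0 \<le> t k" using n by (simp add: t_def)
  qed
  fix i j assume ij: "i \<in> {..<n}" "j \<in> {..<n}" "complex_of_real (cgl_node a n i) = of_real (cgl_node a n j)"
  have "a / 2 * (1 - cos (t i)) = a / 2 * (1 - cos (t j))"
    using ij(3) unfolding of_real_eq_iff cgl_node_def t_def .
  then have c: "cos (t i) = cos (t j)" using assms(1) by simp
  have lt: "i < n" "j < n" using ij(1,2) by auto
  have "t i = t j"
    by (rule cos_inj_pi[OF t(1)[OF lt(1)] t(2)[OF lt(1)] t(1)[OF lt(2)] t(2)[OF lt(2)] c])
  then have "real i * pi = real j * pi"
    using n unfolding t_def by simp
  then show "i = j" by simp
qed

lemma cgl_node_bounds: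
  assumes "a > 0"
  shows "cgl_node a n j \<in> {0..a}"
proof -
  define c where "c = cos (real j * pi / (real n - 1))"
  have c: "0 \<le> 1 - c" "1 - c \<le> 2"
    using cos_le_one[of "real j * pi / (real n - 1)"] cos_ge_minus_one[of "real j * pi / (real n - 1)"]
    unfolding c_def by linarith+
  have "0 \<le> a / 2 * (1 - c)" using c assms by simp
  moreover have "a / 2 * (1 - c) \<le> a / 2 * 2" using c assms by (intro mult_left_mono) auto
  ultimately have "a / 2 * (1 - c) \<in> {0..a}" unfolding atLeastAtMost_iff by linarith
  then show ?thesis unfolding cgl_node_def c_def .
qed

text \<open>Both q' + iwq and p have degree below n and agree at n distinct nodes, so the
  collocation conditions amount to the polynomial identity q' + iwq = p. This has exactly one
  solution, which also justifies the definite description in \<open>levin_poly\<close>.\<close>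

lemma levin_poly_eq:
  assumes a: "a > 0" and w: "w > 0" and n: "n \<ge> 2"
    and p: "degree p \<le> n - 1" "\<And>j. j < n \<Longrightarrow> poly p (of_real (cgl_node a n j)) = r (cgl_node a n j)"
  shows "degree (levin_poly a w n r) \<le> n - 1"
    and "pderiv (levin_poly a w n r) + smult (\<i> * of_real w) (levin_poly a w n r) = p"
proof -
  define c where "c = \<i> * complex_of_real w"
  have c: "c \<noteq> 0" using w by (simp add: c_def)
  define P where "P = (\<lambda>q. degree q \<le> n - 1 \<and>
        (\<forall>j<n. poly (pderiv q) (of_real (cgl_node a n j)) + c * poly q (of_real (cgl_node a n j)) = r (cgl_node a n j)))"
  have ode: "pderiv q + smult c q = p" if "P q" for q
  proof (rule poly_eq_on_nodes[OF cgl_node_inj[OF a n]])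
    have "degree (pderiv q + smult c q) \<le> n - 1"
      using that by (intro degree_add_le order_trans[OF degree_smult_le]) (auto simp: P_def degree_pderiv)
    then show "degree (pderiv q + smult c q) < n" using n by simp
    show "degree p < n" using p(1) n by simp
    fix j assume "j < n"
    then show "poly (pderiv q + smult c q) (of_real (cgl_node a n j)) = poly p (of_real (cgl_node a n j))"
      using that p(2) by (simp add: P_def)
  qed
  obtain q where q: "degree q \<le> degree p" "pderiv q + smult c q = p"
    using poly_ode_exists[OF c, of p] by blast
  have "poly (pderiv q) z + c * poly q z = poly p z" for z
    using arg_cong[OF q(2), of "\<lambda>u. poly u z"] by simp
  then have "P q"
    using p q(1) unfolding P_def by simp
  moreover have "q' = q" if "P q'" for q'
  proof -
    have "pderiv (q' - q) + smult c (q' - q) = (pderiv q' + smult c q') - (pderiv q + smult c q)"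
      by (simp add: pderiv_diff smult_diff_right)
    also have "\<dots> = 0" using ode[OF that] q(2) by simp
    finally have "q' - q = 0" by (rule poly_ode_unique[OF c])
    then show ?thesis by simp
  qed
  ultimately have "P (THE q. P q)" by (rule theI)
  moreover have "levin_poly a w n r = (THE q. P q)"
    by (simp add: levin_poly_def P_def c_def)
  ultimately have P: "P (levin_poly a w n r)" by simp
  then show "degree (levin_poly a w n r) \<le> n - 1"
    unfolding P_def by (rule conjunct1)
  show "pderiv (levin_poly a w n r) + smult (\<i> * of_real w) (levin_poly a w n r) = p"
    using ode[OF P] unfolding c_def .
qed

text \<open>The quadrature value is the difference of the boundary values of an exact antiderivative
  of p ln x exp(iwx), with the value at 0 taken as a limit.\<close>

lemma levin_Q_eq_ln_osc_integral:
  assumes a: "a > 0" and w: "w > 0" and n: "n \<ge> 2"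
    and p: "degree p \<le> n - 1" "\<And>j. j < n \<Longrightarrow> poly p (of_real (cgl_node a n j)) = f (cgl_node a n j)"
  shows "levin_Q a w n f = ln_osc_integral a w (\<lambda>x. poly p (of_real x))"
proof -
  define c where "c = \<i> * complex_of_real w"
  have c0: "c \<noteq> 0" using w by (simp add: c_def)
  define q where "q = levin_q1 a w n f"
  define h where "h = levin_h1 a w n f"
  define q0 where "q0 = poly q 0"
  have q: "degree q \<le> n - 1" "pderiv q + smult c q = p"
    using levin_poly_eq[OF a w n p] by (auto simp: q_def levin_q1_def c_def)
  have "poly (q - [:q0:]) 0 = 0" by (simp add: q0_def)
  then have "[:- 0, 1:] dvd q - [:q0:]" by (rule iffD1[OF poly_eq_0_iff_dvd])
  then obtain q2 where "q - [:q0:] = [:- 0, 1:] * q2" by (rule dvdE)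
  then have qq: "q = [:0, 1:] * q2 + [:q0:]" unfolding diff_eq_eq minus_zero .
  have pq: "poly q z = z * poly q2 z + q0" for z by (subst qq) simp
  have "poly (pderiv q) 0 = poly q2 0" by (subst qq) (simp add: pderiv_mult pderiv_add pderiv_pCons)
  then have lq2: "levin_q2 a w n f x = poly q2 (of_real x)" for x
    using pq[of "of_real x"] pq[of 0] by (simp add: levin_q2_def flip: q_def)
  have "degree q2 \<le> n - 1"
  proof (cases "q2 = 0")
    case False
    then have "degree ([:0, 1:] * q2) = 1 + degree q2" by (subst degree_mult_eq) auto
    moreover have "degree ([:0, 1:] * q2) = degree (q - [:q0:])" using qq by simp
    moreover have "degree (q - [:q0:]) \<le> n - 1" using q(1) by (intro degree_diff_le) auto
    ultimately show ?thesis by simp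
  qed auto
  then have h: "pderiv h + smult c h = - q2"
    using levin_poly_eq(2)[OF a w n, of "- q2" "\<lambda>x. - levin_q2 a w n f x"] lq2
    by (simp add: h_def levin_h1_def c_def)
  define e where "e = (\<lambda>x. exp (c * complex_of_real x))"
  define g where "g = (\<lambda>x. poly p (of_real x) * of_real (ln x) * e x)"
  \<comment> \<open>Differentiating e q ln x leaves e q/x = e q2 + q0 e/x besides the integrand. The
    term with h removes e q2, and Ein(-cx) - ln x, whose derivative is -e/x, removes the
    rest.\<close>
  define \<Psi> where "\<Psi> = (\<lambda>x. e x * poly q (of_real x) * of_real (ln x) + e x * poly h (of_real x)
     + q0 * Ein (- c * of_real x) - q0 * of_real (ln x))"
  have gint: "g integrable_on {0..a}"
    unfolding g_def e_def c_def by (intro ln_osc_integrable continuous_intros)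
  have e: "(e has_vector_derivative c * e x) (at x)" for x
    unfolding e_def
    by (rule has_vector_derivative_real_field) (auto intro!: derivative_eq_intros)
  have ln: "((\<lambda>x. complex_of_real (ln x)) has_vector_derivative of_real (inverse x)) (at x)" if "x > 0" for x
    using that by (intro has_vector_derivative_of_real DERIV_ln)
  have Ein: "((\<lambda>x. Ein (- c * of_real x)) has_vector_derivative (1 - e x) / of_real x) (at x)" if "x > 0" for x
  proof -
    have "- c * complex_of_real x \<noteq> 0" using c0 that by simp
    with Ein_deriv[of "- c * of_real x"]
    have "(Ein has_field_derivative (1 - exp (- (- c * of_real x))) / (- c * of_real x)) (at (- c * of_real x))"
      by (simp split: if_splits)
    from DERIV_chain2[where g = "\<lambda>z. - c * z", OF this DERIV_cmult[OF DERIV_ident]]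
    have "((\<lambda>z. Ein (- c * z)) has_field_derivative (1 - e x) / of_real x) (at (of_real x))"
      using c0 by (simp add: e_def)
    then show ?thesis by (rule has_vector_derivative_real_field)
  qed
  have \<Psi>: "(\<Psi> has_vector_derivative g x) (at x)" if "x > 0" for x
  proof -
    let ?x = "complex_of_real x"
    have "(\<Psi> has_vector_derivative
       (e x * poly q ?x * of_real (inverse x) + (e x * poly (pderiv q) ?x + c * e x * poly q ?x) * of_real (ln x))
       + (e x * poly (pderiv h) ?x + c * e x * poly h ?x)
       + q0 * ((1 - e x) / ?x) - q0 * of_real (inverse x)) (at x)"
      unfolding \<Psi>_def
      by (intro has_vector_derivative_add has_vector_derivative_diff has_vector_derivative_mult
          has_vector_derivative_mult_right poly_of_real_has_vector_derivative e ln Ein that)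
    also have "(e x * poly q ?x * of_real (inverse x) + (e x * poly (pderiv q) ?x + c * e x * poly q ?x) * of_real (ln x))
       + (e x * poly (pderiv h) ?x + c * e x * poly h ?x)
       + q0 * ((1 - e x) / ?x) - q0 * of_real (inverse x)
      = e x * poly q ?x * of_real (inverse x)
       + e x * (poly (pderiv q) ?x + c * poly q ?x) * of_real (ln x)
       + e x * (poly (pderiv h) ?x + c * poly h ?x)
       + q0 * ((1 - e x) / ?x) - q0 * of_real (inverse x)"
      by (simp only: ring_distribs mult_ac add_ac)
    also have "poly (pderiv q) ?x + c * poly q ?x = poly p ?x"
      using arg_cong[OF q(2), of "\<lambda>u. poly u ?x"] by simp
    also have "poly (pderiv h) ?x + c * poly h ?x = - poly q2 ?x"
      using arg_cong[OF h, of "\<lambda>u. poly u ?x"] by simp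
    also have "poly q ?x = ?x * poly q2 ?x + q0" by (rule pq)
    also have "e x * (?x * poly q2 ?x + q0) * of_real (inverse x) + e x * poly p ?x * of_real (ln x)
       + e x * (- poly q2 ?x) + q0 * ((1 - e x) / ?x) - q0 * of_real (inverse x) = g x"
      using that by (simp add: g_def field_simps)
    finally show ?thesis .
  qed
  define \<epsilon> where "\<epsilon> = (\<lambda>n::nat. a / (real n + 3))"
  have ep: "0 < \<epsilon> n" "\<epsilon> n \<le> a - \<epsilon> n" "\<epsilon> n \<le> a" for n
    using a by (auto simp: \<epsilon>_def field_simps)
  have e0: "\<epsilon> \<longlonglongrightarrow> 0" unfolding \<epsilon>_def by real_asymp
  have "integral {\<epsilon> n..a - \<epsilon> n} g = \<Psi> (a - \<epsilon> n) - \<Psi> (\<epsilon> n)" for n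
  proof (rule integral_unique, rule fundamental_theorem_of_calculus[OF ep(2)])
    fix x assume "x \<in> {\<epsilon> n..a - \<epsilon> n}"
    then have "x > 0" using ep(1)[of n] by auto
    from \<Psi>[OF this] show "(\<Psi> has_vector_derivative g x) (at x within {\<epsilon> n..a - \<epsilon> n})"
      by (rule has_vector_derivative_at_within)
  qed
  then have lim: "(\<lambda>n. \<Psi> (a - \<epsilon> n) - \<Psi> (\<epsilon> n)) \<longlonglongrightarrow> integral {0..a} g"
    using integral_truncated_lim[OF a gint] by (simp add: \<epsilon>_def)
  have "(\<lambda>n. a - \<epsilon> n) \<longlonglongrightarrow> a - 0" by (intro tendsto_intros e0)
  then have l1: "(\<lambda>n. \<Psi> (a - \<epsilon> n)) \<longlonglongrightarrow> \<Psi> a"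
    using isCont_tendsto_compose[OF has_vector_derivative_continuous[OF \<Psi>[OF a]]] by simp
  have l2: "(\<lambda>n. \<Psi> (\<epsilon> n)) \<longlonglongrightarrow> poly h 0"
  proof -
    have "compact ((\<lambda>x. poly q2 (complex_of_real x)) ` {0..a})"
      by (intro compact_continuous_image continuous_intros compact_Icc)
    then obtain M where M: "\<And>x. x \<in> {0..a} \<Longrightarrow> norm (poly q2 (complex_of_real x)) \<le> M"
      using compact_imp_bounded[THEN iffD1[OF bounded_iff]] by (metis imageI)
    \<comment> \<open>The two logarithmic terms are taken together: e q - q0 is O(x), so their sum
      is O(x ln x), although each of them may diverge at 0.\<close>
    define z where "z = (\<lambda>x. (e x * poly q (of_real x) - q0) * of_real (ln x))"
    have ne: "norm (e x) = 1" for x by (simp add: e_def c_def)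
    have nz: "norm (z x) \<le> (M + norm q0 * w) * \<bar>x * ln x\<bar>" if "x \<in> {0..a}" for x
    proof -
      have "e x * poly q (of_real x) - q0 = of_real x * (e x * poly q2 (of_real x)) + q0 * (e x - 1)"
        by (simp add: pq algebra_simps)
      also have "norm \<dots> \<le> x * M + norm q0 * (w * x)"
      proof (intro norm_triangle_mono)
        show "norm (of_real x * (e x * poly q2 (of_real x))) \<le> x * M"
          using M[OF that] that by (simp add: norm_mult ne mult_left_mono)
        have "norm (e x - 1) \<le> w * x"
          using norm_exp_ii_minus_one_le[of "w * x"] that w by (simp add: e_def c_def mult.assoc)
        then show "norm (q0 * (e x - 1)) \<le> norm q0 * (w * x)"
          by (simp add: norm_mult mult_left_mono)
      qed
      finally have "norm (e x * poly q (of_real x) - q0) * \<bar>ln x\<bar> \<le> (x * M + norm q0 * (w * x)) * \<bar>ln x\<bar>"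
        by (rule mult_right_mono) simp
      moreover have "norm (z x) = norm (e x * poly q (of_real x) - q0) * \<bar>ln x\<bar>"
        unfolding z_def norm_mult by simp
      ultimately show ?thesis using that by (simp add: abs_mult algebra_simps)
    qed
    have "(\<lambda>n. z (\<epsilon> n)) \<longlonglongrightarrow> 0"
    proof (rule Lim_null_comparison)
      show "\<forall>\<^sub>F n in sequentially. norm (z (\<epsilon> n)) \<le> (M + norm q0 * w) * \<bar>\<epsilon> n * ln (\<epsilon> n)\<bar>"
        using ep by (intro always_eventually allI nz) (auto intro: less_imp_le)
      have "(\<lambda>n. \<epsilon> n * ln (\<epsilon> n)) \<longlonglongrightarrow> 0"
        using a unfolding \<epsilon>_def by real_asymp
      then show "(\<lambda>n. (M + norm q0 * w) * \<bar>\<epsilon> n * ln (\<epsilon> n)\<bar>) \<longlonglongrightarrow> 0"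
        by (auto intro!: tendsto_mult_right_zero tendsto_rabs_zero)
    qed
    moreover have "(\<lambda>n. e (\<epsilon> n) * poly h (of_real (\<epsilon> n))) \<longlonglongrightarrow> e 0 * poly h (of_real 0)"
      by (intro tendsto_mult isCont_tendsto_compose[OF _ e0] has_vector_derivative_continuous[OF e]
          has_vector_derivative_continuous[OF poly_of_real_has_vector_derivative])
    moreover have "(\<lambda>n. q0 * Ein (- c * of_real (\<epsilon> n))) \<longlonglongrightarrow> q0 * Ein (- c * of_real 0)"
      by (intro tendsto_intros isCont_tendsto_compose[OF DERIV_isCont[OF Ein_deriv]] e0)
    ultimately have "(\<lambda>n. z (\<epsilon> n) + e (\<epsilon> n) * poly h (of_real (\<epsilon> n)) + q0 * Ein (- c * of_real (\<epsilon> n)))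
        \<longlonglongrightarrow> 0 + e 0 * poly h (of_real 0) + q0 * Ein (- c * of_real 0)"
      by (intro tendsto_add)
    moreover have "\<Psi> x = z x + e x * poly h (of_real x) + q0 * Ein (- c * of_real x)" for x
      by (simp add: \<Psi>_def z_def algebra_simps)
    ultimately show ?thesis by (simp add: e_def Ein_0)
  qed
  have "integral {0..a} g = \<Psi> a - poly h 0"
    using LIMSEQ_unique[OF lim tendsto_diff[OF l1 l2]] .
  also have "\<dots> = levin_Q a w n f"
  proof -
    \<comment> \<open>The bracket in \<open>levin_h2\<close> is exactly Ein(-ca); here the constant
      \<gamma> of the method is matched.\<close>
    have "inc_Gamma0 (- c * of_real a) = - euler_mascheroni - Ln (- c * of_real a) + Ein (- c * of_real a)"
      using inc_Gamma0_eq[of "w * a"] a w by (simp add: c_def mult.assoc)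
    then have "levin_h2 a w n f a = q0 * exp (- c * of_real a) * Ein (- c * of_real a)"
      using a by (simp add: levin_h2_def q_def q0_def c_def)
    then have "exp (c * of_real a) * levin_h2 a w n f a = q0 * Ein (- c * of_real a)"
      by (simp add: exp_minus)
    then show ?thesis
      unfolding levin_Q_def \<Psi>_def
      by (simp add: q_def[symmetric] h_def[symmetric] q0_def[symmetric] c_def[symmetric] e_def ring_distribs)
  qed
  finally show ?thesis
    by (simp add: ln_osc_integral_def g_def e_def c_def)
qed

lemma levin_error_eq:
  assumes "a > 0" "w > 0" "n \<ge> 2"
    and "degree p \<le> n - 1" "\<And>j. j < n \<Longrightarrow> poly p (of_real (cgl_node a n j)) = f (cgl_node a n j)"
    and "continuous_on {0..a} f"
  shows "levin_error a w n f = norm (ln_osc_integral a w (\<lambda>x. f x - poly p (of_real x)))"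
proof -
  have "ln_osc_integral a w (\<lambda>x. f x - poly p (of_real x))
      = ln_osc_integral a w f - ln_osc_integral a w (\<lambda>x. poly p (of_real x))"
    by (intro ln_osc_integral_diff assms continuous_intros)
  then show ?thesis
    using levin_Q_eq_ln_osc_integral[OF assms(1-5)]
    by (simp add: levin_error_def ln_osc_integral_def)
qed

section \<open>Chebyshev polynomials\<close>

text \<open>The addition theorems for cos and sin with x = cos t: the pair is (T_m, U_(m-1)), and
  \<open>[:1, 0, -1:]\<close> is 1 - x^2, that is sin^2 t. Carrying both components keeps all
  inductions one-step.\<close>

primrec cheb_pair :: "nat \<Rightarrow> complex poly \<times> complex poly" where
  "cheb_pair 0 = (1, 0)"
| "cheb_pair (Suc m) =
     ([:0, 1:] * fst (cheb_pair m) - [:1, 0, -1:] * snd (cheb_pair m),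
      [:0, 1:] * snd (cheb_pair m) + fst (cheb_pair m))"

text \<open>\<open>cheb_W m\<close> is the polynomial \<open>U\<^bsub>m - 1\<^esub>\<close> of the second kind, with \<open>cheb_W 0 = 0\<close>.\<close>

definition cheb_T :: "nat \<Rightarrow> complex poly" where "cheb_T m = fst (cheb_pair m)"
definition cheb_W :: "nat \<Rightarrow> complex poly" where "cheb_W m = snd (cheb_pair m)"

lemma cheb_simps:
  "cheb_T 0 = 1" "cheb_W 0 = 0"
  "cheb_T (Suc m) = [:0, 1:] * cheb_T m - [:1, 0, -1:] * cheb_W m"
  "cheb_W (Suc m) = [:0, 1:] * cheb_W m + cheb_T m"
  by (simp_all add: cheb_T_def cheb_W_def)

lemma cheb_cos:
  "poly (cheb_T m) (of_real (cos t)) = of_real (cos (real m * t))"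
  "poly (cheb_W m) (of_real (cos t)) * of_real (sin t) = of_real (sin (real m * t))"
proof (induction m)
  case (Suc m)
  let ?c = "complex_of_real (cos t)" and ?s = "complex_of_real (sin t)"
  have m: "real (Suc m) * t = real m * t + t" by (simp add: algebra_simps)
  have "?s * ?s = of_real (1 - cos t * cos t)"
    using sin_squared_eq[of t] by (simp only: power2_eq_square of_real_mult[symmetric])
  then have "(poly (cheb_W m) ?c * ?s) * ?s = poly (cheb_W m) ?c * (1 - ?c * ?c)"
    by (simp add: mult.assoc)
  then have "poly (cheb_T (Suc m)) ?c = ?c * poly (cheb_T m) ?c - (poly (cheb_W m) ?c * ?s) * ?s"
    by (simp only:) (simp add: cheb_simps algebra_simps)
  then show "poly (cheb_T (Suc m)) ?c = of_real (cos (real (Suc m) * t))"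
    unfolding m Suc.IH cos_add by (simp add: mult.commute)
  have "poly (cheb_W (Suc m)) ?c * ?s = ?c * (poly (cheb_W m) ?c * ?s) + poly (cheb_T m) ?c * ?s"
    by (simp add: cheb_simps algebra_simps)
  then show "poly (cheb_W (Suc m)) ?c * ?s = of_real (sin (real (Suc m) * t))"
    unfolding m Suc.IH sin_add by (simp add: mult.commute)
qed (simp_all add: cheb_simps)

lemma degree_cheb: "degree (cheb_T m) \<le> m" "degree (cheb_W m) \<le> m - 1"
proof -
  have "degree (cheb_T m) \<le> m \<and> degree (cheb_W m) \<le> m - 1"
  proof (induction m)
    case (Suc m)
    have "degree ([:0, 1:] * cheb_T m) \<le> Suc m"
      using Suc by (intro order_trans[OF degree_mult_le]) auto
    moreover have "degree ([:1, 0, -1:] * cheb_W m) \<le> Suc m"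
    proof (cases "m = 0")
      case False
      then show ?thesis using Suc by (intro order_trans[OF degree_mult_le]) auto
    qed (simp add: cheb_simps)
    moreover have "degree ([:0, 1:] * cheb_W m) \<le> m"
    proof (cases "m = 0")
      case False
      then show ?thesis using Suc by (intro order_trans[OF degree_mult_le]) auto
    qed (simp add: cheb_simps)
    ultimately show ?case
      using Suc unfolding cheb_simps by (auto intro!: degree_diff_le degree_add_le)
  qed (simp add: cheb_simps)
  then show "degree (cheb_T m) \<le> m" "degree (cheb_W m) \<le> m - 1" by auto
qed

text \<open>The Chebyshev differential equation as a first-order system. The two identities need
  each other in the induction, and the second supplies the factor 1 - x^2 that tames the derivative
  of U_(m-1) at the ends.\<close>

lemma pderiv_cheb:
  "pderiv (cheb_T m) = of_nat m * cheb_W m"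
  "[:1, 0, -1:] * pderiv (cheb_W m) = [:0, 1:] * cheb_W m - of_nat m * cheb_T m"
proof (induction m)
  case (Suc m)
  let ?X = "[:0, 1:] :: complex poly" and ?V = "[:1, 0, -1:] :: complex poly"
  have V: "?V = 1 - ?X * ?X" by (simp add: one_pCons)
  have dX: "pderiv ?X = 1" "pderiv ?V = - (2 * ?X)" by (simp_all add: pderiv_pCons one_pCons numeral_poly)
  have "pderiv (cheb_T (Suc m)) = cheb_T m + ?X * pderiv (cheb_T m) + 2 * ?X * cheb_W m - ?V * pderiv (cheb_W m)"
    by (simp only: cheb_simps pderiv_diff pderiv_mult dX) (simp add: algebra_simps)
  also have "\<dots> = (1 + of_nat m) * (?X * cheb_W m + cheb_T m)"
    unfolding Suc.IH by (simp only: ring_distribs) (simp add: algebra_simps)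
  finally show "pderiv (cheb_T (Suc m)) = of_nat (Suc m) * cheb_W (Suc m)"
    by (simp add: cheb_simps)
  have "?V * pderiv (cheb_W (Suc m)) = ?V * cheb_W m + ?X * (?V * pderiv (cheb_W m)) + ?V * pderiv (cheb_T m)"
    by (simp only: cheb_simps pderiv_add pderiv_mult dX) (simp add: algebra_simps)
  also have "\<dots> = (1 + of_nat m) * (?V * cheb_W m) + ?X * (?X * cheb_W m - of_nat m * cheb_T m)"
    unfolding Suc.IH by (simp only: ring_distribs) (simp add: algebra_simps)
  also have "\<dots> = ?X * (?X * cheb_W m + cheb_T m) - (1 + of_nat m) * (?X * cheb_T m - ?V * cheb_W m)"
    by (simp only: ring_distribs) (simp add: algebra_simps)
  finally show "?V * pderiv (cheb_W (Suc m)) = ?X * cheb_W (Suc m) - of_nat (Suc m) * cheb_T (Suc m)"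
    by (simp only: cheb_simps of_nat_Suc)
qed (simp_all add: cheb_simps)

context
  fixes y :: real
  assumes y: "\<bar>y\<bar> \<le> 1"
begin

lemma norm_cheb_T_le: "norm (poly (cheb_T m) (of_real y)) \<le> 1"
  using cheb_cos(1)[of m "arccos y"] y by (simp add: cos_arccos abs_le_iff)

lemma norm_of_real_mult_le: "norm (complex_of_real y * z) \<le> norm z"
  using mult_right_mono[OF y norm_ge_zero[of z]] by (simp add: norm_mult)

lemma norm_cheb_W_le: "norm (poly (cheb_W m) (of_real y)) \<le> real m"
proof (induction m)
  case (Suc m)
  have "norm (of_real y * poly (cheb_W m) (of_real y) + poly (cheb_T m) (of_real y)) \<le> real m + 1"
    by (intro norm_triangle_mono norm_cheb_T_le order_trans[OF norm_of_real_mult_le] Suc)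
  then show ?case by (simp add: cheb_simps)
qed (simp add: cheb_simps)

text \<open>Differentiating the recursion and replacing T_m' by m U_(m-1) adds at most m + m^2 in
  each step, which fits below (m+1)^3 - m^3. Times m this is the bound m^4 for T_m''.\<close>

lemma norm_pderiv_cheb_W_le: "norm (poly (pderiv (cheb_W m)) (of_real y)) \<le> real m ^ 3"
proof (induction m)
  case (Suc m)
  let ?y = "complex_of_real y"
  have "poly (pderiv (cheb_W (Suc m))) ?y
      = ?y * poly (pderiv (cheb_W m)) ?y + poly (cheb_W m) ?y + of_nat m * poly (cheb_W m) ?y"
    by (simp add: cheb_simps pderiv_add pderiv_mult pderiv_pCons pderiv_cheb(1))
  also have "norm \<dots> \<le> real m ^ 3 + real m + real m * real m"
    by (intro norm_triangle_mono order_trans[OF norm_of_real_mult_le] Suc norm_cheb_W_le)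
       (simp add: norm_mult mult_left_mono norm_cheb_W_le)
  also have "\<dots> \<le> real (Suc m) ^ 3"
    by (simp add: power3_eq_cube algebra_simps)
  finally show ?case .
qed (simp add: cheb_simps)

lemma norm_pderiv_cheb_W_le': "(1 - y\<^sup>2) * norm (poly (pderiv (cheb_W m)) (of_real y)) \<le> 2 * real m"
proof -
  let ?y = "complex_of_real y"
  have u: "1 - y\<^sup>2 \<ge> 0" using y by (simp add: abs_square_le_1)
  have "(1 - of_real (y\<^sup>2)) * poly (pderiv (cheb_W m)) ?y
      = ?y * poly (cheb_W m) ?y - of_nat m * poly (cheb_T m) ?y"
    using arg_cong[OF pderiv_cheb(2)[of m], of "\<lambda>p. poly p ?y"]
    by (simp add: power2_eq_square algebra_simps)
  then have "norm ((1 - of_real (y\<^sup>2)) * poly (pderiv (cheb_W m)) ?y) \<le> real m + real m * 1"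
    by (simp only:) (intro norm_triangle_le_diff add_mono order_trans[OF norm_of_real_mult_le] norm_cheb_W_le,
       simp add: norm_mult norm_cheb_T_le mult_left_le)
  moreover have "norm (1 - complex_of_real (y\<^sup>2)) = 1 - y\<^sup>2"
    using u by (metis abs_of_nonneg norm_of_real of_real_1 of_real_diff)
  ultimately show ?thesis by (simp add: norm_mult)
qed

text \<open>Interpolating between \<open>\<bar>T\<^sub>m''\<bar> \<le> m\<^sup>4\<close> and \<open>(1 - y\<^sup>2) \<bar>T\<^sub>m''\<bar> \<le> 2 m\<^sup>2\<close> with exponents \<open>1/4\<close>
  and \<open>3/4\<close> gives a bound that is integrable in \<open>y\<close>.\<close>

lemma norm_pderiv2_cheb_T_le:
  assumes "\<bar>y\<bar> < 1"
  shows "norm (poly (pderiv (pderiv (cheb_T m))) (of_real y)) \<le> 2 * (real m ^ 2 * sqrt (real m)) * (1 - y\<^sup>2) powr (-3/4)"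
proof (cases "m = 0")
  case False
  define X where "X = norm (poly (pderiv (pderiv (cheb_T m))) (of_real y))"
  define u where "u = 1 - y\<^sup>2"
  have u: "u > 0" using assms by (simp add: u_def abs_square_less_1)
  have X: "X = real m * norm (poly (pderiv (cheb_W m)) (of_real y))"
    by (simp add: X_def pderiv_cheb(1) pderiv_mult norm_mult)
  have 1: "X \<le> real m ^ 4"
    using mult_left_mono[OF norm_pderiv_cheb_W_le[of m], of "real m"] unfolding X
    by (simp add: power3_eq_cube power4_eq_xxxx)
  have "u * X \<le> 2 * real m ^ 2"
    using mult_left_mono[OF norm_pderiv_cheb_W_le'[of m], of "real m"] unfolding X u_def
    by (simp add: power2_eq_square mult_ac)
  then have 2: "X \<le> 2 * real m ^ 2 / u" using u by (simp add: pos_le_divide_eq mult.commute)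
  have X0: "X \<ge> 0" by (simp add: X_def)
  have "X = X powr (1/4 + 3/4)" using X0 by simp
  also have "\<dots> = X powr (1/4) * X powr (3/4)" by (rule powr_add)
  \<comment> \<open>The powers of m combine as (m^4)^(1/4) (m^2)^(3/4) = m^(5/2).\<close>
  also have "\<dots> \<le> (real m ^ 4) powr (1/4) * (2 * real m ^ 2 / u) powr (3/4)"
    by (rule mult_mono[OF powr_mono2[OF _ X0 1] powr_mono2[OF _ X0 2]]) auto
  also have "(real m ^ 4) powr (1/4) = real m"
  proof -
    have "real m ^ 4 = real m powr 4" by simp
    then have "(real m ^ 4) powr (1/4) = real m powr (4 * (1/4))" by (simp only: powr_powr)
    then show ?thesis by simp
  qed
  also have "(2 * real m ^ 2 / u) powr (3/4) = 2 powr (3/4) * (real m * sqrt (real m)) * u powr (-3/4)"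
  proof -
    have "real m ^ 2 = real m powr 2" by simp
    then have "(real m ^ 2) powr (3/4) = real m powr (1 + 1/2)" by (simp only: powr_powr) simp
    also have "\<dots> = real m * sqrt (real m)" by (subst powr_add) (simp add: powr_half_sqrt)
    finally have "(2 * real m ^ 2) powr (3/4) = 2 powr (3/4) * (real m * sqrt (real m))"
      by (simp only: powr_mult)
    moreover have "(2 * real m ^ 2 / u) powr (3/4) = (2 * real m ^ 2) powr (3/4) / u powr (3/4)"
      by (rule powr_divide)
    moreover have "u powr (-3/4) = 1 / u powr (3/4)"
      using powr_minus_divide[of u "3/4"] by simp
    ultimately show ?thesis by simp
  qed
  also have "real m * (2 powr (3/4) * (real m * sqrt (real m)) * u powr (-3/4))
      \<le> real m * (2 powr 1 * (real m * sqrt (real m)) * u powr (-3/4))"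
  proof -
    have "2 powr (3/4) \<le> (2::real) powr 1" by (rule powr_mono) auto
    then show ?thesis by (intro mult_left_mono mult_right_mono) auto
  qed
  finally show ?thesis by (simp add: X_def u_def power2_eq_square mult_ac)
qed (simp add: cheb_simps)

end

section \<open>Chebyshev polynomials on the interval from 0 to a\<close>

text \<open>The map reverses orientation, so that x = a/2 (1 - cos t) goes to cos t, and the j-th
  node has the angle t = j \<pi>/(n-1) with no reindexing.\<close>

definition cheb_on :: "real \<Rightarrow> nat \<Rightarrow> complex poly" where
  "cheb_on a m = pcompose (cheb_T m) [:1, - (2 / of_real a):]"

lemma degree_cheb_on: "degree (cheb_on a m) \<le> m"
proof -
  have "degree (cheb_on a m) \<le> degree (cheb_T m) * degree [:1, - (2 / complex_of_real a):]"
    unfolding cheb_on_def by (rule degree_pcompose_le)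
  also have "\<dots> \<le> m * 1" by (intro mult_mono degree_cheb) auto
  finally show ?thesis by simp
qed

lemma poly_cheb_on: "poly (cheb_on a m) (of_real x) = poly (cheb_T m) (of_real (1 - 2 * x / a))"
  by (simp add: cheb_on_def poly_pcompose mult.commute)

lemma poly_cheb_on_cos:
  assumes "a > 0"
  shows "poly (cheb_on a m) (of_real (a / 2 * (1 - cos t))) = of_real (cos (real m * t))"
proof -
  have "1 - 2 * (a / 2 * (1 - cos t)) / a = cos t" using assms by (simp add: field_simps)
  then show ?thesis unfolding poly_cheb_on by (simp add: cheb_cos)
qed

lemma poly_pderiv_cheb_on:
  "poly (pderiv (cheb_on a m)) (of_real x) = - (2 / of_real a) * poly (pderiv (cheb_T m)) (of_real (1 - 2 * x / a))"
  "poly (pderiv (pderiv (cheb_on a m))) (of_real x) = (2 / of_real a)\<^sup>2 * poly (pderiv (pderiv (cheb_T m))) (of_real (1 - 2 * x / a))"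
  by (simp_all add: cheb_on_def pderiv_pcompose pderiv_mult pderiv_minus pderiv_smult pderiv_pCons
      poly_pcompose power2_eq_square mult.commute)

context
  fixes a :: real
  assumes a: "a > 0"
begin

lemma affine_bound: "x \<in> {0..a} \<Longrightarrow> \<bar>1 - 2 * x / a\<bar> \<le> 1"
  using a by (auto simp: abs_le_iff field_simps)

lemma norm_cheb_on_le: "x \<in> {0..a} \<Longrightarrow> norm (poly (cheb_on a m) (of_real x)) \<le> 1"
  unfolding poly_cheb_on by (intro norm_cheb_T_le affine_bound)

lemma cheb_on_deriv_bounds:
  obtains D where "D > 0"
    "\<And>m x. x \<in> {0..a} \<Longrightarrow> norm (poly (pderiv (cheb_on a m)) (of_real x)) \<le> D * (real m ^ 2 * sqrt (real m))"
    "\<And>m x. x \<in> {0<..<a} \<Longrightarrow> norm (poly (pderiv (pderiv (cheb_on a m))) (of_real x))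
       \<le> D * (real m ^ 2 * sqrt (real m)) * (x powr (-3/4) + (a - x) powr (-3/4))"
proof -
  define D2 where "D2 = (2 / a)\<^sup>2 * 2 * (2 / a) powr (-3/4)"
  define D where "D = 2 / a + D2"
  have D2: "D2 > 0" using a by (simp add: D2_def)
  have D: "D > 0" "2 / a \<le> D" "D2 \<le> D" using D2 a by (auto simp: D_def add_pos_pos)
  show ?thesis
  proof (rule that[OF D(1)])
    fix m x assume x: "x \<in> {0..a}"
    define y where "y = 1 - 2 * x / a"
    have y: "\<bar>y\<bar> \<le> 1" unfolding y_def by (rule affine_bound[OF x])
    have "norm (poly (pderiv (cheb_on a m)) (of_real x)) = 2 / a * (real m * norm (poly (cheb_W m) (of_real y)))"
      unfolding poly_pderiv_cheb_on y_def[symmetric] using a by (simp add: norm_mult norm_divide pderiv_cheb(1))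
    also have "\<dots> \<le> D * (real m * real m)"
      using a D by (intro mult_mono mult_left_mono norm_cheb_W_le[OF y]) auto
    also have "\<dots> \<le> D * (real m ^ 2 * sqrt (real m))"
    proof (cases "m = 0")
      case False
      then have "1 \<le> sqrt (real m)" by simp
      then have "real m ^ 2 * 1 \<le> real m ^ 2 * sqrt (real m)" by (intro mult_left_mono) auto
      then show ?thesis using D by (simp add: power2_eq_square)
    qed simp
    finally show "norm (poly (pderiv (cheb_on a m)) (of_real x)) \<le> D * (real m ^ 2 * sqrt (real m))" .
  next
    fix m x assume x: "x \<in> {0<..<a}"
    define y where "y = 1 - 2 * x / a"
    have y: "\<bar>y\<bar> < 1" using x a by (auto simp: y_def abs_less_iff field_simps)
    define p where "p = 2 / a * x"
    define q where "q = 2 / a * (a - x)"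
    have pq: "p > 0" "q > 0" "p + q = 2" using x a by (auto simp: p_def q_def field_simps)
    have "1 - y\<^sup>2 = p * q" using a by (simp add: y_def p_def q_def field_simps power2_eq_square)
    \<comment> \<open>Of two positive numbers with sum 2 one is at least 1, so the product is at
      least the other factor. This separates the singularities at 0 and a.\<close>
    moreover have "(p * q) powr (-3/4) \<le> p powr (-3/4) + q powr (-3/4)"
    proof (cases "p \<ge> 1")
      case True
      then have "(p * q) powr (-3/4) \<le> q powr (-3/4)" using pq by (intro powr_mono2') auto
      then show ?thesis by (simp add: add_increasing)
    next
      case False
      then have "(p * q) powr (-3/4) \<le> p powr (-3/4)" using pq by (intro powr_mono2') auto
      then show ?thesis by (simp add: add_increasing2)
    qed
    ultimately have u: "(1 - y\<^sup>2) powr (-3/4) \<le> (2 / a) powr (-3/4) * (x powr (-3/4) + (a - x) powr (-3/4))"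
    proof -
      have "p powr (-3/4) = (2 / a) powr (-3/4) * x powr (-3/4)"
        unfolding p_def by (rule powr_mult)
      moreover have "q powr (-3/4) = (2 / a) powr (-3/4) * (a - x) powr (-3/4)"
        unfolding q_def by (rule powr_mult)
      ultimately show ?thesis
        using \<open>1 - y\<^sup>2 = p * q\<close> \<open>(p * q) powr (-3/4) \<le> _\<close> by (simp only: distrib_left)
    qed
    have "norm (poly (pderiv (pderiv (cheb_on a m))) (of_real x))
        = (2 / a)\<^sup>2 * norm (poly (pderiv (pderiv (cheb_T m))) (of_real y))"
      unfolding poly_pderiv_cheb_on y_def[symmetric] using a by (simp add: norm_mult norm_divide norm_power)
    also have "\<dots> \<le> (2 / a)\<^sup>2 * (2 * (real m ^ 2 * sqrt (real m)) * ((2 / a) powr (-3/4) * (x powr (-3/4) + (a - x) powr (-3/4))))"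
      by (intro mult_left_mono order_trans[OF norm_pderiv2_cheb_T_le[OF _ y]] u) (use y in auto)
    also have "\<dots> = D2 * ((real m ^ 2 * sqrt (real m)) * (x powr (-3/4) + (a - x) powr (-3/4)))"
      by (simp add: D2_def mult_ac)
    also have "\<dots> \<le> D * ((real m ^ 2 * sqrt (real m)) * (x powr (-3/4) + (a - x) powr (-3/4)))"
      using D by (intro mult_right_mono) auto
    finally show "norm (poly (pderiv (pderiv (cheb_on a m))) (of_real x))
       \<le> D * (real m ^ 2 * sqrt (real m)) * (x powr (-3/4) + (a - x) powr (-3/4))"
      by (simp add: mult.assoc)
  qed
qed

end

text \<open>With N = n-1, on the grid of multiples of \<pi>/N the function cos(m t) depends only on
  m mod 2N, and a residue r > N may be replaced by 2N - r. The result is at most N, hence below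
  n.\<close>

lemma cos_alias:
  assumes "n \<ge> 2"
  shows "\<exists>l<n. \<forall>j. cos (real m * (real j * pi / (real n - 1))) = cos (real l * (real j * pi / (real n - 1)))"
proof -
  define N where "N = n - 1"
  have N: "N > 0" "real n - 1 = real N" using assms by (auto simp: N_def of_nat_diff)
  define r where "r = m mod (2 * N)"
  define d where "d = m div (2 * N)"
  have m: "m = 2 * N * d + r" by (simp add: r_def d_def)
  have r: "r < 2 * N" using N by (simp add: r_def)
  define t where "t = (\<lambda>j::nat. real j * pi / real N)"
  have Nt: "real N * t j = real j * pi" for j using N by (simp add: t_def)
  have "real m * t j = real r * t j + real d * (2 * (real N * t j))" for j
    by (subst m) (simp add: ring_distribs)
  then have "real m * t j = real r * t j + real (d * j) * (2 * pi)" for j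
    by (simp add: Nt)
  then have c: "cos (real m * t j) = cos (real r * t j)" for j
    using cos.plus_of_nat[of "real r * t j" "d * j"] by simp
  have "\<exists>l<n. \<forall>j. cos (real m * t j) = cos (real l * t j)"
  proof (cases "r \<le> N")
    case True
    then show ?thesis using c N(1) by (intro exI[of _ r]) (auto simp: N_def)
  next
    case False
    have "real (2 * N - r) * t j = - (real r * t j) + real j * (2 * pi)" for j
    proof -
      have "real (2 * N - r) * t j = 2 * (real N * t j) - real r * t j"
        using r by (simp add: of_nat_diff left_diff_distrib)
      then show ?thesis by (simp add: Nt)
    qed
    then have "cos (real (2 * N - r) * t j) = cos (real r * t j)" for j
      using cos.plus_of_nat[of "- (real r * t j)" j] by simp
    then show ?thesis using c N(1) False by (intro exI[of _ "2 * N - r"]) (auto simp: N_def)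
  qed
  then show ?thesis by (simp add: t_def N(2))
qed

section \<open>The error of a Chebyshev series\<close>

lemma cardinal_polys_exist:
  assumes "a > 0" "n \<ge> 2"
  shows "\<exists>L. \<forall>j. degree (L j) \<le> n - 1 \<and>
    (\<forall>i<n. poly (L j) (of_real (cgl_node a n i)) = (if i = j then 1 else 0 :: complex))"
proof (intro choice allI)
  fix j
  have "1 \<le> n" using assms(2) by simp
  from poly_interpolation_exists[OF cgl_node_inj[OF assms] this, of "\<lambda>i. if i = j then 1 else 0"]
  show "\<exists>p. degree p \<le> n - 1 \<and>
      (\<forall>i<n. poly p (of_real (cgl_node a n i)) = (if i = j then 1 else 0 :: complex))" .
qed

text \<open>For m < n the interpolant of T_m is T_m itself. Otherwise it is T_l with an alias l < n
  <= m, whose derivative bounds are no worse than those of T_m; this is the factor 2 in 2 D.\<close>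

lemma cheb_alias_error_bound:
  assumes a: "a > 0"
  shows "\<exists>A. A > 0 \<and> (\<forall>w>0. \<forall>n\<ge>2. \<forall>m. \<exists>q. degree q \<le> n - 1 \<and>
    (\<forall>j. poly q (of_real (cgl_node a n j)) = poly (cheb_on a m) (of_real (cgl_node a n j))) \<and>
    norm (ln_osc_integral a w (\<lambda>x. poly (cheb_on a m) (of_real x) - poly q (of_real x)))
      \<le> (if m < n then 0 else A * (1 + \<bar>ln w\<bar>) / w\<^sup>2 * (real m ^ 2 * sqrt (real m))))"
proof (rule ln_osc_integral_poly_bound[OF a])
  fix A :: real assume A: "A > 0" and bound: "\<And>w s K. w > 0 \<Longrightarrow> poly s 0 = 0 \<Longrightarrow> poly s (of_real a) = 0 \<Longrightarrow>
      (\<And>x. x \<in> {0..a} \<Longrightarrow> norm (poly (pderiv s) (of_real x)) \<le> K) \<Longrightarrow>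
      (\<And>x. x \<in> {0<..<a} \<Longrightarrow> norm (poly (pderiv (pderiv s)) (of_real x)) \<le> K * (x powr (-3/4) + (a - x) powr (-3/4)))
      \<Longrightarrow> norm (ln_osc_integral a w (\<lambda>x. poly s (of_real x))) \<le> A * (1 + \<bar>ln w\<bar>) / w\<^sup>2 * K"
  obtain D where D: "D > 0" and
    D1: "\<And>m x. x \<in> {0..a} \<Longrightarrow> norm (poly (pderiv (cheb_on a m)) (of_real x)) \<le> D * (real m ^ 2 * sqrt (real m))" and
    D2: "\<And>m x. x \<in> {0<..<a} \<Longrightarrow> norm (poly (pderiv (pderiv (cheb_on a m))) (of_real x))
       \<le> D * (real m ^ 2 * sqrt (real m)) * (x powr (-3/4) + (a - x) powr (-3/4))"
    using cheb_on_deriv_bounds[OF a] by blast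
  have "\<exists>q. degree q \<le> n - 1 \<and>
    (\<forall>j. poly q (of_real (cgl_node a n j)) = poly (cheb_on a m) (of_real (cgl_node a n j))) \<and>
    norm (ln_osc_integral a w (\<lambda>x. poly (cheb_on a m) (of_real x) - poly q (of_real x)))
      \<le> (if m < n then 0 else A * (2 * D) * (1 + \<bar>ln w\<bar>) / w\<^sup>2 * (real m ^ 2 * sqrt (real m)))"
    if w: "w > 0" and n: "n \<ge> 2" for w n m
  proof (cases "m < n")
    case True
    then show ?thesis
      using degree_cheb_on[of a m] by (intro exI[of _ "cheb_on a m"]) (auto simp: ln_osc_integral_def)
  next
    case False
    obtain l where l: "l < n" and al: "\<And>j. cos (real m * (real j * pi / (real n - 1))) = cos (real l * (real j * pi / (real n - 1)))"
      using cos_alias[OF n, of m] by blast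
    have node: "poly (cheb_on a l) (of_real (cgl_node a n j)) = poly (cheb_on a m) (of_real (cgl_node a n j))" for j
      unfolding cgl_node_def poly_cheb_on_cos[OF a] al ..
    define s where "s = cheb_on a m - cheb_on a l"
    define k where "k = (\<lambda>m::nat. real m ^ 2 * sqrt (real m))"
    define K where "K = 2 * D * k m"
    have "k l \<le> k m"
      unfolding k_def using False l by (intro mult_mono power_mono) auto
    then have kK: "D * k m + D * k l \<le> K"
      using D by (simp add: K_def distrib_left[symmetric])
    \<comment> \<open>The Lobatto grid contains both endpoints, which makes the residual vanish
      there and removes the boundary terms with the first antiderivative.\<close>
    have "cgl_node a n 0 = 0" by (simp add: cgl_node_def)
    then have s0: "poly s 0 = 0" using node[of 0] by (simp add: s_def)
    have "cgl_node a n (n - 1) = a" using n by (simp add: cgl_node_def of_nat_diff)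
    then have sa: "poly s (of_real a) = 0" using node[of "n - 1"] by (simp add: s_def)
    have "norm (ln_osc_integral a w (\<lambda>x. poly s (of_real x))) \<le> A * (1 + \<bar>ln w\<bar>) / w\<^sup>2 * K"
    proof (rule bound[OF w s0 sa])
      fix x assume "x \<in> {0..a}"
      then have "norm (poly (pderiv s) (of_real x)) \<le> D * k m + D * k l"
        unfolding s_def pderiv_diff poly_diff k_def by (intro norm_triangle_le_diff add_mono D1)
      with kK show "norm (poly (pderiv s) (of_real x)) \<le> K" by linarith
    next
      fix x assume x: "x \<in> {0<..<a}"
      let ?o = "x powr (-3/4) + (a - x) powr (-3/4)"
      have "norm (poly (pderiv (pderiv s)) (of_real x)) \<le> D * k m * ?o + D * k l * ?o"
        unfolding s_def pderiv_diff poly_diff k_def by (intro norm_triangle_le_diff add_mono D2 x)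
      also have "\<dots> \<le> K * ?o"
        using mult_right_mono[OF kK, of ?o] by (simp add: distrib_right)
      finally show "norm (poly (pderiv (pderiv s)) (of_real x)) \<le> K * ?o" .
    qed
    also have "A * (1 + \<bar>ln w\<bar>) / w\<^sup>2 * K = A * (2 * D) * (1 + \<bar>ln w\<bar>) / w\<^sup>2 * k m"
      by (simp add: K_def)
    finally have "norm (ln_osc_integral a w (\<lambda>x. poly (cheb_on a m) (of_real x) - poly (cheb_on a l) (of_real x)))
        \<le> A * (2 * D) * (1 + \<bar>ln w\<bar>) / w\<^sup>2 * k m"
      by (simp only: s_def poly_diff)
    moreover have "degree (cheb_on a l) \<le> n - 1" using degree_cheb_on[of a l] l by linarith
    ultimately show ?thesis
      using node False unfolding k_def by (intro exI[of _ "cheb_on a l"] conjI) simp_all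
  qed
  then show ?thesis using A D by (intro exI[of _ "A * (2 * D)"]) auto
qed

text \<open>The difficulty is to interpolate and integrate an infinite series term by term. For
  fixed n the interpolation operator is bounded through its cardinal polynomials, so the truncated
  tail contributes at most \<tau>_N (1 + n M) times the integral of |ln x|. This tends to 0 as N
  grows, however large M is; only the sum S survives.\<close>

lemma levin_error_cheb_series:
  assumes a: "a > 0"
  shows "\<exists>A. A > 0 \<and> (\<forall>w>0. \<forall>n\<ge>2. \<forall>f b S. continuous_on {0..a} f \<and> summable (\<lambda>m. norm (b m)) \<and>
    (\<forall>x\<in>{0..a}. (\<lambda>m. b m * poly (cheb_on a m) (of_real x)) sums f x) \<and>
    (\<forall>N. (\<Sum>m=n..<N. norm (b m) * (real m ^ 2 * sqrt (real m))) \<le> S) \<longrightarrow>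
    levin_error a w n f \<le> A * (1 + \<bar>ln w\<bar>) / w\<^sup>2 * S)"
proof -
  obtain A where A: "A > 0" and alias_bound: "\<And>w n m. w > 0 \<Longrightarrow> n \<ge> 2 \<Longrightarrow> \<exists>q. degree q \<le> n - 1 \<and>
    (\<forall>j. poly q (of_real (cgl_node a n j)) = poly (cheb_on a m) (of_real (cgl_node a n j))) \<and>
    norm (ln_osc_integral a w (\<lambda>x. poly (cheb_on a m) (of_real x) - poly q (of_real x)))
      \<le> (if m < n then 0 else A * (1 + \<bar>ln w\<bar>) / w\<^sup>2 * (real m ^ 2 * sqrt (real m)))"
    using cheb_alias_error_bound[OF a] by blast
  have "levin_error a w n f \<le> A * (1 + \<bar>ln w\<bar>) / w\<^sup>2 * S"
    if w: "w > 0" and n: "n \<ge> 2" and f: "continuous_on {0..a} f" and sb: "summable (\<lambda>m. norm (b m))"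
      and fs: "\<And>x. x \<in> {0..a} \<Longrightarrow> (\<lambda>m. b m * poly (cheb_on a m) (of_real x)) sums f x"
      and S: "\<And>N. (\<Sum>m=n..<N. norm (b m) * (real m ^ 2 * sqrt (real m))) \<le> S"
    for w n f b S
  proof -
    define t where "t = (\<lambda>m x. poly (cheb_on a m) (complex_of_real x))"
    define X where "X = cgl_node a n"
    define B where "B = A * (1 + \<bar>ln w\<bar>) / w\<^sup>2"
    have B: "B \<ge> 0" using A by (simp add: B_def)
    have X: "X j \<in> {0..a}" for j unfolding X_def by (rule cgl_node_bounds[OF a])
    obtain L where L: "\<And>j. degree (L j) \<le> n - 1"
      "\<And>i j. i < n \<Longrightarrow> poly (L j) (of_real (X i)) = (if i = j then 1 else 0 :: complex)"
      using cardinal_polys_exist[OF a n] unfolding X_def by blast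
    define I where "I = (\<lambda>r. \<Sum>j<n. smult (r (X j)) (L j))"
    have I_deg: "degree (I r) \<le> n - 1" for r
      unfolding I_def by (intro degree_sum_le order_trans[OF degree_smult_le L(1)]) auto
    have I_node: "poly (I r) (of_real (X i)) = r (X i)" if "i < n" for r i
    proof -
      have "poly (I r) (of_real (X i)) = (\<Sum>j<n. if j = i then r (X j) else 0)"
        unfolding I_def poly_sum by (intro sum.cong) (auto simp: L(2)[OF that])
      then show ?thesis using that by simp
    qed
    define e where "e = (\<lambda>m x. t m x - poly (I (t m)) (of_real x))"
    have ct: "continuous_on T (t m)" for T m unfolding t_def by (intro continuous_intros)
    have ce: "continuous_on T (e m)" for T m unfolding e_def by (intro continuous_intros ct)
    have e: "norm (ln_osc_integral a w (e m)) \<le> (if m < n then 0 else B * (real m ^ 2 * sqrt (real m)))" for m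
    proof -
      obtain q where q: "degree q \<le> n - 1"
        "\<And>j. poly q (of_real (X j)) = t m (X j)"
        "norm (ln_osc_integral a w (\<lambda>x. t m x - poly q (of_real x)))
           \<le> (if m < n then 0 else B * (real m ^ 2 * sqrt (real m)))"
        using alias_bound[OF w n, of m] unfolding X_def t_def B_def by blast
      \<comment> \<open>The alias polynomial is the cardinal-form interpolant, by uniqueness. The
        cardinal form is linear in the data, the alias form carries the error bound.\<close>
      have "I (t m) = q"
      proof (rule poly_eq_on_nodes[OF cgl_node_inj[OF a n]])
        show "degree (I (t m)) < n" "degree q < n" using I_deg[of "t m"] q(1) n by auto
        show "poly (I (t m)) (of_real (cgl_node a n j)) = poly q (of_real (cgl_node a n j))" if "j < n" for j
          using I_node[OF that, of "t m"] q(2)[of j] by (simp add: X_def)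
      qed
      then show ?thesis using q(3) by (simp add: e_def)
    qed
    obtain M where M: "\<And>j x. j < n \<Longrightarrow> x \<in> {0..a} \<Longrightarrow> norm (poly (L j) (complex_of_real x)) \<le> M"
    proof -
      have "\<exists>M. \<forall>x\<in>{0..a}. norm (poly (L j) (complex_of_real x)) \<le> M" for j
      proof -
        have "compact ((\<lambda>x. poly (L j) (complex_of_real x)) ` {0..a})"
          by (intro compact_continuous_image continuous_intros compact_Icc)
        then show ?thesis
          using compact_imp_bounded[THEN iffD1[OF bounded_iff]] by (metis imageI)
      qed
      then obtain M where M: "\<And>j x. x \<in> {0..a} \<Longrightarrow> norm (poly (L j) (complex_of_real x)) \<le> M j"
        by metis
      show ?thesis
      proof (rule that)
        fix j x assume "j < n" "x \<in> {0..a}"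
        then show "norm (poly (L j) (complex_of_real x)) \<le> Max (M ` {..<n})"
          by (intro order_trans[OF M Max_ge]) auto
      qed
    qed
    define \<tau> where "\<tau> = (\<lambda>N. \<Sum>m. norm (b (m + N)))"
    have \<tau>0: "\<tau> \<longlonglongrightarrow> 0"
      unfolding \<tau>_def by (rule suminf_exist_split2[OF sb])
    define s where "s = (\<lambda>N x. \<Sum>m<N. b m * t m x)"
    have cs: "continuous_on T (s N)" for T N unfolding s_def by (intro continuous_intros ct)
    have tail: "norm (f x - s N x) \<le> \<tau> N" if x: "x \<in> {0..a}" for N x
    proof -
      have le: "norm (b m * t m x) \<le> norm (b m)" for m
        using norm_cheb_on_le[OF a x, of m] by (simp add: norm_mult t_def mult_left_le)
      have sN: "summable (\<lambda>m. norm (b (m + N)))" by (rule summable_ignore_initial_segment[OF sb])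
      have sN': "summable (\<lambda>m. norm (b (m + N) * t (m + N) x))"
        by (rule summable_comparison_test'[OF sN, of 0]) (use le in auto)
      have "(\<lambda>m. b m * t m x) sums f x" using fs[OF x] by (simp add: t_def)
      then have "f x - s N x = (\<Sum>m. b (m + N) * t (m + N) x)"
        unfolding s_def by (intro sums_unique) (rule sums_split_initial_segment)
      also have "norm \<dots> \<le> (\<Sum>m. norm (b (m + N) * t (m + N) x))"
        by (rule summable_norm[OF sN'])
      also have "\<dots> \<le> \<tau> N"
        unfolding \<tau>_def by (rule suminf_le[OF le sN' sN])
      finally show ?thesis .
    qed
    define E where "E = (\<lambda>N x. f x - poly (I f) (of_real x) - (\<Sum>m<N. b m * e m x))"
    have E: "norm (E N x) \<le> \<tau> N * (1 + real n * M)" if x: "x \<in> {0..a}" for N x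
    proof -
      have pI: "poly (I r) z = (\<Sum>j<n. r (X j) * poly (L j) z)" for r z
        by (simp add: I_def poly_sum)
      have "(\<Sum>m<N. b m * poly (I (t m)) (of_real x)) = (\<Sum>j<n. s N (X j) * poly (L j) (of_real x))"
        unfolding pI s_def sum_distrib_left sum_distrib_right by (subst sum.swap) (simp add: mult.assoc)
      then have "E N x = (f x - s N x) - (\<Sum>j<n. (f (X j) - s N (X j)) * poly (L j) (of_real x))"
        unfolding E_def e_def s_def pI[of f] right_diff_distrib left_diff_distrib sum_subtractf by simp
      also have "norm \<dots> \<le> \<tau> N + (\<Sum>j<n. \<tau> N * M)"
      proof (rule norm_triangle_le_diff[OF add_mono[OF tail[OF x] sum_norm_le]])
        fix j assume "j \<in> {..<n}"
        then show "norm ((f (X j) - s N (X j)) * poly (L j) (of_real x)) \<le> \<tau> N * M"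
          unfolding norm_mult using tail[OF X] M[OF _ x]
          by (intro mult_mono) (auto intro: order_trans[OF norm_ge_zero])
      qed
      finally show ?thesis by (simp add: algebra_simps)
    qed
    define J where "J = integral {0..a} (\<lambda>x. \<bar>ln x\<bar>)"
    define f' where "f' = (\<lambda>x. f x - poly (I f) (of_real x))"
    have cf': "continuous_on {0..a} f'" unfolding f'_def by (intro continuous_intros f)
    have cse: "continuous_on {0..a} (\<lambda>x. \<Sum>m<N. b m * e m x)" for N
      by (intro continuous_intros ce)
    have main: "norm (ln_osc_integral a w f') \<le> B * S + \<tau> N * (1 + real n * M) * J" for N
    proof -
      have cE: "continuous_on {0..a} (E N)"
        unfolding E_def by (intro continuous_intros f ce)
      have "ln_osc_integral a w (E N) = ln_osc_integral a w f' - ln_osc_integral a w (\<lambda>x. \<Sum>m<N. b m * e m x)"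
        unfolding E_def f'_def[symmetric] using ln_osc_integral_diff[OF cf' cse] by (simp add: f'_def)
      also have "ln_osc_integral a w (\<lambda>x. \<Sum>m<N. b m * e m x) = (\<Sum>m<N. b m * ln_osc_integral a w (e m))"
        by (rule ln_osc_integral_sum) (auto intro: ce)
      finally have eq: "ln_osc_integral a w f' = (\<Sum>m<N. b m * ln_osc_integral a w (e m)) + ln_osc_integral a w (E N)"
        by simp
      have "norm (\<Sum>m<N. b m * ln_osc_integral a w (e m))
          \<le> (\<Sum>m<N. norm (b m) * (if m < n then 0 else B * (real m ^ 2 * sqrt (real m))))"
        by (intro sum_norm_le) (simp only: norm_mult, intro mult_left_mono e norm_ge_zero)
      also have "\<dots> = (\<Sum>m=n..<N. norm (b m) * (B * (real m ^ 2 * sqrt (real m))))"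
        by (intro sum.mono_neutral_cong_right) auto
      also have "\<dots> = B * (\<Sum>m=n..<N. norm (b m) * (real m ^ 2 * sqrt (real m)))"
        by (simp add: sum_distrib_left mult_ac)
      also have "\<dots> \<le> B * S" by (rule mult_left_mono[OF S B])
      finally have 1: "norm (\<Sum>m<N. b m * ln_osc_integral a w (e m)) \<le> B * S" .
      have 2: "norm (ln_osc_integral a w (E N)) \<le> \<tau> N * (1 + real n * M) * J"
        unfolding J_def by (rule norm_ln_osc_integral_le[OF cE E])
      show ?thesis unfolding eq by (rule norm_triangle_mono[OF 1 2])
    qed
    have "(\<lambda>N. B * S + \<tau> N * (1 + real n * M) * J) \<longlonglongrightarrow> B * S + 0 * (1 + real n * M) * J"
      by (intro tendsto_intros \<tau>0)
    then have "norm (ln_osc_integral a w f') \<le> B * S + 0 * (1 + real n * M) * J"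
      by (rule LIMSEQ_le_const) (use main in auto)
    moreover have "levin_error a w n f = norm (ln_osc_integral a w f')"
      unfolding f'_def by (rule levin_error_eq[OF a w n I_deg _ f]) (use I_node in \<open>simp add: X_def\<close>)
    ultimately show ?thesis by (simp add: B_def)
  qed
  then show ?thesis using A by blast
qed

section \<open>Fourier coefficients\<close>

lemma cis_has_vector_derivative:
  "((\<lambda>t. cis (k * t)) has_vector_derivative \<i> * of_real k * cis (k * t)) (at t within S)"
proof -
  have "((\<lambda>z. exp (\<i> * of_real k * z)) has_field_derivative \<i> * of_real k * exp (\<i> * of_real k * of_real t)) (at (of_real t))"
    by (auto intro!: derivative_eq_intros)
  from has_vector_derivative_real_field[OF this, of S] show ?thesis
    by (simp add: cis_conv_exp mult.assoc)
qed

lemma has_integral_cis_period: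
  "((\<lambda>t. cis (of_int k * t)) has_integral (if k = 0 then 2 * pi else 0)) {0..2 * pi}"
proof (cases "k = 0")
  case True
  then show ?thesis using has_integral_const_real[of "1::complex" 0 "2 * pi"] by (simp add: scaleR_conv_of_real)
next
  case False
  have "((\<lambda>t. cis (of_int k * t) / (\<i> * of_real (of_int k))) has_vector_derivative cis (of_int k * t)) (at t within {0..2 * pi})" for t
    using has_vector_derivative_divide[OF cis_has_vector_derivative[of "of_int k" t "{0..2 * pi}"], of "\<i> * of_real (of_int k)"] False
    by simp
  from fundamental_theorem_of_calculus[OF _ this]
  have "((\<lambda>t. cis (of_int k * t)) has_integral
      cis (of_int k * (2 * pi)) / (\<i> * of_real (of_int k)) - cis (of_int k * 0) / (\<i> * of_real (of_int k))) {0..2 * pi}"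
    by simp
  moreover have "cis (of_int k * (2 * pi)) = 1"
    using cis_multiple_2pi[of "of_int k"] by (simp add: mult_ac)
  ultimately show ?thesis using False by simp
qed

text \<open>Unnormalised: the factor 1/(2\<pi>) is left out, so the orthogonal projection in
  Bessel's inequality is P/(2\<pi>).\<close>

definition fourier_coeff :: "(real \<Rightarrow> complex) \<Rightarrow> nat \<Rightarrow> complex" where
  "fourier_coeff g m = integral {0..2 * pi} (\<lambda>t. g t * cis (- (real m * t)))"

lemma fourier_coeff_has_integral:
  assumes "continuous_on {0..2 * pi} g"
  shows "((\<lambda>t. g t * cis (- (real m * t))) has_integral fourier_coeff g m) {0..2 * pi}"
  unfolding fourier_coeff_def
  by (intro integrable_integral integrable_continuous_interval continuous_intros assms)

text \<open>The integral of |g - P/(2\<pi>)|^2 is nonnegative and equals J - Q/(2\<pi>), where P is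
  the trigonometric sum with the coefficients of g and Q is the sum of their squared moduli.\<close>

lemma bessel_inequality:
  assumes g: "continuous_on {0..2 * pi} g"
  shows "\<exists>B. \<forall>N. (\<Sum>m<N. (norm (fourier_coeff g m))\<^sup>2) \<le> B"
proof -
  define J where "J = integral {0..2 * pi} (\<lambda>t. g t * cnj (g t))"
  have gg: "((\<lambda>t. g t * cnj (g t)) has_integral J) {0..2 * pi}"
    unfolding J_def by (intro integrable_integral integrable_continuous_interval continuous_intros g)
  have "(\<Sum>m<N. (norm (fourier_coeff g m))\<^sup>2) \<le> 2 * pi * Re J" for N
  proof -
    define c where "c = fourier_coeff g"
    define Q where "Q = (\<Sum>m<N. c m * cnj (c m))"
    define P where "P = (\<lambda>t. \<Sum>m<N. c m * cis (real m * t))"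
    have Q: "Q = of_real (\<Sum>m<N. (norm (c m))\<^sup>2)"
      unfolding Q_def of_real_sum by (intro sum.cong refl complex_norm_square[symmetric])
    have "((\<lambda>t. \<Sum>m<N. cnj (c m) * (g t * cis (- (real m * t)))) has_integral (\<Sum>m<N. cnj (c m) * c m)) {0..2 * pi}"
      unfolding c_def by (intro has_integral_sum has_integral_mult_right fourier_coeff_has_integral g) simp
    moreover have "(\<Sum>m<N. cnj (c m) * (g t * cis (- (real m * t)))) = g t * cnj (P t)" for t
      by (simp add: P_def sum_distrib_left mult_ac cis_cnj)
    moreover have "(\<Sum>m<N. cnj (c m) * c m) = Q" by (simp add: Q_def mult.commute)
    ultimately have gP: "((\<lambda>t. g t * cnj (P t)) has_integral Q) {0..2 * pi}" by simp
    then have "(cnj \<circ> (\<lambda>t. g t * cnj (P t)) has_integral cnj Q) {0..2 * pi}"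
      by (subst has_integral_cnj)
    moreover have "cnj Q = Q" unfolding Q by simp
    ultimately have Pg: "((\<lambda>t. P t * cnj (g t)) has_integral Q) {0..2 * pi}"
      by (simp add: o_def mult.commute)
    have "((\<lambda>t. \<Sum>m<N. \<Sum>k<N. (c m * cnj (c k)) * cis (of_int (int m - int k) * t)) has_integral
       (\<Sum>m<N. \<Sum>k<N. (c m * cnj (c k)) * (if int m - int k = 0 then 2 * pi else 0))) {0..2 * pi}"
      by (intro has_integral_sum has_integral_mult_right has_integral_cis_period) auto
    moreover have "(\<Sum>m<N. \<Sum>k<N. (c m * cnj (c k)) * cis (of_int (int m - int k) * t)) = P t * cnj (P t)" for t
    proof -
      have "cis (of_int (int m - int k) * t) = cis (real m * t) * cnj (cis (real k * t))" for m k
        by (simp add: cis_cnj cis_mult left_diff_distrib)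
      then show ?thesis
        by (simp add: P_def sum_product mult_ac)
    qed
    moreover have "(\<Sum>m<N. \<Sum>k<N. (c m * cnj (c k)) * (if int m - int k = 0 then 2 * pi else 0)) = 2 * pi * Q"
    proof -
      have "(\<Sum>k<N. (c m * cnj (c k)) * (if int m - int k = 0 then 2 * pi else 0)) = c m * cnj (c m) * (2 * pi)"
        if "m < N" for m
      proof -
        have "(\<Sum>k<N. (c m * cnj (c k)) * (if int m - int k = 0 then 2 * pi else 0))
            = (\<Sum>k<N. if k = m then c m * cnj (c m) * (2 * pi) else 0)"
          by (intro sum.cong) auto
        then show ?thesis using that by simp
      qed
      then show ?thesis by (simp add: Q_def sum_distrib_left mult_ac)
    qed
    ultimately have PP: "((\<lambda>t. P t * cnj (P t)) has_integral 2 * pi * Q) {0..2 * pi}" by simp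
    define h where "h = (\<lambda>t. g t - P t / (2 * pi))"
    have "((\<lambda>t. g t * cnj (g t) - 1 / (2 * pi) * (g t * cnj (P t)) - 1 / (2 * pi) * (P t * cnj (g t))
        + 1 / (2 * pi) * (1 / (2 * pi)) * (P t * cnj (P t))) has_integral
        (J - 1 / (2 * pi) * Q - 1 / (2 * pi) * Q + 1 / (2 * pi) * (1 / (2 * pi)) * (2 * pi * Q))) {0..2 * pi}"
      by (intro has_integral_add has_integral_diff has_integral_mult_right gg gP Pg PP)
    moreover have "g t * cnj (g t) - 1 / (2 * pi) * (g t * cnj (P t)) - 1 / (2 * pi) * (P t * cnj (g t))
        + 1 / (2 * pi) * (1 / (2 * pi)) * (P t * cnj (P t)) = of_real ((norm (h t))\<^sup>2)" for t
      unfolding complex_norm_square h_def by (simp add: algebra_simps)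
    moreover have "J - 1 / (2 * pi) * Q - 1 / (2 * pi) * Q + 1 / (2 * pi) * (1 / (2 * pi)) * (2 * pi * Q) = J - Q / (2 * pi)"
      by simp
    ultimately have "((\<lambda>t. complex_of_real ((norm (h t))\<^sup>2)) has_integral (J - Q / (2 * pi))) {0..2 * pi}" by simp
    from has_integral_linear[OF this bounded_linear_Re]
    have "((\<lambda>t. (norm (h t))\<^sup>2) has_integral Re (J - Q / (2 * pi))) {0..2 * pi}"
      unfolding o_def Re_complex_of_real .
    then have "Re (J - Q / (2 * pi)) \<ge> 0" by (rule has_integral_nonneg) simp
    then have "(\<Sum>m<N. (norm (c m))\<^sup>2) / (2 * pi) \<le> Re J" unfolding Q by (simp add: Re_divide_of_real)
    then show ?thesis by (simp add: c_def divide_le_eq mult.commute)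
  qed
  then show ?thesis by blast
qed

section \<open>Periodic functions of class C^k and the decay of their Fourier coefficients\<close>

text \<open>The recursion hides the derivatives behind an existential, so that closure under
  products needs no Leibniz formula for higher orders. Periodicity is required at every level
  because it cancels the boundary terms in each integration by parts.\<close>

primrec periodic_Ck :: "nat \<Rightarrow> (real \<Rightarrow> complex) \<Rightarrow> bool" where
  "periodic_Ck 0 g \<longleftrightarrow> continuous_on UNIV g \<and> (\<forall>t. g (t + 2 * pi) = g t)"
| "periodic_Ck (Suc k) g \<longleftrightarrow> (\<forall>t. g (t + 2 * pi) = g t) \<and>
     (\<exists>g'. (\<forall>t. (g has_vector_derivative g' t) (at t)) \<and> periodic_Ck k g')"

lemma periodic_Ck_periodic: "periodic_Ck k g \<Longrightarrow> g (t + 2 * pi) = g t"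
  by (cases k) auto

lemma periodic_Ck_continuous: "periodic_Ck k g \<Longrightarrow> continuous_on S g"
proof (cases k)
  case 0
  then show "periodic_Ck k g \<Longrightarrow> ?thesis" by (auto intro: continuous_on_subset)
next
  case (Suc l)
  assume "periodic_Ck k g"
  then obtain g' where "\<And>t. (g has_vector_derivative g' t) (at t)" using Suc by auto
  then have "isCont g t" for t by (rule has_vector_derivative_continuous)
  then show ?thesis by (simp add: continuous_at_imp_continuous_on)
qed

lemma periodic_Ck_Suc_imp: "periodic_Ck (Suc k) g \<Longrightarrow> periodic_Ck k g"
proof (induction k arbitrary: g)
  case 0
  then show ?case using periodic_Ck_continuous[OF 0] by auto
next
  case (Suc k)
  then show ?case unfolding periodic_Ck.simps(2)[of "Suc k"] periodic_Ck.simps(2)[of k g] by blast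
qed

lemma periodic_Ck_add: "periodic_Ck k g \<Longrightarrow> periodic_Ck k h \<Longrightarrow> periodic_Ck k (\<lambda>t. g t + h t)"
proof (induction k arbitrary: g h)
  case 0
  then show ?case by (auto intro: continuous_intros)
next
  case (Suc k)
  from Suc.prems obtain g' h' where
    "\<And>t. (g has_vector_derivative g' t) (at t)" "periodic_Ck k g'"
    "\<And>t. (h has_vector_derivative h' t) (at t)" "periodic_Ck k h'" by auto
  then have "\<forall>t. ((\<lambda>t. g t + h t) has_vector_derivative g' t + h' t) (at t)" "periodic_Ck k (\<lambda>t. g' t + h' t)"
    by (simp_all add: has_vector_derivative_add Suc.IH)
  then show ?case
    unfolding periodic_Ck.simps(2) periodic_Ck_periodic[OF Suc.prems(1)] periodic_Ck_periodic[OF Suc.prems(2)]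
    by (intro conjI exI[of _ "\<lambda>t. g' t + h' t"]) simp_all
qed

lemma periodic_Ck_mult: "periodic_Ck k g \<Longrightarrow> periodic_Ck k h \<Longrightarrow> periodic_Ck k (\<lambda>t. g t * h t)"
proof (induction k arbitrary: g h)
  case 0
  then show ?case by (auto intro: continuous_intros)
next
  case (Suc k)
  from Suc.prems obtain g' h' where gh:
    "\<And>t. (g has_vector_derivative g' t) (at t)" "periodic_Ck k g'"
    "\<And>t. (h has_vector_derivative h' t) (at t)" "periodic_Ck k h'" by auto
  have "periodic_Ck k (\<lambda>t. g t * h' t + g' t * h t)"
    using Suc.prems[THEN periodic_Ck_Suc_imp] gh by (intro periodic_Ck_add Suc.IH)
  moreover have "\<forall>t. ((\<lambda>t. g t * h t) has_vector_derivative g t * h' t + g' t * h t) (at t)"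
    using gh by (simp add: has_vector_derivative_mult)
  ultimately show ?case
    unfolding periodic_Ck.simps(2) periodic_Ck_periodic[OF Suc.prems(1)] periodic_Ck_periodic[OF Suc.prems(2)]
    by (intro conjI exI[of _ "\<lambda>t. g t * h' t + g' t * h t"]) simp_all
qed

text \<open>Differentiation exchanges the two families and changes a sign; hence the conjunction and
  the free factor c in the induction.\<close>

lemma periodic_Ck_sin_cos:
  "periodic_Ck k (\<lambda>t. complex_of_real (c * sin t)) \<and> periodic_Ck k (\<lambda>t. complex_of_real (c * cos t))"
proof (induction k arbitrary: c)
  case 0
  show ?case by (auto intro!: continuous_intros)
next
  case (Suc k)
  have s: "((\<lambda>t. complex_of_real (c * sin t)) has_vector_derivative of_real (c * cos t)) (at t)" for t
    by (rule has_vector_derivative_of_real) (auto intro!: derivative_eq_intros)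
  have c: "((\<lambda>t. complex_of_real (c * cos t)) has_vector_derivative of_real (- c * sin t)) (at t)" for t
    by (rule has_vector_derivative_of_real) (auto intro!: derivative_eq_intros)
  show ?case
  proof
    show "periodic_Ck (Suc k) (\<lambda>t. complex_of_real (c * sin t))"
      unfolding periodic_Ck.simps(2) sin_periodic
      by (intro conjI exI[of _ "\<lambda>t. complex_of_real (c * cos t)"] allI refl s conjunct2[OF Suc[of c]])
    show "periodic_Ck (Suc k) (\<lambda>t. complex_of_real (c * cos t))"
      unfolding periodic_Ck.simps(2) cos_periodic
      by (intro conjI exI[of _ "\<lambda>t. complex_of_real (- c * sin t)"] allI refl c conjunct1[OF Suc[of "- c"]])
  qed
qed

lemma fourier_coeff_derivative:
  assumes g: "\<And>t. (g has_vector_derivative g' t) (at t)" and g': "continuous_on UNIV g'"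
    and per: "g (0 + 2 * pi) = g 0"
  shows "fourier_coeff g' m = \<i> * of_real (real m) * fourier_coeff g m"
proof -
  have cg: "continuous_on {0..2 * pi} g"
    using g by (intro continuous_at_imp_continuous_on ballI) (blast intro: has_vector_derivative_continuous)
  have cg': "continuous_on {0..2 * pi} g'" using g' by (rule continuous_on_subset) simp
  have "((\<lambda>t. g t * cis (- real m * t)) has_vector_derivative
      g t * (\<i> * of_real (- real m) * cis (- real m * t)) + g' t * cis (- real m * t)) (at t within {0..2 * pi})" for t
    by (intro has_vector_derivative_mult cis_has_vector_derivative has_vector_derivative_at_within[OF g])
  from fundamental_theorem_of_calculus[OF _ this]
  have "((\<lambda>t. g t * (\<i> * of_real (- real m) * cis (- real m * t)) + g' t * cis (- real m * t)) has_integral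
      g (2 * pi) * cis (- real m * (2 * pi)) - g 0 * cis (- real m * 0)) {0..2 * pi}"
    by simp
  moreover have "cis (- real m * (2 * pi)) = 1"
    using cis_multiple_2pi[of "- real m"] by (simp add: mult_ac)
  ultimately have 1: "((\<lambda>t. g t * (\<i> * of_real (- real m) * cis (- real m * t)) + g' t * cis (- real m * t)) has_integral 0) {0..2 * pi}"
    using per by simp
  have "((\<lambda>t. - (\<i> * of_real (real m)) * (g t * cis (- (real m * t))) + g' t * cis (- (real m * t))) has_integral
      (- (\<i> * of_real (real m)) * fourier_coeff g m + fourier_coeff g' m)) {0..2 * pi}"
    by (intro has_integral_add has_integral_mult_right fourier_coeff_has_integral cg cg')
  then have "((\<lambda>t. g t * (\<i> * of_real (- real m) * cis (- real m * t)) + g' t * cis (- real m * t)) has_integral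
      (- (\<i> * of_real (real m)) * fourier_coeff g m + fourier_coeff g' m)) {0..2 * pi}"
    by (simp add: mult_ac)
  from has_integral_unique[OF 1 this] show ?thesis by (simp add: eq_neg_iff_add_eq_0)
qed

lemma periodic_Ck_fourier_decay:
  "periodic_Ck k g \<Longrightarrow> \<exists>B. \<forall>N. (\<Sum>m<N. (real m ^ k * norm (fourier_coeff g m))\<^sup>2) \<le> B"
proof (induction k arbitrary: g)
  case 0
  then show ?case using bessel_inequality[OF periodic_Ck_continuous[OF 0]] by simp
next
  case (Suc k)
  then obtain g' where g': "\<And>t. (g has_vector_derivative g' t) (at t)" "periodic_Ck k g'" by auto
  have "real m ^ Suc k * norm (fourier_coeff g m) = real m ^ k * norm (fourier_coeff g' m)" for m
    using fourier_coeff_derivative[OF g'(1) periodic_Ck_continuous[OF g'(2)] periodic_Ck_periodic[OF Suc.prems], of m]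
    by (simp add: norm_mult)
  then show ?case using Suc.IH[OF g'(2)] by (simp only:)
qed

section \<open>From derivatives on the interval to smooth periodic functions\<close>

text \<open>A single interval is already a division.\<close>

lemma absolutely_continuous_imp_continuous:
  assumes "absolutely_continuous_fun_on {a..b} f"
  shows "continuous_on {a..b::real} f"
  unfolding continuous_on_iff
proof (intro ballI allI impI)
  fix x e :: real assume x: "x \<in> {a..b}" and e: "e > 0"
  obtain d where d: "d > 0" and D: "\<And>D T. D division_of T \<Longrightarrow> T \<subseteq> {a..b} \<Longrightarrow> (\<Sum>K\<in>D. Sup K - Inf K) < d
      \<Longrightarrow> (\<Sum>K\<in>D. norm (f (Sup K) - f (Inf K))) < e"
    using assms e unfolding absolutely_continuous_fun_on_def by meson
  have *: "norm (f v - f u) < e" if "u \<in> {a..b}" "v \<in> {a..b}" "u \<le> v" "v - u < d" for u v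
  proof -
    have "{cbox u v} division_of cbox u v" using that by (intro division_of_self) auto
    then have "{{u..v}} division_of {u..v}" by simp
    from D[OF this] that show ?thesis by auto
  qed
  show "\<exists>d>0. \<forall>x'\<in>{a..b}. dist x' x < d \<longrightarrow> dist (f x') (f x) < e"
  proof (intro exI[of _ d] conjI d ballI impI)
    fix x' assume x': "x' \<in> {a..b}" "dist x' x < d"
    show "dist (f x') (f x) < e"
    proof (cases "x \<le> x'")
      case True
      then show ?thesis using *[OF x x'(1)] x'(2) by (simp add: dist_norm)
    next
      case False
      then show ?thesis using *[OF x'(1) x] x'(2) by (simp add: dist_norm norm_minus_commute)
    qed
  qed
qed

lemma cos_image_interval:
  assumes "a > (0::real)"
  shows "a / 2 * (1 - cos t) \<in> {0..a}"
proof -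
  have "a / 2 * (1 - cos t) \<le> a / 2 * 2"
    using assms cos_ge_minus_one[of t] by (intro mult_left_mono) linarith+
  moreover have "0 \<le> a / 2 * (1 - cos t)" using assms by simp
  ultimately show ?thesis unfolding atLeastAtMost_iff by linarith
qed

text \<open>The derivatives of f are one-sided at 0 and a, but x = a/2 (1 - cos t) never leaves
  [0,a], so the composition is differentiable on the whole line. The chain rule yields sin t times
  the next derivative at the same point, which is why i varies in the induction. For i = 0 the
  highest order reached is k - 1.\<close>

lemma ac_derivatives_periodic_Ck:
  assumes a: "a > 0" and F: "ac_derivatives a k f F"
  shows "i + j < k \<Longrightarrow> periodic_Ck j (\<lambda>t. F i (a / 2 * (1 - cos t)))"
proof (induction j arbitrary: i)
  case 0
  have "continuous_on {0..a} (F i)"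
    using F 0 unfolding ac_derivatives_def by (intro absolutely_continuous_imp_continuous) auto
  then have "continuous_on UNIV (\<lambda>t. F i (a / 2 * (1 - cos t)))"
  proof (rule continuous_on_compose2)
    show "continuous_on UNIV (\<lambda>t. a / 2 * (1 - cos t))" by (intro continuous_intros)
    show "range (\<lambda>t. a / 2 * (1 - cos t)) \<subseteq> {0..a}"
      using cos_image_interval[OF a] by blast
  qed
  then show ?case by simp
next
  case (Suc j)
  let ?x = "\<lambda>t. a / 2 * (1 - cos t)"
  have x: "?x t \<in> {0..a}" for t by (rule cos_image_interval[OF a])
  have d: "((\<lambda>t. F i (?x t)) has_vector_derivative of_real (a / 2 * sin t) * F (Suc i) (?x t)) (at t)" for t
  proof -
    have "(F i has_vector_derivative F (Suc i) (?x t)) (at (?x t) within {0..a})"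
      using F Suc.prems x[of t] unfolding ac_derivatives_def by auto
    then have 1: "(F i has_vector_derivative F (Suc i) (?x t)) (at (?x t) within range ?x)"
      by (rule has_vector_derivative_within_subset) (use x in blast)
    have 2: "(?x has_vector_derivative (a / 2 * sin t)) (at t within UNIV)"
      unfolding has_real_derivative_iff_has_vector_derivative[symmetric]
      by (auto intro!: derivative_eq_intros)
    from vector_diff_chain_within[OF 2 1] show ?thesis
      by (simp add: o_def scaleR_conv_of_real)
  qed
  moreover have "periodic_Ck j (\<lambda>t. of_real (a / 2 * sin t) * F (Suc i) (?x t))"
    by (intro periodic_Ck_mult periodic_Ck_sin_cos[THEN conjunct1] Suc.IH) (use Suc.prems in simp)
  ultimately show ?case
    unfolding periodic_Ck.simps(2)
    by (intro conjI exI[of _ "\<lambda>t. of_real (a / 2 * sin t) * F (Suc i) (?x t)"] allI) simp_all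
qed

section \<open>Chebyshev expansions\<close>

text \<open>By Weierstrass there is a polynomial p within e of u. Vanishing moments annihilate the
  integral of u p, so the integral K of u^2 is that of (u - p) u, at most e times the integral of
  |u|. Hence K = 0, and u vanishes by continuity.\<close>

lemma cos_moments_zero:
  fixes u :: "real \<Rightarrow> real"
  assumes u: "continuous_on {-1..1} u"
    and mom: "\<And>j. integral {0..2 * pi} (\<lambda>t. u (cos t) * cos t ^ j) = 0"
    and y: "y \<in> {-1..1}"
  shows "u y = 0"
proof -
  have cu: "continuous_on {0..2 * pi} (\<lambda>t. u (cos t))"
    by (rule continuous_on_compose2[OF u]) (auto intro!: continuous_intros)
  define J where "J = integral {0..2 * pi} (\<lambda>t. \<bar>u (cos t)\<bar>)"
  define K where "K = integral {0..2 * pi} (\<lambda>t. (u (cos t))\<^sup>2)"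
  have J0: "J \<ge> 0" unfolding J_def by (rule integral_nonneg) (intro integrable_continuous_interval continuous_intros cu, auto)
  have K0: "K \<ge> 0" unfolding K_def by (rule integral_nonneg) (intro integrable_continuous_interval continuous_intros cu, auto)
  have KJ: "K \<le> e * J" if e: "e > 0" for e
  proof -
    obtain p where p: "real_polynomial_function p" "\<And>x. x \<in> {-1..1} \<Longrightarrow> \<bar>u x - p x\<bar> < e"
      using Stone_Weierstrass_real_polynomial_function[OF compact_Icc u e] by blast
    obtain c n where pc: "p = (\<lambda>x. \<Sum>i\<le>n. c i * x ^ i)"
      using p(1) real_polynomial_function_iff_sum by blast
    have cp: "continuous_on {0..2 * pi} (\<lambda>t. p (cos t))"
      unfolding pc by (intro continuous_intros)
    have "integral {0..2 * pi} (\<lambda>t. u (cos t) * p (cos t))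
        = integral {0..2 * pi} (\<lambda>t. \<Sum>i\<le>n. c i * (u (cos t) * cos t ^ i))"
      by (simp add: pc sum_distrib_left mult_ac)
    also have "\<dots> = (\<Sum>i\<le>n. integral {0..2 * pi} (\<lambda>t. c i * (u (cos t) * cos t ^ i)))"
      by (intro integral_sum integrable_continuous_interval continuous_intros cu) auto
    also have "\<dots> = 0" by (simp add: mom)
    finally have 0: "integral {0..2 * pi} (\<lambda>t. u (cos t) * p (cos t)) = 0" .
    have "K = K - integral {0..2 * pi} (\<lambda>t. u (cos t) * p (cos t))" by (simp add: 0)
    also have "\<dots> = integral {0..2 * pi} (\<lambda>t. (u (cos t))\<^sup>2 - u (cos t) * p (cos t))"
      unfolding K_def by (intro integral_diff[symmetric] integrable_continuous_interval continuous_intros cu cp)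
    also have "\<dots> \<le> integral {0..2 * pi} (\<lambda>t. e * \<bar>u (cos t)\<bar>)"
    proof (rule integral_le)
      fix t
      have "(u (cos t))\<^sup>2 - u (cos t) * p (cos t) = (u (cos t) - p (cos t)) * u (cos t)"
        by (simp add: power2_eq_square algebra_simps)
      also have "\<dots> \<le> \<bar>u (cos t) - p (cos t)\<bar> * \<bar>u (cos t)\<bar>"
        by (simp flip: abs_mult)
      also have "\<dots> \<le> e * \<bar>u (cos t)\<bar>"
        using p(2)[of "cos t"] by (intro mult_right_mono) auto
      finally show "(u (cos t))\<^sup>2 - u (cos t) * p (cos t) \<le> e * \<bar>u (cos t)\<bar>" .
    qed (intro integrable_continuous_interval continuous_intros cu cp)+
    also have "\<dots> = e * J" by (simp add: J_def)
    finally show ?thesis .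
  qed
  have "K \<le> 0"
  proof (rule field_le_epsilon)
    fix e :: real assume "e > 0"
    then have "K \<le> e / (J + 1) * J" using J0 by (intro KJ) auto
    also have "\<dots> \<le> 0 + e" using J0 \<open>e > 0\<close> by (simp add: field_simps)
    finally show "K \<le> 0 + e" .
  qed
  with K0 have "K = 0" by simp
  then have "\<forall>t\<in>{0..2 * pi}. (u (cos t))\<^sup>2 = 0"
    unfolding K_def by (subst integral_eq_0_iff[symmetric]) (auto intro!: continuous_intros cu)
  moreover have "arccos y \<in> {0..2 * pi}"
    using y arccos_lbound[of y] arccos_ubound[of y] pi_ge_zero by (auto intro: order_trans)
  ultimately have "(u (cos (arccos y)))\<^sup>2 = 0" by (rule bspec)
  then show ?thesis using y by (simp add: cos_arccos)
qed

definition cos_coeff :: "(real \<Rightarrow> complex) \<Rightarrow> nat \<Rightarrow> complex" where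
  "cos_coeff g m = integral {0..2 * pi} (\<lambda>t. g t * of_real (cos (real m * t)))"

text \<open>Reflection t -> 2\<pi> - t preserves g and conjugates the exponential; the mean of the
  two integrals is the cosine integral.\<close>

lemma cos_coeff_eq_fourier_coeff:
  assumes g: "continuous_on {0..2 * pi} g" and even: "\<And>t. g (2 * pi - t) = g t"
  shows "cos_coeff g m = fourier_coeff g m"
proof -
  let ?h = "\<lambda>t. g t * cis (- (real m * t))"
  have h: "(?h has_integral fourier_coeff g m) (cbox 0 (2 * pi))"
    using fourier_coeff_has_integral[OF g] by simp
  from has_integral_affinity[OF this, of "-1" "2 * pi"]
  have "((\<lambda>t. ?h (2 * pi - t)) has_integral fourier_coeff g m) ((\<lambda>t. 2 * pi - t) ` {0..2 * pi})"
    by simp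
  moreover have "(\<lambda>t. 2 * pi - t) ` {0..2 * pi} = {0..2 * pi}"
    by (auto simp: image_iff intro!: bexI[of _ "2 * pi - t" for t])
  moreover have "?h (2 * pi - t) = g t * cis (real m * t)" for t
  proof -
    have "cis (- (real m * (2 * pi - t))) = cis (real m * t) * cis (2 * pi * real_of_int (- int m))"
      unfolding cis_mult by (rule arg_cong[of _ _ cis]) (simp add: algebra_simps)
    also have "cis (2 * pi * real_of_int (- int m)) = 1" by (rule cis_multiple_2pi) simp
    finally show ?thesis by (simp add: even)
  qed
  ultimately have h': "((\<lambda>t. g t * cis (real m * t)) has_integral fourier_coeff g m) {0..2 * pi}"
    by simp
  have "((\<lambda>t. 1 / 2 * (?h t + g t * cis (real m * t))) has_integral 1 / 2 * (fourier_coeff g m + fourier_coeff g m)) {0..2 * pi}"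
    using h h' by (intro has_integral_mult_right has_integral_add) auto
  moreover have "1 / 2 * (?h t + g t * cis (real m * t)) = g t * of_real (cos (real m * t))" for t
  proof -
    have "cis (- (real m * t)) + cis (real m * t) = of_real (2 * cos (real m * t))"
      by (simp add: complex_eq_iff)
    then have "?h t + g t * cis (real m * t) = g t * of_real (2 * cos (real m * t))"
      by (simp only: distrib_left[symmetric])
    then show ?thesis by simp
  qed
  ultimately show ?thesis
    by (simp add: cos_coeff_def integral_unique)
qed

lemma integral_cos_cos:
  "integral {0..2 * pi} (\<lambda>t. complex_of_real (cos (real m * t)) * of_real (cos (real k * t)))
     = (if m = k then (if m = 0 then 2 * pi else pi) else 0)"
proof -
  have "((\<lambda>t. 1 / 4 * (cis (of_int (int m + int k) * t) + cis (of_int (- (int m + int k)) * t)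
        + cis (of_int (int m - int k) * t) + cis (of_int (int k - int m) * t))) has_integral
     1 / 4 * (complex_of_real (if int m + int k = 0 then 2 * pi else 0)
        + complex_of_real (if - (int m + int k) = 0 then 2 * pi else 0)
        + complex_of_real (if int m - int k = 0 then 2 * pi else 0)
        + complex_of_real (if int k - int m = 0 then 2 * pi else 0))) {0..2 * pi}"
    by (intro has_integral_mult_right has_integral_add has_integral_cis_period)
  moreover have "1 / 4 * (cis (of_int (int m + int k) * t) + cis (of_int (- (int m + int k)) * t)
        + cis (of_int (int m - int k) * t) + cis (of_int (int k - int m) * t))
      = complex_of_real (cos (real m * t)) * of_real (cos (real k * t))" for t
    by (simp add: complex_eq_iff cos_add cos_diff sin_add sin_diff ring_distribs)
       (simp add: add_divide_distrib diff_divide_distrib mult.commute)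
  ultimately show ?thesis by (auto simp: integral_unique)
qed

text \<open>Over a full period cos^2(m t) integrates to \<pi>, but to 2\<pi> for m = 0; hence the
  factor 1/2.\<close>

definition cheb_coeff :: "real \<Rightarrow> (real \<Rightarrow> complex) \<Rightarrow> nat \<Rightarrow> complex" where
  "cheb_coeff a f m = (if m = 0 then 1 / 2 else 1) * cos_coeff (\<lambda>t. f (a / 2 * (1 - cos t))) m / pi"

text \<open>Absolute summability makes the series converge uniformly, but to a limit S not yet known
  to be f. The difference D = f - S is continuous, all its cosine coefficients vanish, therefore so
  do its moments against powers of cos, and D = 0 follows from density of polynomials.\<close>

lemma cheb_series_sums:
  assumes a: "a > 0" and f: "continuous_on {0..a} f"
    and b: "summable (\<lambda>m. norm (cheb_coeff a f m))" and x: "x \<in> {0..a}"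
  shows "(\<lambda>m. cheb_coeff a f m * poly (cheb_on a m) (of_real x)) sums f x"
proof -
  define b where "b = cheb_coeff a f"
  define t where "t = (\<lambda>m x. poly (cheb_on a m) (complex_of_real x))"
  define X where "X = (\<lambda>\<theta>. a / 2 * (1 - cos \<theta>))"
  have X: "X \<theta> \<in> {0..a}" for \<theta> unfolding X_def by (rule cos_image_interval[OF a])
  have tX: "t m (X \<theta>) = of_real (cos (real m * \<theta>))" for m \<theta>
    unfolding t_def X_def by (rule poly_cheb_on_cos[OF a])
  have nb: "summable (\<lambda>m. norm (b m))" using b by (simp add: b_def)
  have le: "norm (b m * t m y) \<le> norm (b m)" if "y \<in> {0..a}" for m y
    using norm_cheb_on_le[OF a that, of m] by (simp add: norm_mult t_def mult_left_le)
  define s where "s = (\<lambda>N x. \<Sum>m<N. b m * t m x)"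
  define S where "S = (\<lambda>x. \<Sum>m. b m * t m x)"
  have unif: "uniform_limit {0..a} s S sequentially"
    unfolding s_def S_def by (rule Weierstrass_m_test[OF _ nb]) (use le in auto)
  have cs: "continuous_on T (s N)" for T N
    unfolding s_def t_def by (intro continuous_intros)
  have cS: "continuous_on {0..a} S"
    by (rule uniform_limit_theorem[OF always_eventually unif]) (simp_all add: cs)
  define D where "D = (\<lambda>x. f x - S x)"
  have cD: "continuous_on {0..a} D" unfolding D_def by (intro continuous_intros f cS)
  have cX: "continuous_on T X" for T unfolding X_def by (intro continuous_intros)
  have cDX: "continuous_on T (\<lambda>\<theta>. D (X \<theta>))" for T
    by (rule continuous_on_compose2[OF cD cX]) (use X in blast)
  have cfX: "continuous_on T (\<lambda>\<theta>. f (X \<theta>))" for T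
    by (rule continuous_on_compose2[OF f cX]) (use X in blast)
  have csX: "continuous_on T (\<lambda>\<theta>. s N (X \<theta>))" for T N
    by (rule continuous_on_compose2[OF cs[of UNIV] cX]) simp
  have co: "integral {0..2 * pi} (\<lambda>\<theta>. D (X \<theta>) * of_real (cos (real k * \<theta>))) = 0" for k
  proof -
    let ?c = "\<lambda>\<theta>. complex_of_real (cos (real k * \<theta>))"
    \<comment> \<open>Once N > k, orthogonality gives the N-th partial sum exactly the k-th
      coefficient of f, so that only the uniform distance between s N and S remains to be
      estimated.\<close>
    have z: "integral {0..2 * pi} (\<lambda>\<theta>. (f (X \<theta>) - s N (X \<theta>)) * ?c \<theta>) = 0" if N: "N > k" for N
    proof -
      have "integral {0..2 * pi} (\<lambda>\<theta>. s N (X \<theta>) * ?c \<theta>)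
          = integral {0..2 * pi} (\<lambda>\<theta>. \<Sum>m<N. b m * (of_real (cos (real m * \<theta>)) * ?c \<theta>))"
        by (simp add: s_def tX sum_distrib_right mult.assoc)
      also have "\<dots> = (\<Sum>m<N. b m * integral {0..2 * pi} (\<lambda>\<theta>. of_real (cos (real m * \<theta>)) * ?c \<theta>))"
        by (subst integral_sum) (auto intro!: integrable_continuous_interval continuous_intros)
      also have "\<dots> = (\<Sum>m<N. if m = k then b k * (if k = 0 then 2 * pi else pi) else 0)"
        unfolding integral_cos_cos by (intro sum.cong) auto
      also have "\<dots> = b k * (if k = 0 then 2 * pi else pi)" using N by simp
      also have "\<dots> = cos_coeff (\<lambda>\<theta>. f (X \<theta>)) k"
        by (simp add: b_def cheb_coeff_def X_def)
      finally have 1: "integral {0..2 * pi} (\<lambda>\<theta>. s N (X \<theta>) * ?c \<theta>) = cos_coeff (\<lambda>\<theta>. f (X \<theta>)) k" .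
      have "integral {0..2 * pi} (\<lambda>\<theta>. f (X \<theta>) * ?c \<theta> - s N (X \<theta>) * ?c \<theta>)
          = integral {0..2 * pi} (\<lambda>\<theta>. f (X \<theta>) * ?c \<theta>) - integral {0..2 * pi} (\<lambda>\<theta>. s N (X \<theta>) * ?c \<theta>)"
        by (intro integral_diff integrable_continuous_interval continuous_intros cfX csX)
      then show ?thesis unfolding 1 by (simp add: cos_coeff_def left_diff_distrib)
    qed
    have bound: "norm (integral {0..2 * pi} (\<lambda>\<theta>. D (X \<theta>) * ?c \<theta>)) \<le> e * (2 * pi)" if e: "e > 0" for e
    proof -
      from uniform_limitD[OF unif e] have "\<forall>\<^sub>F N in sequentially. \<forall>x\<in>{0..a}. dist (s N x) (S x) < e" .
      with eventually_gt_at_top[of k] have "\<forall>\<^sub>F N in sequentially. k < N \<and> (\<forall>x\<in>{0..a}. dist (s N x) (S x) < e)"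
        by (rule eventually_conj)
      then obtain N where N: "k < N" "\<And>x. x \<in> {0..a} \<Longrightarrow> dist (s N x) (S x) < e"
        by (auto simp: eventually_sequentially)
      have "integral {0..2 * pi} (\<lambda>\<theta>. D (X \<theta>) * ?c \<theta> - (f (X \<theta>) - s N (X \<theta>)) * ?c \<theta>)
          = integral {0..2 * pi} (\<lambda>\<theta>. D (X \<theta>) * ?c \<theta>) - integral {0..2 * pi} (\<lambda>\<theta>. (f (X \<theta>) - s N (X \<theta>)) * ?c \<theta>)"
        by (intro integral_diff integrable_continuous_interval continuous_intros cDX cfX csX)
      then have "integral {0..2 * pi} (\<lambda>\<theta>. D (X \<theta>) * ?c \<theta>)
          = integral {0..2 * pi} (\<lambda>\<theta>. (s N (X \<theta>) - S (X \<theta>)) * ?c \<theta>)"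
        unfolding z[OF N(1)] by (simp add: D_def algebra_simps)
      also have "norm \<dots> \<le> integral {0..2 * pi} (\<lambda>\<theta>. e)"
      proof (rule integral_norm_bound_integral)
        have "continuous_on {0..2 * pi} (\<lambda>\<theta>. S (X \<theta>))"
          by (rule continuous_on_compose2[OF cS cX]) (use X in blast)
        then show "(\<lambda>\<theta>. (s N (X \<theta>) - S (X \<theta>)) * ?c \<theta>) integrable_on {0..2 * pi}"
          by (intro integrable_continuous_interval continuous_intros csX)
        fix \<theta>
        have "norm (s N (X \<theta>) - S (X \<theta>)) * norm (?c \<theta>) \<le> e * 1"
          using N(2)[OF X[of \<theta>]] e by (intro mult_mono) (auto simp: dist_norm)
        then show "norm ((s N (X \<theta>) - S (X \<theta>)) * ?c \<theta>) \<le> e" by (simp add: norm_mult)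
      qed auto
      finally show ?thesis by (simp add: mult_ac)
    qed
    have "norm (integral {0..2 * pi} (\<lambda>\<theta>. D (X \<theta>) * ?c \<theta>)) \<le> 0"
    proof (rule field_le_epsilon)
      fix e :: real assume "e > 0"
      then show "norm (integral {0..2 * pi} (\<lambda>\<theta>. D (X \<theta>) * ?c \<theta>)) \<le> 0 + e"
        using bound[of "e / (2 * pi)"] by (simp add: mult.commute)
    qed
    then show ?thesis by simp
  qed
  \<comment> \<open>The product formula for cos \<theta> cos(k \<theta>) trades one power of cos for
    the frequencies k + 1 and k - 1, so k must vary in the induction.\<close>
  have pw: "integral {0..2 * pi} (\<lambda>\<theta>. D (X \<theta>) * of_real (cos \<theta> ^ j * cos (real k * \<theta>))) = 0" for j k
  proof (induction j arbitrary: k)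
    case 0
    then show ?case using co by simp
  next
    case (Suc j)
    show ?case
    proof (cases k)
      case 0
      then show ?thesis using Suc.IH[of 1] by (simp add: mult.commute)
    next
      case (Suc l)
      have "cos \<theta> * cos (real k * \<theta>) = 1 / 2 * cos (real (Suc k) * \<theta>) + 1 / 2 * cos (real l * \<theta>)" for \<theta>
      proof -
        have "real (Suc k) * \<theta> = real k * \<theta> + \<theta>" "real l * \<theta> = real k * \<theta> - \<theta>"
          using Suc by (simp_all add: algebra_simps)
        then show ?thesis by (simp only: cos_add cos_diff) (simp add: algebra_simps)
      qed
      then have "cos \<theta> ^ Suc j * cos (real k * \<theta>)
          = cos \<theta> ^ j * (1 / 2 * cos (real (Suc k) * \<theta>) + 1 / 2 * cos (real l * \<theta>))" for \<theta>
        by (simp only: power_Suc2 mult.assoc)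
      then have "D (X \<theta>) * of_real (cos \<theta> ^ Suc j * cos (real k * \<theta>))
          = 1 / 2 * (D (X \<theta>) * of_real (cos \<theta> ^ j * cos (real (Suc k) * \<theta>)))
          + 1 / 2 * (D (X \<theta>) * of_real (cos \<theta> ^ j * cos (real l * \<theta>)))" for \<theta>
        by (simp only:) (simp add: ring_distribs mult_ac)
      then have "integral {0..2 * pi} (\<lambda>\<theta>. D (X \<theta>) * of_real (cos \<theta> ^ Suc j * cos (real k * \<theta>)))
          = integral {0..2 * pi} (\<lambda>\<theta>. 1 / 2 * (D (X \<theta>) * of_real (cos \<theta> ^ j * cos (real (Suc k) * \<theta>)))
          + 1 / 2 * (D (X \<theta>) * of_real (cos \<theta> ^ j * cos (real l * \<theta>))))"
        by (simp only:)
      also have "\<dots> = integral {0..2 * pi} (\<lambda>\<theta>. 1 / 2 * (D (X \<theta>) * of_real (cos \<theta> ^ j * cos (real (Suc k) * \<theta>))))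
          + integral {0..2 * pi} (\<lambda>\<theta>. 1 / 2 * (D (X \<theta>) * of_real (cos \<theta> ^ j * cos (real l * \<theta>))))"
        by (intro integral_add integrable_continuous_interval continuous_intros cDX)
      also have "\<dots> = 0" unfolding integral_mult_right Suc.IH by simp
      finally show ?thesis .
    qed
  qed
  define Y where "Y = (\<lambda>y. a / 2 * (1 - y))"
  have Y: "Y y \<in> {0..a}" if "y \<in> {-1..1}" for y
  proof -
    have "Y y = X (arccos y)" using that by (simp add: Y_def X_def cos_arccos)
    then show ?thesis using X by simp
  qed
  have cDY: "continuous_on {-1..1} (\<lambda>y. D (Y y))"
    by (rule continuous_on_compose2[OF cD]) (use Y in \<open>auto simp: Y_def intro!: continuous_intros\<close>)
  have mom: "((\<lambda>\<theta>. D (Y (cos \<theta>)) * of_real (cos \<theta> ^ j)) has_integral 0) {0..2 * pi}" for j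
  proof -
    have "(\<lambda>\<theta>. D (X \<theta>) * of_real (cos \<theta> ^ j)) integrable_on {0..2 * pi}"
      by (intro integrable_continuous_interval continuous_intros cDX)
    then show ?thesis using pw[of j 0] by (simp add: has_integral_iff X_def Y_def)
  qed
  have D0: "D (Y y) = 0" if y: "y \<in> {-1..1}" for y
  proof -
    have "Re (D (Y y)) = 0"
    proof (rule cos_moments_zero[OF _ _ y])
      show "continuous_on {-1..1} (\<lambda>y. Re (D (Y y)))" by (intro continuous_intros cDY)
      fix j
      from has_integral_linear[OF mom[of j] bounded_linear_Re]
      show "integral {0..2 * pi} (\<lambda>t. Re (D (Y (cos t))) * cos t ^ j) = 0"
        by (simp add: o_def integral_unique flip: of_real_power)
    qed
    moreover have "Im (D (Y y)) = 0"
    proof (rule cos_moments_zero[OF _ _ y])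
      show "continuous_on {-1..1} (\<lambda>y. Im (D (Y y)))" by (intro continuous_intros cDY)
      fix j
      from has_integral_linear[OF mom[of j] bounded_linear_Im]
      show "integral {0..2 * pi} (\<lambda>t. Im (D (Y (cos t))) * cos t ^ j) = 0"
        by (simp add: o_def integral_unique flip: of_real_power)
    qed
    ultimately show ?thesis by (simp add: complex_eq_iff)
  qed
  have "1 - 2 * x / a \<in> {-1..1}"
    using affine_bound[OF a x] by (simp add: abs_le_iff)
  from D0[OF this] have "D x = 0" using a by (simp add: Y_def)
  then have "S x = f x" by (simp add: D_def)
  moreover have "summable (\<lambda>m. b m * t m x)"
    by (rule summable_comparison_test'[OF nb, of 0]) (use le[OF x] in auto)
  ultimately show ?thesis
    unfolding S_def b_def t_def by (simp add: sums_iff)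
qed

section \<open>Coefficients of analytic functions\<close>

text \<open>The linear homotopy stays in the annulus: corresponding points have the same angle, so
  the modulus along their segment is a convex combination of the radii.\<close>

lemma contour_integral_concentric_circles_eq:
  fixes f :: "complex \<Rightarrow> complex"
  assumes S: "open S" "f holomorphic_on S"
    and r: "0 < r" "0 < s" and sub: "\<And>z. min r s \<le> norm z \<Longrightarrow> norm z \<le> max r s \<Longrightarrow> z \<in> S"
  shows "contour_integral (circlepath 0 r) f = contour_integral (circlepath 0 s) f"
proof (rule Cauchy_theorem_homotopic_loops[OF homotopic_loops_linear S])
  fix t x :: real
  define u where "u = exp (2 * of_real pi * \<i> * of_real t)"
  have u: "norm u = 1" by (simp add: u_def norm_exp_eq_Re)
  show "closed_segment (circlepath 0 r t) (circlepath 0 s t) \<subseteq> S"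
  proof
    fix z assume "z \<in> closed_segment (circlepath 0 r t) (circlepath 0 s t)"
    then obtain v where v: "0 \<le> v" "v \<le> 1"
      and "z = (1 - v) *\<^sub>R circlepath 0 r t + v *\<^sub>R circlepath 0 s t"
      by (auto simp: closed_segment_def)
    then have "z = of_real ((1 - v) * r + v * s) * u"
      by (simp add: circlepath u_def scaleR_conv_of_real algebra_simps)
    then have nz: "norm z = \<bar>(1 - v) * r + v * s\<bar>" using u by (simp only: norm_mult norm_of_real) simp
    have "(1 - v) * min r s + v * min r s \<le> (1 - v) * r + v * s"
      using v by (intro add_mono mult_left_mono) auto
    then have 1: "min r s \<le> (1 - v) * r + v * s" by (simp add: algebra_simps)
    have "(1 - v) * r + v * s \<le> (1 - v) * max r s + v * max r s"
      using v by (intro add_mono mult_left_mono) auto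
    then have 2: "(1 - v) * r + v * s \<le> max r s" by (simp add: algebra_simps)
    have "min r s > 0" using r by simp
    with 1 have "norm z = (1 - v) * r + v * s" unfolding nz by linarith
    with 1 2 show "z \<in> S" by (intro sub) simp_all
  qed
qed auto

text \<open>The circle of radius r goes to the ellipse with semiaxes (r + 1/r)/2 and |r - 1/r|/2,
  both smaller than those for \<rho> when 1/\<rho> < r < \<rho>. The minus sign matches the
  orientation x = a/2 (1 - cos t).\<close>

lemma bernstein_ellipse_joukowski:
  assumes "\<rho> > 1" "1 / \<rho> < norm u" "norm u < \<rho>"
  shows "- (u + 1 / u) / 2 \<in> bernstein_ellipse \<rho>"
proof -
  define r where "r = norm u"
  define \<theta> where "\<theta> = Arg u"
  have r: "1 / \<rho> < r" "r < \<rho>" using assms by (auto simp: r_def)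
  have r0: "r > 0" using r(1) assms(1) by (auto intro: less_trans[of 0 "1 / \<rho>"])
  have rr: "1 / r < \<rho>" using r(1) r0 assms(1) by (simp add: field_simps)
  have u: "u = rcis r \<theta>" by (simp add: r_def \<theta>_def rcis_cmod_Arg)
  have iu: "1 / u = rcis (1 / r) (- \<theta>)" unfolding u by (simp add: rcis_inverse inverse_eq_divide[symmetric])
  have comp: "Re u = r * cos \<theta>" "Im u = r * sin \<theta>" "Re (1 / u) = 1 / r * cos \<theta>" "Im (1 / u) = - (1 / r * sin \<theta>)"
    unfolding iu by (subst u, simp)+ simp_all
  have "Re (- (p + q) / 2) = - ((Re p + Re q) / 2)" "Im (- (p + q) / 2) = - ((Im p + Im q) / 2)" for p q :: complex
    by (simp_all add: add_divide_distrib)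
  note half = this[of u "1 / u"]
  have Re: "Re (- (u + 1 / u) / 2) = - ((r + 1 / r) / 2 * cos \<theta>)"
    unfolding half comp by (simp add: ring_distribs add_divide_distrib)
  have Im: "Im (- (u + 1 / u) / 2) = - ((r - 1 / r) / 2 * sin \<theta>)"
    unfolding half comp by (simp add: ring_distribs diff_divide_distrib)
  define A where "A = (r + 1 / r) / (\<rho> + 1 / \<rho>)"
  define B where "B = (r - 1 / r) / (\<rho> - 1 / \<rho>)"
  have "1 / \<rho> < 1" using assms(1) by simp
  moreover have "1 / \<rho> > 0" using assms(1) by simp
  ultimately have d: "\<rho> - 1 / \<rho> > 0" "\<rho> + 1 / \<rho> > 0" using assms(1) by linarith+
  \<comment> \<open>Dividing this product by \<rho> gives \<rho> + 1/\<rho> - (r + 1/r), so its sign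
    compares the major semiaxes.\<close>
  have "0 < (\<rho> - r) * (\<rho> - 1 / r)" using r rr by simp
  then have "r + 1 / r < \<rho> + 1 / \<rho>"
  proof -
    have "(\<rho> - r) * (\<rho> - 1 / r) = \<rho> * (\<rho> + 1 / \<rho> - (r + 1 / r))"
      using assms(1) r0 by (simp add: field_simps)
    with \<open>0 < (\<rho> - r) * (\<rho> - 1 / r)\<close> show ?thesis
      using assms(1) by (simp add: zero_less_mult_iff)
  qed
  then have A: "\<bar>A\<bar> < 1" using r0 d by (simp add: A_def abs_less_iff add_pos_pos)
  have "r - 1 / r < \<rho> - 1 / \<rho>" 
    using r r0 assms(1) frac_less2[of 1 1 r \<rho>] by simp
  moreover have "1 / r - r < \<rho> - 1 / \<rho>" using rr r by simp
  ultimately have B: "\<bar>B\<bar> < 1" using d by (simp add: B_def abs_less_iff minus_divide_left)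
  have "A\<^sup>2 < 1" "B\<^sup>2 < 1" using A B by (simp_all add: abs_square_less_1)
  then have AB: "A\<^sup>2 * (cos \<theta>)\<^sup>2 + B\<^sup>2 * (sin \<theta>)\<^sup>2 < 1"
  proof (cases "cos \<theta> = 0")
    case True
    then have "(sin \<theta>)\<^sup>2 = 1" using sin_cos_squared_add[of \<theta>] by simp
    then show ?thesis using True \<open>B\<^sup>2 < 1\<close> by simp
  next
    case False
    then have "A\<^sup>2 * (cos \<theta>)\<^sup>2 < 1 * (cos \<theta>)\<^sup>2" using \<open>A\<^sup>2 < 1\<close> by (intro mult_strict_right_mono) auto
    moreover have "B\<^sup>2 * (sin \<theta>)\<^sup>2 \<le> 1 * (sin \<theta>)\<^sup>2" using \<open>B\<^sup>2 < 1\<close> by (intro mult_right_mono) auto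
    ultimately show ?thesis using sin_cos_squared_add[of \<theta>] by linarith
  qed
  have "(Re (- (u + 1 / u) / 2) / ((\<rho> + 1 / \<rho>) / 2))\<^sup>2 = A\<^sup>2 * (cos \<theta>)\<^sup>2"
    unfolding Re A_def by (simp add: power_divide power_mult_distrib)
  moreover have "(Im (- (u + 1 / u) / 2) / ((\<rho> - 1 / \<rho>) / 2))\<^sup>2 = B\<^sup>2 * (sin \<theta>)\<^sup>2"
    unfolding Im B_def by (simp add: power_divide power_mult_distrib)
  ultimately show ?thesis using AB unfolding bernstein_ellipse_def by simp
qed

text \<open>By evenness the cosine coefficient is a Fourier coefficient, hence a contour integral
  over the unit circle; the integrand is holomorphic in the annulus 1/\<rho> < |u| < \<rho>. The
  bound 2 \<pi> M for the integral over \<pi> is the origin of 2 M.\<close>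

lemma cheb_coeff_analytic_bound:
  fixes f :: "complex \<Rightarrow> complex"
  assumes a: "a > 0" and \<rho>: "\<rho> > 1"
    and an: "(\<lambda>z. f ((z + 1) * of_real a / 2)) analytic_on bernstein_ellipse \<rho>"
    and M: "\<And>z. z \<in> bernstein_ellipse \<rho> \<Longrightarrow> norm (f ((z + 1) * of_real a / 2)) \<le> M"
  shows "continuous_on {0..a} (\<lambda>x. f (of_real x))"
    and "norm (cheb_coeff a (\<lambda>x. f (of_real x)) m) \<le> 2 * M / \<rho> ^ m"
proof -
  define h where "h = (\<lambda>z. f ((z + 1) * of_real a / 2))"
  have hol: "h holomorphic_on bernstein_ellipse \<rho>"
    unfolding h_def by (rule analytic_imp_holomorphic[OF an])
  have J1: "- (cis t + 1 / cis t) / 2 = - of_real (cos t)" for t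
    unfolding divide_inverse[of 1 "cis t"] cis_inverse by (simp add: complex_eq_iff)
  have real_in: "of_real y \<in> bernstein_ellipse \<rho>" if "y \<in> {-1..1}" for y
  proof -
    have "- (cis (arccos (- y)) + 1 / cis (arccos (- y))) / 2 \<in> bernstein_ellipse \<rho>"
      using \<rho> by (intro bernstein_ellipse_joukowski) auto
    then show ?thesis unfolding J1 using that by (simp add: cos_arccos)
  qed
  have fh: "f (of_real x) = h (of_real (2 * x / a - 1))" for x
    using a by (simp add: h_def)
  have "continuous_on {0..a} (\<lambda>x. h (of_real (2 * x / a - 1)))"
  proof (rule continuous_on_compose2[OF holomorphic_on_imp_continuous_on[OF hol]])
    show "continuous_on {0..a} (\<lambda>x. complex_of_real (2 * x / a - 1))"
      using a by (intro continuous_intros) auto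
    show "(\<lambda>x. complex_of_real (2 * x / a - 1)) ` {0..a} \<subseteq> bernstein_ellipse \<rho>"
    proof (rule image_subsetI)
      fix x assume "x \<in> {0..a}"
      from affine_bound[OF a this] show "complex_of_real (2 * x / a - 1) \<in> bernstein_ellipse \<rho>"
        by (intro real_in) (simp only: abs_le_iff atLeastAtMost_iff, linarith)
    qed
  qed
  then show cont: "continuous_on {0..a} (\<lambda>x. f (of_real x))" by (simp add: fh)
  define S where "S = {u::complex. 1 / \<rho> < norm u \<and> norm u < \<rho>}"
  have "S = {u. 1 / \<rho> < norm u} \<inter> {u. norm u < \<rho>}" by (auto simp: S_def)
  moreover have "open {u::complex. 1 / \<rho> < norm u}" by (intro open_Collect_less continuous_intros)
  moreover have "open {u::complex. norm u < \<rho>}" by (intro open_Collect_less continuous_intros)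
  ultimately have openS: "open S" by auto
  have S0: "u \<noteq> 0" if "u \<in> S" for u using that \<rho> by (auto simp: S_def)
  have JS: "- (u + 1 / u) / 2 \<in> bernstein_ellipse \<rho>" if "u \<in> S" for u
    using that \<rho> by (intro bernstein_ellipse_joukowski) (auto simp: S_def)
  define G where "G = (\<lambda>u. h (- (u + 1 / u) / 2) / u ^ Suc m)"
  have "(\<lambda>u. h (- (u + 1 / u) / 2)) holomorphic_on S"
    by (rule holomorphic_on_compose_gen[OF _ hol, unfolded o_def])
       (use JS S0 in \<open>auto intro!: holomorphic_intros\<close>)
  then have G: "G holomorphic_on S"
    unfolding G_def using S0 by (intro holomorphic_intros) auto
  define g where "g = (\<lambda>t. f (of_real (a / 2 * (1 - cos t))))"
  have cg: "continuous_on T g" for T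
    unfolding g_def
    by (rule continuous_on_compose2[OF cont]) (use cos_image_interval[OF a] in \<open>auto intro!: continuous_intros\<close>)
  have gh: "g t = h (- of_real (cos t))" for t
    unfolding g_def fh using a by (simp add: field_simps)
  have "contour_integral (circlepath 0 1) G = integral {0..2 * pi} (\<lambda>t. G (0 + of_real 1 * cis t) * of_real 1 * \<i> * cis t)"
    unfolding circlepath_def by (subst contour_integral_part_circlepath_eq) simp_all
  also have "(\<lambda>t. G (0 + of_real 1 * cis t) * of_real 1 * \<i> * cis t) = (\<lambda>t. \<i> * (g t * cis (- (real m * t))))"
  proof
    fix t
    have "cis t ^ Suc m = cis t * cis (real m * t)" by (simp only: power_Suc Complex.DeMoivre)
    then have G: "G (cis t) = h (- (cis t + 1 / cis t) / 2) / (cis t * cis (real m * t))"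
      by (simp only: G_def)
    have iv: "cis (- (real m * t)) = inverse (cis (real m * t))" by (rule cis_inverse[symmetric])
    have "H / (c * d) * \<i> * c = \<i> * (H * inverse d)" if "c \<noteq> 0" for H c d :: complex
      using that by (simp add: divide_inverse)
    from this[OF cis_neq_zero] have "G (cis t) * \<i> * cis t = \<i> * (h (- (cis t + 1 / cis t) / 2) * cis (- (real m * t)))"
      unfolding G iv .
    then show "G (0 + of_real 1 * cis t) * of_real 1 * \<i> * cis t = \<i> * (g t * cis (- (real m * t)))"
      unfolding gh J1 by simp
  qed
  also have "integral {0..2 * pi} \<dots> = \<i> * cos_coeff g m"
    using cos_coeff_eq_fourier_coeff[OF cg, of m] by (simp add: fourier_coeff_def g_def)
  finally have circ: "contour_integral (circlepath 0 1) G = \<i> * cos_coeff g m" .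
  have M0: "M \<ge> 0" using order_trans[OF norm_ge_zero M[OF real_in[of 0]]] by simp
  have bound: "norm (cos_coeff g m) * r ^ m \<le> 2 * pi * M" if r: "1 < r" "r < \<rho>" for r
  proof -
    have "1 / \<rho> < 1" using \<rho> by simp
    then have rS: "u \<in> S" if "norm u = r" for u
      using that r less_trans[OF \<open>1 / \<rho> < 1\<close> r(1)] unfolding S_def by simp
    have "contour_integral (circlepath 0 1) G = contour_integral (circlepath 0 r) G"
      using r by (intro contour_integral_concentric_circles_eq[OF openS G])
        (auto simp: S_def intro: less_le_trans[OF \<open>1 / \<rho> < 1\<close>])
    moreover have "(G has_contour_integral contour_integral (circlepath 0 r) G) (circlepath 0 r)"
    proof (intro has_contour_integral_integral contour_integrable_continuous_circlepath)
      show "continuous_on (path_image (circlepath 0 r)) G"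
        using r rS by (intro continuous_on_subset[OF holomorphic_on_imp_continuous_on[OF G]]) auto
    qed
    moreover have "norm (G u) \<le> M / r ^ Suc m" if "norm (u - 0) = r" for u
    proof -
      have "norm (h (- (u + 1 / u) / 2)) \<le> M"
        unfolding h_def using that by (intro M JS rS) simp
      then show ?thesis using that r by (simp add: G_def norm_divide norm_power divide_right_mono norm_mult)
    qed
    ultimately have "norm (\<i> * cos_coeff g m) \<le> M / r ^ Suc m * (2 * pi * r)"
      unfolding circ using M0 r by (intro has_contour_integral_bound_circlepath) auto
    also have "M / r ^ Suc m * (2 * pi * r) = 2 * pi * M / r ^ m" using r by simp
    finally show ?thesis using r by (simp add: norm_mult pos_le_divide_eq)
  qed
  \<comment> \<open>The circle of radius \<rho> is not inside the region of analyticity, so the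
    estimate is taken for radii 1 < r < \<rho> and passed to the limit.\<close>
  have lim: "norm (cos_coeff g m) * \<rho> ^ m \<le> 2 * pi * M"
  proof (rule LIMSEQ_le_const2)
    have "(\<lambda>n. \<rho> - (\<rho> - 1) / (real n + 2)) \<longlonglongrightarrow> \<rho>" by real_asymp
    then show "(\<lambda>n. norm (cos_coeff g m) * (\<rho> - (\<rho> - 1) / (real n + 2)) ^ m) \<longlonglongrightarrow> norm (cos_coeff g m) * \<rho> ^ m"
      by (intro tendsto_intros)
    show "\<exists>N. \<forall>n\<ge>N. norm (cos_coeff g m) * (\<rho> - (\<rho> - 1) / (real n + 2)) ^ m \<le> 2 * pi * M"
    proof (intro exI[of _ 0] allI impI bound)
      fix n :: nat
      define X where "X = (\<rho> - 1) / (real n + 2)"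
      have "0 < X" using \<rho> by (simp add: X_def)
      moreover have "X < (\<rho> - 1) / 1" unfolding X_def using \<rho> by (intro divide_strict_left_mono) auto
      ultimately have "1 < \<rho> - X \<and> \<rho> - X < \<rho>" by simp
      then show "1 < \<rho> - (\<rho> - 1) / (real n + 2)" "\<rho> - (\<rho> - 1) / (real n + 2) < \<rho>"
        unfolding X_def by simp_all
    qed
  qed
  have "norm (cheb_coeff a (\<lambda>x. f (of_real x)) m) \<le> norm (cos_coeff g m) / pi"
    unfolding cheb_coeff_def g_def[symmetric]
    by (auto simp: norm_mult norm_divide divide_right_mono)
  also have "norm (cos_coeff g m) \<le> pi * (2 * M / \<rho> ^ m)"
    using lim \<rho> by (simp add: pos_le_divide_eq mult_ac)
  then have "norm (cos_coeff g m) / pi \<le> 2 * M / \<rho> ^ m"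
    by (simp add: pos_divide_le_eq mult.commute)
  finally show "norm (cheb_coeff a (\<lambda>x. f (of_real x)) m) \<le> 2 * M / \<rho> ^ m" .
qed

section \<open>Convergence rates\<close>

text \<open>For x >= 1 the term 1/x^2 is at most 2/(x(x+1)) = 2/x - 2/(x+1), which
  telescopes.\<close>

lemma sum_inverse_squares_le:
  assumes "n \<ge> (1::nat)"
  shows "(\<Sum>m=n..<N. 1 / real m ^ 2) \<le> 2 / real n"
proof -
  have "(\<Sum>m=n..<n + d. 1 / real m ^ 2) \<le> 2 / real n - 2 / real (n + d)" for d
  proof (induction d)
    case (Suc d)
    define x where "x = real (n + d)"
    have x: "x \<ge> 1" using assms by (simp add: x_def)
    have sq: "1 / x ^ 2 \<le> 2 / x - 2 / (x + 1)"
    proof -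
      have "2 / x - 2 / (x + 1) = 2 / (x * (x + 1))" using x by (simp add: field_simps)
      moreover have "1 / x ^ 2 \<le> 2 / (x * (x + 1))"
        using x by (simp add: frac_le_eq power2_eq_square divide_le_0_iff mult_nonneg_nonneg)
      ultimately show ?thesis by simp
    qed
    have e1: "real (n + Suc d) = x + 1" by (simp add: x_def)
    have e2: "(\<Sum>m=n..<n + Suc d. 1 / real m ^ 2) = (\<Sum>m=n..<n + d. 1 / real m ^ 2) + 1 / x ^ 2"
      by (simp add: x_def)
    show ?case unfolding e1 e2 using sq Suc.IH[folded x_def] by linarith
  qed simp
  from this[of "N - n"] have "(\<Sum>m=n..<N. 1 / real m ^ 2) \<le> 2 / real n - 2 / real (n + (N - n))"
    by (cases "n \<le> N") simp_all
  also have "\<dots> \<le> 2 / real n" by simp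
  finally show ?thesis .
qed

text \<open>Square summability of \<open>m\<^sup>k\<^sup>-\<^sup>1 \<beta>\<^sub>m\<close> already gives the rate \<open>n\<^sup>4\<^sup>-\<^sup>k\<close>, here with \<open>k = p + 5\<close>:
  apply the inequality \<open>2 x y \<le> x\<^sup>2 / c + c y\<^sup>2\<close> with \<open>c = n\<^sup>p\<^sup>+\<^sup>1\<close>.\<close>

lemma weighted_tail_bound:
  fixes \<beta> :: "nat \<Rightarrow> real"
  assumes \<beta>: "\<And>m. \<beta> m \<ge> 0" and B: "\<And>N. (\<Sum>m<N. (real m ^ (p + 4) * \<beta> m)\<^sup>2) \<le> B" and n: "n \<ge> (1::nat)"
  shows "(\<Sum>m=n..<N. \<beta> m * (real m ^ 2 * sqrt (real m))) \<le> (B + 2) / 2 / real n ^ (p + 1)"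
proof -
  define c where "c = real n ^ (p + 1)"
  have c: "c > 0" using n by (simp add: c_def)
  have termwise: "\<beta> m * (real m ^ 2 * sqrt (real m)) \<le> 1 / (2 * c) * ((real m ^ (p + 4) * \<beta> m)\<^sup>2 + real n * (1 / real m ^ 2))"
    if m: "m \<ge> n" for m
  proof -
    have m0: "real m > 0" using m n by simp
    define x where "x = real m ^ (p + 4) * \<beta> m"
    define y where "y = real m ^ 2 * sqrt (real m) / real m ^ (p + 4)"
    have "\<beta> m * (real m ^ 2 * sqrt (real m)) = x * y" using m0 by (simp add: x_def y_def)
    also have "x * y \<le> 1 / (2 * c) * (x\<^sup>2 + (c * y)\<^sup>2)"
    proof -
      have "0 \<le> (x - c * y)\<^sup>2" by simp
      then have "2 * c * (x * y) \<le> x\<^sup>2 + (c * y)\<^sup>2" by (simp add: power2_eq_square algebra_simps)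
      then show ?thesis using c by (simp add: pos_le_divide_eq mult_ac)
    qed
    \<comment> \<open>Here y^2 = m^(-2p-1) m^(-2), and m >= n with c^2 = n^(2p+2) leaves one factor
      n. It cancels against the 2/n of the sum of inverse squares and produces the 2 in B +
      2.\<close>
    also have "(c * y)\<^sup>2 \<le> real n * (1 / real m ^ 2)"
    proof -
      have "(real m ^ 2 * sqrt (real m))\<^sup>2 = real m ^ 5"
        by (simp add: power_mult_distrib eval_nat_numeral)
      moreover have "(real m ^ (p + 4))\<^sup>2 = real m ^ (2 * p + 8)"
        by (simp add: algebra_simps flip: power_mult)
      ultimately have "y\<^sup>2 = real m ^ 5 / real m ^ (2 * p + 8)"
        by (simp only: y_def power_divide)
      also have "2 * p + 8 = 5 + ((2 * p + 1) + 2)" by simp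
      also have "real m ^ 5 / real m ^ (5 + ((2 * p + 1) + 2)) = 1 / real m ^ (2 * p + 1) * (1 / real m ^ 2)"
        unfolding power_add using m0 by simp
      finally have y2: "y\<^sup>2 = 1 / real m ^ (2 * p + 1) * (1 / real m ^ 2)" .
      have "c\<^sup>2 * (1 / real m ^ (2 * p + 1)) \<le> c\<^sup>2 * (1 / real n ^ (2 * p + 1))"
        using m n m0 by (intro mult_left_mono divide_left_mono power_mono mult_pos_pos zero_less_power) auto
      also have "\<dots> = real n"
      proof -
        have "c\<^sup>2 = real n ^ (2 * p + 1) * real n"
          by (simp add: c_def power_add power_mult_distrib power2_eq_square mult_2)
        then show ?thesis using n by simp
      qed
      finally have "c\<^sup>2 * (1 / real m ^ (2 * p + 1)) * (1 / real m ^ 2) \<le> real n * (1 / real m ^ 2)"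
        by (rule mult_right_mono) simp
      then show ?thesis by (simp only: power_mult_distrib y2 mult.assoc)
    qed
    finally show ?thesis using c unfolding x_def by (simp add: divide_right_mono)
  qed
  have "(\<Sum>m=n..<N. \<beta> m * (real m ^ 2 * sqrt (real m)))
      \<le> (\<Sum>m=n..<N. 1 / (2 * c) * ((real m ^ (p + 4) * \<beta> m)\<^sup>2 + real n * (1 / real m ^ 2)))"
    by (intro sum_mono termwise) simp
  also have "\<dots> = 1 / (2 * c) * ((\<Sum>m=n..<N. (real m ^ (p + 4) * \<beta> m)\<^sup>2) + real n * (\<Sum>m=n..<N. 1 / real m ^ 2))"
    by (simp only: sum_distrib_left sum.distrib distrib_left)
  also have "\<dots> \<le> 1 / (2 * c) * (B + real n * (2 / real n))"
  proof (intro mult_left_mono add_mono sum_inverse_squares_le n)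
    have "(\<Sum>m=n..<N. (real m ^ (p + 4) * \<beta> m)\<^sup>2) \<le> (\<Sum>m<N. (real m ^ (p + 4) * \<beta> m)\<^sup>2)"
      by (intro sum_mono2) auto
    with B[of N] show "(\<Sum>m=n..<N. (real m ^ (p + 4) * \<beta> m)\<^sup>2) \<le> B" by linarith
  qed (use c in auto)
  also have "\<dots> = (B + 2) / 2 / c" using n by (simp add: field_simps)
  finally show ?thesis by (simp add: c_def)
qed

lemma sq_sqrt_le_power4: "real m ^ 2 * sqrt (real m) \<le> real m ^ 4"
proof (cases "m = 0")
  case False
  then have "real m \<le> real m ^ 4" by (intro self_le_power) auto
  then have "sqrt (real m) \<le> real m ^ 2"
    by (intro real_le_lsqrt) (simp_all flip: power_mult)
  then have "real m ^ 2 * sqrt (real m) \<le> real m ^ 2 * real m ^ 2" by (intro mult_left_mono) auto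
  then show ?thesis by (simp flip: power_add)
qed simp

text \<open>With m = n + j one has n + j <= (1 + j) n, so each term is at most (1 + j)^4 / \<rho>1^j
  times n^4 / \<sigma>^n. The constant is the sum of this series and depends on \<rho>1
  only.\<close>

lemma geometric_tail_bound:
  fixes \<rho>1 :: real
  assumes "\<rho>1 > 1"
  shows "\<exists>K\<ge>0. \<forall>\<sigma>\<ge>\<rho>1. \<forall>n\<ge>1. \<forall>N. (\<Sum>m=n..<N. real m ^ 4 / \<sigma> ^ m) \<le> K * real n ^ 4 / \<sigma> ^ n"
proof -
  define q where "q = (\<lambda>j::nat. (1 + real j) ^ 4 / \<rho>1 ^ j)"
  have "q \<in> O(\<lambda>j. 1 / real j ^ 2)" unfolding q_def using assms by real_asymp
  moreover have "summable (\<lambda>j. norm (1 / real j ^ 2))"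
    using inverse_power_summable[of 2, where ?'a = real] by (simp add: inverse_eq_divide)
  ultimately have sq: "summable q" by (rule summable_comparison_test_bigo[rotated])
  have q0: "q j \<ge> 0" for j using assms by (simp add: q_def)
  have "(\<Sum>m=n..<N. real m ^ 4 / \<sigma> ^ m) \<le> suminf q * real n ^ 4 / \<sigma> ^ n"
    if \<sigma>: "\<sigma> \<ge> \<rho>1" and n: "n \<ge> 1" for \<sigma> n N
  proof -
    have \<sigma>0: "\<sigma> > 0" using \<sigma> assms by simp
    have "(\<Sum>m=n..<N. real m ^ 4 / \<sigma> ^ m) \<le> (\<Sum>m=0 + n..<N + n. real m ^ 4 / \<sigma> ^ m)"
      using \<sigma>0 by (intro sum_mono2) auto
    also have "\<dots> = (\<Sum>j<N. real (j + n) ^ 4 / \<sigma> ^ (j + n))"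
      unfolding sum.shift_bounds_nat_ivl atLeast0LessThan ..
    also have "\<dots> \<le> (\<Sum>j<N. q j * (real n ^ 4 / \<sigma> ^ n))"
    proof (intro sum_mono)
      fix j
      have "real (j + n) \<le> (1 + real j) * real n"
      proof -
        have "real j * 1 \<le> real j * real n" using n by (intro mult_left_mono) auto
        then show ?thesis by (simp add: algebra_simps)
      qed
      then have "real (j + n) ^ 4 \<le> ((1 + real j) * real n) ^ 4" by (intro power_mono) auto
      then have 1: "real (j + n) ^ 4 \<le> (1 + real j) ^ 4 * real n ^ 4" by (simp only: power_mult_distrib)
      have "real (j + n) ^ 4 / \<sigma> ^ (j + n) \<le> (1 + real j) ^ 4 * real n ^ 4 / (\<rho>1 ^ j * \<sigma> ^ n)"
      proof (rule frac_le[OF _ 1])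
        show "\<rho>1 ^ j * \<sigma> ^ n \<le> \<sigma> ^ (j + n)"
          unfolding power_add using \<sigma> \<sigma>0 assms by (intro mult_right_mono power_mono) auto
      qed (use \<sigma>0 assms in auto)
      then show "real (j + n) ^ 4 / \<sigma> ^ (j + n) \<le> q j * (real n ^ 4 / \<sigma> ^ n)"
        by (simp add: q_def)
    qed
    also have "\<dots> = (\<Sum>j<N. q j) * (real n ^ 4 / \<sigma> ^ n)" by (simp only: sum_distrib_right)
    also have "\<dots> \<le> suminf q * (real n ^ 4 / \<sigma> ^ n)"
      using \<sigma>0 q0 by (intro mult_right_mono sum_le_suminf sq) auto
    finally show ?thesis by simp
  qed
  moreover have "suminf q \<ge> 0" using sq q0 by (rule suminf_nonneg)
  ultimately show ?thesis by (intro exI[of _ "suminf q"] conjI allI impI)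
qed

section \<open>Assembly of the two error bounds\<close>

lemma levin_error_algebraic_rate:
  fixes f :: "real \<Rightarrow> complex"
  assumes a: "a > 0" and k: "k > 4" and F: "ac_derivatives a k f F"
  shows "\<exists>C. \<forall>n w. n \<ge> k + 2 \<and> w > 0 \<longrightarrow>
     levin_error a w n f \<le> C * (1 + \<bar>ln w\<bar>) * w powi (-2) *
       (real n * (real n - 1) / (\<Prod>j=3..k. real n - real j))"
proof -
  define p where "p = k - 5"
  have p: "k = p + 5" using k by (simp add: p_def)
  define g where "g = (\<lambda>t. f (a / 2 * (1 - cos t)))"
  define \<beta> where "\<beta> = (\<lambda>m. norm (cheb_coeff a f m))"
  have Ff: "F 0 x = f x" if "x \<in> {0..a}" for x using F that by (simp add: ac_derivatives_def)
  have "(\<lambda>t. F 0 (a / 2 * (1 - cos t))) = g"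
    unfolding g_def using Ff cos_image_interval[OF a] by blast
  with ac_derivatives_periodic_Ck[OF a F, of 0 "p + 4"] have g: "periodic_Ck (p + 4) g" by (simp add: p)
  obtain B where B: "\<And>N. (\<Sum>m<N. (real m ^ (p + 4) * norm (fourier_coeff g m))\<^sup>2) \<le> B"
    using periodic_Ck_fourier_decay[OF g] by blast
  have "continuous_on {0..a} (F 0)"
    using F k unfolding ac_derivatives_def by (intro absolutely_continuous_imp_continuous) auto
  then have cf: "continuous_on {0..a} f"
    by (rule continuous_on_eq) (rule Ff)
  have "g (2 * pi - t) = g t" for t by (simp add: g_def cos_diff)
  then have "cos_coeff g m = fourier_coeff g m" for m
    by (intro cos_coeff_eq_fourier_coeff periodic_Ck_continuous[OF g])
  then have le: "\<beta> m \<le> norm (fourier_coeff g m)" for m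
  proof -
    have "norm (fourier_coeff g m) * 1 \<le> norm (fourier_coeff g m) * pi"
      using pi_ge_two by (intro mult_left_mono) auto
    then have "norm (fourier_coeff g m) / pi \<le> norm (fourier_coeff g m)" by (simp add: divide_le_eq)
    moreover have "\<beta> m \<le> norm (fourier_coeff g m) / pi"
      unfolding \<beta>_def cheb_coeff_def g_def[symmetric] \<open>cos_coeff g m = _\<close>
      by (auto simp: norm_mult norm_divide divide_right_mono)
    ultimately show ?thesis by linarith
  qed
  have \<beta>0: "\<beta> m \<ge> 0" for m by (simp add: \<beta>_def)
  have B\<beta>: "(\<Sum>m<N. (real m ^ (p + 4) * \<beta> m)\<^sup>2) \<le> B" for N
    using \<beta>0 le by (intro order_trans[OF sum_mono B] power_mono mult_left_mono) auto
  note tail = weighted_tail_bound[OF \<beta>0 B\<beta>]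
  \<comment> \<open>The weight m^(5/2) is at least 1 for m >= 1, so the tail bound from n = 1 also
    controls the unweighted sum.\<close>
  have sum\<beta>: "summable \<beta>"
  proof (rule summableI_nonneg_bounded[OF \<beta>0])
    fix N
    have "(\<Sum>m<N. \<beta> m) \<le> (\<Sum>m<Suc N. \<beta> m)" using \<beta>0 by simp
    also have "\<dots> = \<beta> 0 + (\<Sum>m=1..<Suc N. \<beta> m)"
      by (simp add: lessThan_atLeast0 sum.atLeast_Suc_lessThan)
    also have "(\<Sum>m=1..<Suc N. \<beta> m) \<le> (\<Sum>m=1..<Suc N. \<beta> m * (real m ^ 2 * sqrt (real m)))"
    proof (intro sum_mono)
      fix m assume "m \<in> {1..<Suc N}"
      then have "1 * 1 \<le> real m ^ 2 * sqrt (real m)" by (intro mult_mono one_le_power) auto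
      then have "\<beta> m * 1 \<le> \<beta> m * (real m ^ 2 * sqrt (real m))" using \<beta>0 by (intro mult_left_mono) auto
      then show "\<beta> m \<le> \<beta> m * (real m ^ 2 * sqrt (real m))" by simp
    qed
    also have "\<dots> \<le> (B + 2) / 2 / real 1 ^ (p + 1)" by (rule tail) simp
    finally show "(\<Sum>m<N. \<beta> m) \<le> \<beta> 0 + (B + 2) / 2 / real 1 ^ (p + 1)" by simp
  qed
  obtain A where A: "A > 0" and err: "\<forall>w>0. \<forall>n\<ge>2. \<forall>f b S. continuous_on {0..a} f \<and> summable (\<lambda>m. norm (b m)) \<and>
    (\<forall>x\<in>{0..a}. (\<lambda>m. b m * poly (cheb_on a m) (of_real x)) sums f x) \<and>
    (\<forall>N. (\<Sum>m=n..<N. norm (b m) * (real m ^ 2 * sqrt (real m))) \<le> S) \<longrightarrow>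
    levin_error a w n f \<le> A * (1 + \<bar>ln w\<bar>) / w\<^sup>2 * S"
    using levin_error_cheb_series[OF a] by (elim exE conjE) (rule that)
  have B0: "B \<ge> 0" using B[of 0] by simp
  have "levin_error a w n f \<le> A * (B + 2) * (1 + \<bar>ln w\<bar>) * w powi (-2) *
       (real n * (real n - 1) / (\<Prod>j=3..k. real n - real j))"
    if n: "n \<ge> k + 2" and w: "w > 0" for n w
  proof -
    define S where "S = (B + 2) / 2 / real n ^ (p + 1)"
    define P where "P = (\<Prod>j=3..k. real n - real j)"
    have "levin_error a w n f \<le> A * (1 + \<bar>ln w\<bar>) / w\<^sup>2 * S"
    proof (rule err[rule_format, OF w, of n f "cheb_coeff a f" S])
      show "2 \<le> n" using n k by simp
      show "continuous_on {0..a} f \<and> summable (\<lambda>m. norm (cheb_coeff a f m)) \<and>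
        (\<forall>x\<in>{0..a}. (\<lambda>m. cheb_coeff a f m * poly (cheb_on a m) (of_real x)) sums f x) \<and>
        (\<forall>N. (\<Sum>m=n..<N. norm (cheb_coeff a f m) * (real m ^ 2 * sqrt (real m))) \<le> S)"
        using cf sum\<beta> cheb_series_sums[OF a cf] tail[of n] n
        unfolding \<beta>_def S_def by (intro conjI ballI allI) simp_all
    qed
    \<comment> \<open>Only an upper bound for the product is required: its k - 2 = p + 3 factors are
      at most n, and n^2 <= 2 n (n-1). So n^(-(p+1)) is at most twice the stated quotient, which
      absorbs the 1/2 in S.\<close>
    also have "S \<le> (B + 2) * (real n * (real n - 1) / P)"
    proof -
      have "P \<le> (\<Prod>j=3..k. real n)" unfolding P_def using n by (intro prod_mono) auto
      also have "\<dots> = real n ^ (p + 3)" by (simp add: p add.commute)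
      finally have P: "P \<le> real n ^ (p + 1) * real n ^ 2"
        by (simp add: power_add power2_eq_square power3_eq_cube mult_ac)
      have P0: "P > 0" unfolding P_def using n by (intro prod_pos) auto
      have np: "real n ^ (p + 1) > 0" using n k by simp
      have "real n ^ 2 \<le> 2 * (real n * (real n - 1))"
      proof -
        have "real n * 2 \<le> real n * real n" using n k by (intro mult_left_mono) auto
        then show ?thesis by (simp add: power2_eq_square algebra_simps)
      qed
      then have "P \<le> real n ^ (p + 1) * (2 * (real n * (real n - 1)))"
        using P mult_left_mono[of "real n ^ 2" "2 * (real n * (real n - 1))" "real n ^ (p + 1)"] np by linarith
      moreover have "1 / 2 / X \<le> Y / Z" if "Z \<le> X * (2 * Y)" "X > 0" "Z > 0" for X Y Z :: real
        using that by (simp add: field_simps)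
      ultimately have "1 / 2 / real n ^ (p + 1) \<le> real n * (real n - 1) / P"
        using np P0 by blast
      then have "(B + 2) * (1 / 2 / real n ^ (p + 1)) \<le> (B + 2) * (real n * (real n - 1) / P)"
        using B0 by (intro mult_left_mono) auto
      then show ?thesis by (simp add: S_def)
    qed
    then have "A * (1 + \<bar>ln w\<bar>) / w\<^sup>2 * S \<le> A * (1 + \<bar>ln w\<bar>) / w\<^sup>2 * ((B + 2) * (real n * (real n - 1) / P))"
      using A by (intro mult_left_mono) auto
    also have "\<dots> = A * (B + 2) * (1 + \<bar>ln w\<bar>) * w powi (-2) * (real n * (real n - 1) / P)"
      by (simp add: power_int_minus divide_inverse mult_ac)
    finally show ?thesis unfolding P_def .
  qed
  then show ?thesis
    by (intro exI[of _ "A * (B + 2)"] allI impI) (elim conjE)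
qed

text \<open>The constant of the geometric tail blows up as the radius tends to 1, while C is chosen
  before \<rho>. Hence the case split: without any admissible radius there is nothing to show,
  otherwise one admissible \<rho>1 fixes the constant.\<close>

lemma levin_error_geometric_rate:
  fixes f :: "complex \<Rightarrow> complex"
  assumes a: "a > 0"
  shows "\<exists>C. \<forall>\<rho>. \<rho> > 1 \<and> (\<lambda>z. f ((z + 1) * of_real a / 2)) analytic_on bernstein_ellipse \<rho> \<and>
      (\<forall>z\<in>bernstein_ellipse \<rho>. norm (f ((z + 1) * of_real a / 2)) \<le> M) \<longrightarrow>
      (\<forall>n w. n \<ge> 2 \<and> w > 0 \<longrightarrow>
         levin_error a w n (\<lambda>x. f (of_real x)) \<le>
           C * (1 + \<bar>ln w\<bar>) * w powi (-2) * real n ^ 4 * \<rho> powi (- (int n - 1)))"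
    (is "\<exists>C. \<forall>\<rho>. ?ok \<rho> \<longrightarrow> ?bound C \<rho>")
proof (cases "\<exists>\<rho>1. ?ok \<rho>1")
  case False
  then show ?thesis by blast
next
  case True
  then obtain \<rho>1 where ok1: "?ok \<rho>1" by blast
  obtain A where A: "A > 0" and err: "\<forall>w>0. \<forall>n\<ge>2. \<forall>f b S. continuous_on {0..a} f \<and> summable (\<lambda>m. norm (b m)) \<and>
    (\<forall>x\<in>{0..a}. (\<lambda>m. b m * poly (cheb_on a m) (of_real x)) sums f x) \<and>
    (\<forall>N. (\<Sum>m=n..<N. norm (b m) * (real m ^ 2 * sqrt (real m))) \<le> S) \<longrightarrow>
    levin_error a w n f \<le> A * (1 + \<bar>ln w\<bar>) / w\<^sup>2 * S"
    using levin_error_cheb_series[OF a] by (elim exE conjE) (rule that)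
  have \<rho>1: "\<rho>1 > 1" using ok1 by blast
  obtain K where K: "K \<ge> 0" and geo: "\<And>\<sigma> n N. \<sigma> \<ge> \<rho>1 \<Longrightarrow> n \<ge> 1 \<Longrightarrow>
      (\<Sum>m=n..<N. real m ^ 4 / \<sigma> ^ m) \<le> K * real n ^ 4 / \<sigma> ^ n"
    using geometric_tail_bound[OF \<rho>1] by blast
  let ?f = "\<lambda>x::real. f (of_real x)"
  define \<beta> where "\<beta> = (\<lambda>m. norm (cheb_coeff a ?f m))"
  have "0 \<in> bernstein_ellipse \<rho>1" by (simp add: bernstein_ellipse_def)
  then have "norm (f ((0 + 1) * of_real a / 2)) \<le> M" using ok1 by blast
  then have M: "M \<ge> 0" using norm_ge_zero order_trans by blast
  have dec: "\<beta> m \<le> 2 * M / \<sigma> ^ m" if "?ok \<sigma>" for \<sigma> m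
    unfolding \<beta>_def using that by (intro cheb_coeff_analytic_bound(2)[OF a]) auto
  have cf: "continuous_on {0..a} ?f"
    using ok1 by (intro cheb_coeff_analytic_bound(1)[OF a, of \<rho>1 f M]) auto
  have sum\<beta>: "summable \<beta>"
  proof (rule summable_comparison_test')
    show "summable (\<lambda>m. 2 * M * (1 / \<rho>1) ^ m)"
      using \<rho>1 by (intro summable_mult summable_geometric) auto
    show "norm (\<beta> m) \<le> 2 * M * (1 / \<rho>1) ^ m" if "m \<ge> 0" for m
      using dec[OF ok1, of m] by (simp add: \<beta>_def power_divide)
  qed
  have main: "levin_error a w n ?f \<le> A * (2 * M * K) * (1 + \<bar>ln w\<bar>) * w powi (-2) * real n ^ 4 * \<rho> powi (- (int n - 1))"
    if ok: "?ok \<rho>" and n: "n \<ge> 2" and w: "w > 0" for \<rho> n w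
  proof -
    \<comment> \<open>The larger radius is admissible too. Being at least \<rho>1 it shares the tail
      constant, and being at least \<rho> it decays no more slowly than required.\<close>
    define \<sigma> where "\<sigma> = max \<rho> \<rho>1"
    have "\<sigma> = \<rho> \<or> \<sigma> = \<rho>1" by (auto simp: \<sigma>_def max_def)
    then have ok\<sigma>: "?ok \<sigma>"
    proof
      assume "\<sigma> = \<rho>"
      show ?thesis unfolding \<open>\<sigma> = \<rho>\<close> by (rule ok)
    next
      assume "\<sigma> = \<rho>1"
      show ?thesis unfolding \<open>\<sigma> = \<rho>1\<close> by (rule ok1)
    qed
    have \<sigma>: "\<sigma> \<ge> \<rho>1" "\<sigma> \<ge> \<rho>" "\<sigma> > 1" "\<rho> > 1" using conjunct1[OF ok] \<rho>1 unfolding \<sigma>_def by simp_all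
    define S where "S = 2 * M * (K * real n ^ 4 / \<sigma> ^ n)"
    have S: "(\<Sum>m=n..<N. \<beta> m * (real m ^ 2 * sqrt (real m))) \<le> S" for N
    proof -
      have "(\<Sum>m=n..<N. \<beta> m * (real m ^ 2 * sqrt (real m))) \<le> (\<Sum>m=n..<N. 2 * M * (real m ^ 4 / \<sigma> ^ m))"
      proof (intro sum_mono)
        fix m
        have "\<beta> m * (real m ^ 2 * sqrt (real m)) \<le> 2 * M / \<sigma> ^ m * real m ^ 4"
          using dec[OF ok\<sigma>] sq_sqrt_le_power4 M \<sigma> by (intro mult_mono) auto
        then show "\<beta> m * (real m ^ 2 * sqrt (real m)) \<le> 2 * M * (real m ^ 4 / \<sigma> ^ m)" by simp
      qed
      also have "\<dots> = 2 * M * (\<Sum>m=n..<N. real m ^ 4 / \<sigma> ^ m)" by (simp only: sum_distrib_left)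
      also have "\<dots> \<le> S" unfolding S_def using M n \<sigma> by (intro mult_left_mono geo) auto
      finally show ?thesis .
    qed
    have "levin_error a w n ?f \<le> A * (1 + \<bar>ln w\<bar>) / w\<^sup>2 * S"
    proof (rule err[rule_format, OF w n, of ?f "cheb_coeff a ?f" S])
      show "continuous_on {0..a} ?f \<and> summable (\<lambda>m. norm (cheb_coeff a ?f m)) \<and>
        (\<forall>x\<in>{0..a}. (\<lambda>m. cheb_coeff a ?f m * poly (cheb_on a m) (of_real x)) sums ?f x) \<and>
        (\<forall>N. (\<Sum>m=n..<N. norm (cheb_coeff a ?f m) * (real m ^ 2 * sqrt (real m))) \<le> S)"
        using cf sum\<beta> cheb_series_sums[OF a cf] S unfolding \<beta>_def by blast
    qed
    also have "S \<le> 2 * M * (K * real n ^ 4 / \<rho> ^ (n - 1))"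
    proof -
      have "\<rho> ^ (n - 1) \<le> \<sigma> ^ (n - 1)" using \<sigma> by (intro power_mono) auto
      also have "\<dots> \<le> \<sigma> ^ n" using \<sigma> by (intro power_increasing) auto
      finally show ?thesis
        unfolding S_def using M K \<sigma> by (intro mult_left_mono divide_left_mono mult_pos_pos zero_less_power) auto
    qed
    then have "A * (1 + \<bar>ln w\<bar>) / w\<^sup>2 * S \<le> A * (1 + \<bar>ln w\<bar>) / w\<^sup>2 * (2 * M * (K * real n ^ 4 / \<rho> ^ (n - 1)))"
      using A by (intro mult_left_mono) auto
    also have "\<dots> = A * (2 * M * K) * (1 + \<bar>ln w\<bar>) * w powi (-2) * real n ^ 4 * inverse (\<rho> ^ (n - 1))"
      by (simp add: power_int_minus divide_inverse mult_ac)
    also have "inverse (\<rho> ^ (n - 1)) = \<rho> powi (- (int n - 1))"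
    proof -
      have "int n - 1 = int (n - 1)" using n by simp
      then show ?thesis by (simp only: power_int_minus power_int_of_nat)
    qed
    finally show ?thesis .
  qed
  show ?thesis
  proof (intro exI[of _ "A * (2 * M * K)"] allI impI)
    fix \<rho> w :: real and n :: nat
    assume "?ok \<rho>" and nw: "n \<ge> 2 \<and> w > 0"
    from main[OF this(1) conjunct1[OF nw] conjunct2[OF nw]]
    show "levin_error a w n ?f \<le> A * (2 * M * K) * (1 + \<bar>ln w\<bar>) * w powi (-2) * real n ^ 4 * \<rho> powi (- (int n - 1))" .
  qed
qed

theorem theorem3p5:
  fixes a :: real
  assumes "a > 0"
  shows
    "(\<forall>(f :: real \<Rightarrow> complex) (F :: nat \<Rightarrow> real \<Rightarrow> complex) (k :: nat) (V :: real).
        k \<ge> 1 \<and> k > 4 \<and> ac_derivatives a k f F \<and>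
        ((\<lambda>t. norm (F k t) / sqrt (a * t - t\<^sup>2)) has_integral V) {0..a} \<longrightarrow>
        (\<exists>C :: real. \<forall>(n :: nat) (w :: real). n \<ge> k + 2 \<and> w > 0 \<longrightarrow>
           levin_error a w n f \<le>
             C * (1 + \<bar>ln w\<bar>) * w powi (-2) *
             (real n * (real n - 1) / (\<Prod>j=3..k. real n - real j))))
     \<and>
     (\<forall>(f :: complex \<Rightarrow> complex) (M :: real).
        \<exists>C :: real. \<forall>\<rho> :: real.
          \<rho> > 1 \<and>
          (\<lambda>z. f ((z + 1) * of_real a / 2)) analytic_on bernstein_ellipse \<rho> \<and>
          (\<forall>z\<in>bernstein_ellipse \<rho>. norm (f ((z + 1) * of_real a / 2)) \<le> M) \<longrightarrow>
          (\<forall>(n :: nat) (w :: real). n \<ge> 2 \<and> w > 0 \<longrightarrow>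
             levin_error a w n (\<lambda>x. f (of_real x)) \<le>
               C * (1 + \<bar>ln w\<bar>) * w powi (-2) * real n ^ 4 * \<rho> powi (- (int n - 1))))"
proof (intro conjI allI impI)
  fix f :: "real \<Rightarrow> complex" and F k V
  assume "k \<ge> 1 \<and> k > 4 \<and> ac_derivatives a k f F \<and>
        ((\<lambda>t. norm (F k t) / sqrt (a * t - t\<^sup>2)) has_integral V) {0..a}"
  then show "\<exists>C. \<forall>n w. n \<ge> k + 2 \<and> w > 0 \<longrightarrow>
           levin_error a w n f \<le>
             C * (1 + \<bar>ln w\<bar>) * w powi (-2) *
             (real n * (real n - 1) / (\<Prod>j=3..k. real n - real j))"
    by (intro levin_error_algebraic_rate[OF assms]) auto
qed (rule levin_error_geometric_rate[OF assms])

end
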